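(* Let $q\ge7$ be a prime power and $p$ an odd prime, let $E/\mathbb{F}_q$ be an elliptic curve with $E(\mathbb{F}_q)\cong\mathbb{Z}_p\oplus\mathbb{Z}_p$, $\mathcal{P}=E(\mathbb{F}_q)$, let $Q\in E(\mathbb{F}_{q^2})\setminus E(\mathbb{F}_q)$ satisfy $Q\oplus\phi(Q)=\infty$, let $k$ be an integer with $p\mid k$ and $0<k<p^2/2$, and let $D=k(Q+\phi(Q))$, so that $\mathcal{C}=\mathcal{C}(E,\mathcal{P},D)$ is NMDS with parameters $[p^2,2k,p^2-2k]$. Then $$A_{p^2-2k}=A^\perp_{2k}=\frac{(q-1)\left[\binom{p^2}{2k}+(p^2-1)\binom{p}{2k/p}\right]}{p^2},$$ for $s\in\{1,\dots,2k\}$ $$A_{p^2-2k+s}=\binom{p^2}{2k-s}\sum_{j=0}^{s-1}(-1)^j\binom{p^2-2k+s}{j}(q^{s-j}-1)+(-1)^s\binom{2k}{s}A_{p^2-2k},$$ and for $s\in\{1,\dots,p^2-2k\}$ $$A^\perp_{2k+s}=\binom{p^2}{2k+s}\sum_{j=0}^{s-1}(-1)^j\binom{2k+s}{j}(q^{s-j}-1)+(-1)^s\binom{p^2-2k}{s}A^\perp_{2k}.$$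
   Context: $A_w$ (resp. $A^\perp_w$) denotes the number of codewords of Hamming weight $w$ in $\mathcal{C}$ (resp. in its dual $\mathcal{C}^\perp$). Elliptic curve $E/\mathbb{F}_q$: nonsingular Weierstrass curve with point at infinity $\infty$ as identity of the group law $\oplus$; $\phi$ is the $q$-Frobenius $(x,y)\mapsto(x^q,y^q)$. For $\mathcal{P}=\{P_1,\dots,P_n\}\subseteq E(\mathbb{F}_q)$ and a Galois-invariant divisor $D$ with support disjoint from $\mathcal{P}$ and $0<\deg D<n$, $\mathcal{C}(E,\mathcal{P},D)=\{(f(P_1),\dots,f(P_n)):f\in\mathscr{L}(D)\}$ where $\mathscr{L}(D)=\{f\in\mathbb{F}_q(E)^\times:\operatorname{div}(f)\ge-D\}\cup\{0\}$. NMDS: the code and its dual both have parameters of the form $[n,k,n-k]$. *)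

theory Defs
  imports "HOL-Computational_Algebra.Polynomial" "HOL-Algebra.Elementary_Groups"
begin

text \<open>The ambient field 'b is assumed algebraically closed; F_{q^m} is realised inside it as
  the set of roots of X^(q^m) - X.\<close>

definition alg_closed_field :: "'b::field itself \<Rightarrow> bool" where
  "alg_closed_field _ \<longleftrightarrow> (\<forall>f::'b poly. degree f > 0 \<longrightarrow> (\<exists>x. poly f x = 0))"

definition Fsub :: "nat \<Rightarrow> 'b::field set" where
  "Fsub Q = {x. x ^ Q = x}"

definition weq :: "(nat \<Rightarrow> 'b::field) \<Rightarrow> 'b \<Rightarrow> 'b \<Rightarrow> 'b" where
  "weq a x y = y^2 + a 1 * x * y + a 3 * y - (x^3 + a 2 * x^2 + a 4 * x + a 6)"

definition on_aff :: "(nat \<Rightarrow> 'b::field) \<Rightarrow> 'b \<Rightarrow> 'b \<Rightarrow> bool" where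
  "on_aff a x y \<longleftrightarrow> weq a x y = 0"

text \<open>Nonsingularity: no affine point where the equation and both partial derivatives vanish
  (the point at infinity of a Weierstrass cubic is always nonsingular).\<close>
definition nonsingular :: "(nat \<Rightarrow> 'b::field) \<Rightarrow> bool" where
  "nonsingular a \<longleftrightarrow> \<not> (\<exists>x y. weq a x y = 0
      \<and> a 1 * y - 3 * x^2 - 2 * a 2 * x - a 4 = 0
      \<and> 2 * y + a 1 * x + a 3 = 0)"

datatype 'b point = Inf | Aff 'b 'b

definition on_curve :: "(nat \<Rightarrow> 'b::field) \<Rightarrow> 'b point \<Rightarrow> bool" where
  "on_curve a P = (case P of Inf \<Rightarrow> True | Aff x y \<Rightarrow> on_aff a x y)"

definition rat_points :: "(nat \<Rightarrow> 'b::field) \<Rightarrow> nat \<Rightarrow> 'b point set" where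
  "rat_points a Q = {Inf} \<union> {Aff x y | x y. on_aff a x y \<and> x \<in> Fsub Q \<and> y \<in> Fsub Q}"

definition frob :: "nat \<Rightarrow> 'b::field point \<Rightarrow> 'b point" where
  "frob q P = (case P of Inf \<Rightarrow> Inf | Aff x y \<Rightarrow> Aff (x ^ q) (y ^ q))"

text \<open>Chord-tangent group law (Silverman, Alg. III.2.3).\<close>
definition ec_add :: "(nat \<Rightarrow> 'b::field) \<Rightarrow> 'b point \<Rightarrow> 'b point \<Rightarrow> 'b point" where
  "ec_add a P R = (case P of Inf \<Rightarrow> R | Aff x1 y1 \<Rightarrow>
     (case R of Inf \<Rightarrow> P | Aff x2 y2 \<Rightarrow>
       (if x1 = x2 \<and> y1 + y2 + a 1 * x2 + a 3 = 0 then Inf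
        else let l = (if x1 \<noteq> x2 then (y2 - y1) / (x2 - x1)
                      else (3 * x1^2 + 2 * a 2 * x1 + a 4 - a 1 * y1) / (2 * y1 + a 1 * x1 + a 3));
                 v = y1 - l * x1;
                 x3 = l^2 + a 1 * l - a 2 - x1 - x2
             in Aff x3 (- (l + a 1) * x3 - v - a 3))))"

definition ec_group :: "(nat \<Rightarrow> 'b::field) \<Rightarrow> nat \<Rightarrow> 'b point monoid" where
  "ec_group a Q = \<lparr>carrier = rat_points a Q, monoid.mult = ec_add a, one = Inf\<rparr>"

text \<open>Bivariate polynomials: 'b poly poly, outer variable y (resp. w), inner x (resp. u).\<close>
definition eval2 :: "'b::field poly poly \<Rightarrow> 'b \<Rightarrow> 'b \<Rightarrow> 'b" where
  "eval2 G x y = poly (map_poly (\<lambda>c. poly c x) G) y"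

definition coeffs_in :: "'b::field poly poly \<Rightarrow> 'b set \<Rightarrow> bool" where
  "coeffs_in G S \<longleftrightarrow> (\<forall>i j. coeff (coeff G i) j \<in> S)"

text \<open>A rational function on E is represented by g(x,y)/h(x,y); it is valid if h does not
  vanish identically on E.\<close>
type_synonym 'b rfun = "'b poly poly \<times> 'b poly poly"

definition rf_valid :: "(nat \<Rightarrow> 'b::field) \<Rightarrow> 'b rfun \<Rightarrow> bool" where
  "rf_valid a f \<longleftrightarrow> (\<exists>x y. on_aff a x y \<and> eval2 (snd f) x y \<noteq> 0)"

definition rf_mult :: "'b::field rfun \<Rightarrow> 'b rfun \<Rightarrow> 'b rfun" where
  "rf_mult f g = (fst f * fst g, snd f * snd g)"

definition rf_ipow :: "'b::field rfun \<Rightarrow> int \<Rightarrow> 'b rfun" where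
  "rf_ipow f n = (if n \<ge> 0 then (fst f ^ nat n, snd f ^ nat n)
                  else (snd f ^ nat (- n), fst f ^ nat (- n)))"

definition rf_same :: "(nat \<Rightarrow> 'b::field) \<Rightarrow> 'b rfun \<Rightarrow> 'b rfun \<Rightarrow> bool" where
  "rf_same a f g \<longleftrightarrow> (\<forall>x y. on_aff a x y \<and> eval2 (snd f) x y \<noteq> 0 \<and> eval2 (snd g) x y \<noteq> 0 \<longrightarrow>
      eval2 (fst f) x y / eval2 (snd f) x y = eval2 (fst g) x y / eval2 (snd g) x y)"

text \<open>f is regular at the point P with value c.  At an affine point: some representative has
  nonvanishing denominator there.  At infinity = (0:1:0): use the chart u = X/Y = x/y,
  w = Z/Y = 1/y, in which infinity is (u,w) = (0,0).\<close>
definition regular_with :: "(nat \<Rightarrow> 'b::field) \<Rightarrow> 'b point \<Rightarrow> 'b rfun \<Rightarrow> 'b \<Rightarrow> bool" where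
  "regular_with a P f c = (case P of
     Aff x0 y0 \<Rightarrow> (\<exists>g h. eval2 h x0 y0 \<noteq> 0 \<and> c = eval2 g x0 y0 / eval2 h x0 y0 \<and> rf_same a f (g, h))
   | Inf \<Rightarrow> (\<exists>G H. eval2 H 0 0 \<noteq> 0 \<and> c = eval2 G 0 0 / eval2 H 0 0 \<and>
        (\<forall>x y. on_aff a x y \<and> y \<noteq> 0 \<and> eval2 (snd f) x y \<noteq> 0 \<and> eval2 H (x / y) (1 / y) \<noteq> 0 \<longrightarrow>
           eval2 (fst f) x y / eval2 (snd f) x y = eval2 G (x / y) (1 / y) / eval2 H (x / y) (1 / y))))"

definition regular_at :: "(nat \<Rightarrow> 'b::field) \<Rightarrow> 'b point \<Rightarrow> 'b rfun \<Rightarrow> bool" where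
  "regular_at a P f \<longleftrightarrow> (\<exists>c. regular_with a P f c)"

definition value_at :: "(nat \<Rightarrow> 'b::field) \<Rightarrow> 'b point \<Rightarrow> 'b rfun \<Rightarrow> 'b" where
  "value_at a P f = (THE c. regular_with a P f c)"

definition in_maxideal :: "(nat \<Rightarrow> 'b::field) \<Rightarrow> 'b point \<Rightarrow> 'b rfun \<Rightarrow> bool" where
  "in_maxideal a P f \<longleftrightarrow> regular_with a P f 0"

definition uniformizer :: "(nat \<Rightarrow> 'b::field) \<Rightarrow> 'b point \<Rightarrow> 'b rfun \<Rightarrow> bool" where
  "uniformizer a P t \<longleftrightarrow> rf_valid a t \<and> in_maxideal a P t \<and>
     (\<forall>f. rf_valid a f \<and> in_maxideal a P f \<longrightarrow>
        (\<exists>r. rf_valid a r \<and> regular_at a P r \<and> rf_same a f (rf_mult t r)))"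

definition ord_ge :: "(nat \<Rightarrow> 'b::field) \<Rightarrow> 'b point \<Rightarrow> 'b rfun \<Rightarrow> int \<Rightarrow> bool" where
  "ord_ge a P f m \<longleftrightarrow> (\<exists>t. uniformizer a P t \<and> regular_at a P (rf_mult f (rf_ipow t (- m))))"

text \<open>Riemann-Roch space L(k(Q + phi Q)) over F_q (representatives with F_q coefficients):
  f regular at every point of E over the algebraically closed field other than Q, phi Q,
  and ord_Q f \<ge> -k, ord_{phi Q} f \<ge> -k.\<close>
definition LD :: "(nat \<Rightarrow> 'b::field) \<Rightarrow> nat \<Rightarrow> 'b point \<Rightarrow> nat \<Rightarrow> 'b rfun set" where
  "LD a q Q k = {f. rf_valid a f \<and> coeffs_in (fst f) (Fsub q) \<and> coeffs_in (snd f) (Fsub q) \<and>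
      (\<forall>P. on_curve a P \<and> P \<noteq> Q \<and> P \<noteq> frob q Q \<longrightarrow> regular_at a P f) \<and>
      ord_ge a Q f (- int k) \<and> ord_ge a (frob q Q) f (- int k)}"

definition AG_code :: "(nat \<Rightarrow> 'b::field) \<Rightarrow> nat \<Rightarrow> 'b point set \<Rightarrow> 'b point \<Rightarrow> nat \<Rightarrow> ('b point \<Rightarrow> 'b) set" where
  "AG_code a q Ps Q k = {(\<lambda>P. if P \<in> Ps then value_at a P f else 0) | f. f \<in> LD a q Q k}"

definition dual_code :: "'b::field set \<Rightarrow> 'i set \<Rightarrow> ('i \<Rightarrow> 'b) set \<Rightarrow> ('i \<Rightarrow> 'b) set" where
  "dual_code F I C = {v. (\<forall>i. i \<notin> I \<longrightarrow> v i = 0) \<and> (\<forall>i\<in>I. v i \<in> F) \<and>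
      (\<forall>c\<in>C. (\<Sum>i\<in>I. v i * c i) = 0)}"

definition hweight :: "'i set \<Rightarrow> ('i \<Rightarrow> 'b::zero) \<Rightarrow> nat" where
  "hweight I c = card {i\<in>I. c i \<noteq> 0}"

definition wdist :: "'i set \<Rightarrow> ('i \<Rightarrow> 'b::zero) set \<Rightarrow> nat \<Rightarrow> nat" where
  "wdist I C w = card {c\<in>C. hweight I c = w}"

end

theory Submission
  imports Defs "HOL-Computational_Algebra.Primes"
begin

text \<open>
  Since \<open>Q + \<phi>(Q) = 0\<close>, the points \<open>Q\<close> and \<open>\<phi>(Q)\<close> are opposite, so they share a rational
  \<open>x\<close>-coordinate \<open>x0\<close>, and multiplication by \<open>(x - x0)^k\<close> identifies the Riemann-Roch space with the
  functions \<open>A(x) + B(x) y\<close> having a pole of order at most \<open>2k\<close> at infinity. The identities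
  \<open>I_P I_{-P} = (x - x_P)\<close> and \<open>I_P I_R I_{-(P + R)} = (line)\<close> between point ideals show that such a
  function has at most \<open>2k\<close> zeros on a set \<open>T\<close> of rational points, and that \<open>2k\<close> zeros occur exactly
  when the points of \<open>T\<close> add up to zero. Hence the number of codewords vanishing on \<open>T\<close> is known for
  every \<open>T\<close>, and double counting of orthogonal pairs gives the same for the dual code; binomial
  inversion then yields both weight distributions. The zero-sum subsets are counted with the
  characters of \<open>Z_p \<times> Z_p\<close>, using \<open>\<Prod>_j (1 + \<omega>^j X) = 1 + X^p\<close> for odd \<open>p\<close>.
\<close>

section \<open>The coordinate ring\<close>

text \<open>Why a zero count detects the group law: chord and vertical-line steps turn the product
  of the point ideals of \<open>T\<close> into the unit ideal or into the ideal of one point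
  \<open>S\<close>, with pole orders tracked throughout. In the second case a function with pole
  order equal to its number of prescribed zeros would leave a function that vanishes at
  \<open>S\<close> and has pole order 1. The orders 2 deg A and 2 deg B + 3 of A and B y never give
  1 (this is genus one), so the sum must be the identity. The ideal identities are hard to check by
  explicit cofactors. The Nullstellensatz reduces each of them to finding multipliers without a
  common zero, and nonsingularity excludes the common zero. The number of codewords vanishing on
  \<open>T\<close> depends only on the size of \<open>T\<close>, except for size 2k, where it
  depends on whether \<open>T\<close> has sum zero. So one unknown, the number of zero-sum subsets
  of size 2k, governs both distributions. The condition p | k makes X^(2k) one of the powers
  occurring in (1 + X^p)^p, which is where the binomial of p over 2k/p comes from.\<close>

lemma eval2_0 [simp]: "eval2 0 x y = 0"
  by (simp add: eval2_def)

lemma eval2_pCons [simp]: "eval2 (pCons c G) x y = poly c x + y * eval2 G x y"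
proof (cases "c = 0 \<and> G = 0")
  case False
  then show ?thesis by (simp add: eval2_def map_poly_pCons)
qed (simp add: eval2_def)

lemma eval2_conv_poly: "eval2 G x y = poly (poly G [:y:]) x"
  by (induction G) (simp_all add: algebra_simps)

lemma eval2_add [simp]: "eval2 (F + G) x y = eval2 F x y + eval2 G x y"
  and eval2_diff [simp]: "eval2 (F - G) x y = eval2 F x y - eval2 G x y"
  and eval2_minus [simp]: "eval2 (- F) x y = - eval2 F x y"
  and eval2_mult [simp]: "eval2 (F * G) x y = eval2 F x y * eval2 G x y"
  and eval2_smult [simp]: "eval2 (smult c F) x y = poly c x * eval2 F x y"
  and eval2_power [simp]: "eval2 (F ^ n) x y = eval2 F x y ^ n"
  and eval2_1 [simp]: "eval2 1 x y = 1"
  by (simp_all add: eval2_conv_poly)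

text \<open>Synthetic division by x - x0 in every coefficient, combined with division by y - y0. It
  turns a zero at (x0, y0) into membership in the ideal generated by x - x0 and y - y0.\<close>

lemma eval2_Taylor: "\<exists>G H. F = [:[:eval2 F x0 y0:]:] + [:[:-x0,1:]:] * G + [:[:-y0:],1:] * H"
proof (induction F)
  case 0
  show ?case by (intro exI[of _ 0]) simp
next
  case (pCons c F)
  then obtain G H where F: "F = [:[:eval2 F x0 y0:]:] + [:[:-x0,1:]:] * G + [:[:-y0:],1:] * H"
    by blast
  have c: "c = [:poly c x0:] + [:-x0,1:] * synthetic_div c x0"
    by (metis add.commute synthetic_div_correct')
  let ?y = "[:[:-y0:],1:] :: 'a poly poly" and ?x = "[:[:-x0,1:]:] :: 'a poly poly"
  have "pCons c F = [:c:] + [:0,1:] * F" by simp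
  also have "[:c:] = [:[:poly c x0:]:] + ?x * [:synthetic_div c x0:]"
    by (subst c) (simp add: add.commute)
  also have "[:0,1:] = ?y + [:[:y0:]:]" by simp
  finally have 1: "pCons c F = [:[:poly c x0:]:] + ?x * [:synthetic_div c x0:] + (?y + [:[:y0:]:]) * F" .
  have "[:[:y0:]:] * F = [:[:y0:]:] * ([:[:eval2 F x0 y0:]:] + ?x * G + ?y * H)"
    using F by simp
  with 1 have "pCons c F = [:[:poly c x0:]:] + [:[:y0:]:] * [:[:eval2 F x0 y0:]:]
      + ?x * ([:synthetic_div c x0:] + [:[:y0:]:] * G) + ?y * (F + [:[:y0:]:] * H)"
    by (simp only: ring_distribs ac_simps)
  moreover have "[:[:eval2 (pCons c F) x0 y0:]:] = [:[:poly c x0:]:] + [:[:y0:]:] * [:[:eval2 F x0 y0:]:]"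
    by simp
  ultimately show ?case by metis
qed

section \<open>Normal forms A + B y, the norm, and the pole order at infinity\<close>

locale weierstrass =
  fixes a :: "nat \<Rightarrow> 'b::field"
  assumes closed: "degree (f :: 'b poly) > 0 \<Longrightarrow> \<exists>x. poly f x = 0"
begin

definition cub :: "'b poly" where "cub = [:a 6, a 4, a 2, 1:]"
definition lin :: "'b poly" where "lin = [:a 3, a 1:]"

text \<open>Equality in the coordinate ring. Being pointwise on the curve, it matches the way
  rational functions are compared; \<open>reduce\<close> and \<open>reduce_unique\<close> give each
  class exactly one representative A + B y.\<close>

definition eqE :: "'b poly poly \<Rightarrow> 'b poly poly \<Rightarrow> bool" where
  "eqE F G \<longleftrightarrow> (\<forall>x y. on_aff a x y \<longrightarrow> eval2 F x y = eval2 G x y)"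

definition negy :: "'b \<Rightarrow> 'b \<Rightarrow> 'b" where "negy x y = - y - a 1 * x - a 3"

text \<open>The norm of A + B y over the polynomials in x, i.e. its product with the conjugate under
  y -> - y - \<open>lin\<close>, simplified by the curve equation.\<close>

definition nrmAB :: "'b poly \<Rightarrow> 'b poly \<Rightarrow> 'b poly" where
  "nrmAB A B = A\<^sup>2 - A * B * lin - B\<^sup>2 * cub"

text \<open>Euclid's argument: over a finite field, one plus the product of all x - c would be a
  nonconstant polynomial without a root.\<close>

lemma infinite_UNIV: "infinite (UNIV :: 'b set)"
proof
  assume fin: "finite (UNIV :: 'b set)"
  let ?f = "(\<Prod>x\<in>UNIV. [:-x,1:]) + 1 :: 'b poly"
  have d: "degree (\<Prod>x\<in>(UNIV::'b set). [:-x,1:]) = card (UNIV :: 'b set)"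
    by (subst degree_prod_eq_sum_degree) auto
  have "card (UNIV :: 'b set) > 0" using fin by (simp add: card_gt_0_iff)
  then have "degree ?f > 0" using d by (metis degree_1 degree_add_eq_left)
  then obtain x where "poly ?f x = 0" using closed by blast
  moreover have "poly (\<Prod>x\<in>UNIV. [:-x,1:]) x = 0" using fin by (auto simp: poly_prod)
  ultimately show False by simp
qed

lemma poly_eqI_all: "(\<And>x. poly f x = poly g (x::'b)) \<Longrightarrow> f = g"
  using poly_roots_finite[of "f - g"] infinite_UNIV by auto

lemma on_aff_iff: "on_aff a x y \<longleftrightarrow> y^2 = poly cub x - poly lin x * y"
  by (auto simp: on_aff_def weq_def cub_def lin_def algebra_simps power2_eq_square power3_eq_cube)

lemma ex_point: "\<exists>y. on_aff a x y"
proof -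
  have "degree [:- poly cub x, poly lin x, 1:] > 0" by simp
  from closed[OF this] obtain y where "poly [:- poly cub x, poly lin x, 1:] y = 0" by blast
  then show ?thesis
    by (auto intro!: exI[of _ y] simp: on_aff_iff power2_eq_square algebra_simps add_eq_0_iff eq_neg_iff_add_eq_0)
qed

lemma on_aff_negy: "on_aff a x (negy x y) \<longleftrightarrow> on_aff a x y"
  by (simp add: on_aff_def weq_def negy_def algebra_simps power2_eq_square)

lemma negy_negy [simp]: "negy x (negy x y) = y"
  by (simp add: negy_def)

lemma negy_lin: "negy x y = - y - poly lin x"
  by (simp add: negy_def lin_def algebra_simps)

lemma same_x: "on_aff a x y \<Longrightarrow> on_aff a x y' \<Longrightarrow> y' = y \<or> y' = negy x y"
proof -
  assume h: "on_aff a x y" "on_aff a x y'"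
  then have "(y' - y) * (y' - negy x y) = 0"
    by (simp add: on_aff_iff negy_lin algebra_simps power2_eq_square)
  then show ?thesis by auto
qed

lemma eqE_refl [simp]: "eqE F F" by (simp add: eqE_def)
lemma eqE_sym: "eqE F G \<Longrightarrow> eqE G F" by (simp add: eqE_def)
lemma eqE_trans [trans]: "eqE F G \<Longrightarrow> eqE G H \<Longrightarrow> eqE F H" by (simp add: eqE_def)
lemma eqE_add: "eqE F G \<Longrightarrow> eqE F' G' \<Longrightarrow> eqE (F + F') (G + G')" by (simp add: eqE_def)
lemma eqE_mult: "eqE F G \<Longrightarrow> eqE F' G' \<Longrightarrow> eqE (F * F') (G * G')" by (simp add: eqE_def)
lemma eqE_power: "eqE F G \<Longrightarrow> eqE (F ^ n) (G ^ n)" by (simp add: eqE_def)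

lemma reduce: "\<exists>A B. eqE F [:A, B:]"
proof (induction F)
  case 0
  show ?case by (intro exI[of _ 0]) simp
next
  case (pCons c F)
  then obtain A B where AB: "eqE F [:A, B:]" by blast
  have "eqE (pCons c F) [:c + B * cub, A - B * lin:]"
    unfolding eqE_def
  proof safe
    fix x y assume P: "on_aff a x y"
    have "eval2 (pCons c F) x y = poly c x + poly A x * y + poly B x * y^2"
      using AB P by (simp add: eqE_def algebra_simps power2_eq_square)
    also have "\<dots> = eval2 [:c + B * cub, A - B * lin:] x y"
      by (simp only: P[unfolded on_aff_iff]) (simp add: algebra_simps)
    finally show "eval2 (pCons c F) x y = eval2 [:c + B * cub, A - B * lin:] x y" .
  qed
  then show ?case by blast
qed

lemma poly_nrmAB:
  assumes "on_aff a x y"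
  shows "poly (nrmAB A B) x = eval2 [:A, B:] x y * eval2 [:A, B:] x (negy x y)"
proof -
  have "eval2 [:A, B:] x y * eval2 [:A, B:] x (negy x y) =
     (poly A x)^2 - poly A x * poly B x * poly lin x - (poly B x)^2 * (y^2 + poly lin x * y)"
    by (simp add: negy_lin algebra_simps power2_eq_square)
  also have "y^2 + poly lin x * y = poly cub x" using assms by (simp add: on_aff_iff)
  finally show ?thesis by (simp add: nrmAB_def)
qed

text \<open>The choice of the normal form is harmless: \<open>poly_nrm\<close> determines the value
  of the norm at every x, because every x lies under some point of the curve.\<close>

definition nrm :: "'b poly poly \<Rightarrow> 'b poly" where
  "nrm F = (let AB = (SOME AB. eqE F [:fst AB, snd AB:]) in nrmAB (fst AB) (snd AB))"

lemma poly_nrm: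
  assumes "on_aff a x y"
  shows "poly (nrm F) x = eval2 F x y * eval2 F x (negy x y)"
proof -
  define AB where "AB = (SOME AB. eqE F [:fst AB, snd AB:])"
  have "\<exists>AB. eqE F [:fst AB, snd AB:]" using reduce[of F] by auto
  then have AB: "eqE F [:fst AB, snd AB:]" unfolding AB_def by (rule someI_ex)
  show ?thesis using poly_nrmAB[OF assms, of "fst AB" "snd AB"] AB assms
    unfolding nrm_def Let_def AB_def[symmetric] by (simp add: eqE_def on_aff_negy)
qed

lemma nrm_mult: "nrm (F * G) = nrm F * nrm G"
proof (rule poly_eqI_all)
  fix x
  obtain y where "on_aff a x y" using ex_point by blast
  then show "poly (nrm (F * G)) x = poly (nrm F * nrm G) x" by (simp add: poly_nrm)
qed

lemma nrm_eqE: "eqE F G \<Longrightarrow> nrm F = nrm G"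
proof (rule poly_eqI_all)
  fix x assume "eqE F G"
  then show "poly (nrm F) x = poly (nrm G) x"
    using ex_point[of x] by (auto simp: poly_nrm eqE_def on_aff_negy)
qed

lemma nrm_AB: "nrm [:A, B:] = nrmAB A B"
  by (rule poly_eqI_all) (use ex_point in \<open>metis poly_nrm poly_nrmAB\<close>)

lemma degree_cub: "degree cub = 3" and lead_coeff_cub: "coeff cub 3 = 1"
  by (simp_all add: cub_def eval_nat_numeral)

lemma cub_nz [simp]: "cub \<noteq> 0" using degree_cub by auto

lemma degree_lin: "degree lin \<le> 1" by (simp add: lin_def)

text \<open>At infinity x has a pole of order 2 and y one of order 3. The case B = 0 is separate
  because the zero polynomial has degree 0, which would contribute a false 3.\<close>

definition dAB :: "'b poly \<Rightarrow> 'b poly \<Rightarrow> nat" where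
  "dAB A B = (if B = 0 then 2 * degree A else max (2 * degree A) (2 * degree B + 3))"

text \<open>2 deg A and 2 deg B + 3 have different parity, so the leading terms of the two squares
  cannot cancel, and the mixed term has degree at most deg A + deg B + 1, below the larger of the
  two.\<close>

lemma degree_nrmAB: "degree (nrmAB A B) = dAB A B"
proof (cases "B = 0")
  case True
  then show ?thesis by (simp add: nrmAB_def dAB_def degree_power_eq power2_eq_square)
     (metis degree_0 degree_mult_eq mult_2 mult_zero_left add_0)
next
  case False
  have dB: "degree (B\<^sup>2 * cub) = 2 * degree B + 3"
    using False by (simp add: degree_mult_eq degree_power_eq degree_cub)
  have dA: "degree (A\<^sup>2) = 2 * degree A"
    by (cases "A = 0") (simp_all add: degree_power_eq)
  have dAB: "degree (A * B * lin) \<le> degree A + degree B + 1"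
    by (meson add_mono degree_lin degree_mult_le order_trans)
  show ?thesis
  proof (cases "2 * degree A > 2 * degree B + 3")
    case True
    have "degree (A * B * lin + B\<^sup>2 * cub) < 2 * degree A"
      using True dAB dB by (intro degree_add_less) auto
    then have "degree (A\<^sup>2 - (A * B * lin + B\<^sup>2 * cub)) = 2 * degree A"
      using dA degree_add_eq_left[of "- (A * B * lin + B\<^sup>2 * cub)" "A\<^sup>2"]
      by (simp only: degree_minus diff_conv_add_uminus)
    then show ?thesis using True False by (simp add: nrmAB_def dAB_def algebra_simps)
  next
    case le: False
    moreover have "2 * degree A \<noteq> 2 * degree B + 3"
    proof
      assume "2 * degree A = 2 * degree B + 3"
      then have "even (2 * degree B + 3)" by (metis dvd_triv_left)
      then show False by simp
    qed
    ultimately have "2 * degree A < 2 * degree B + 3" by linarith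
    then have "degree (A\<^sup>2 - A * B * lin) < 2 * degree B + 3"
      using le dAB dA by (intro degree_diff_less) auto
    then have "degree (A\<^sup>2 - A * B * lin - B\<^sup>2 * cub) = 2 * degree B + 3"
      using dB degree_add_eq_right[of "A\<^sup>2 - A * B * lin" "- (B\<^sup>2 * cub)"] by simp
    then show ?thesis using le False by (simp add: nrmAB_def dAB_def)
  qed
qed

lemma nrmAB_0_iff: "nrmAB A B = 0 \<longleftrightarrow> A = 0 \<and> B = 0"
proof
  assume 0: "nrmAB A B = 0"
  then have "B = 0" using degree_nrmAB[of A B] by (auto simp: dAB_def split: if_splits)
  then show "A = 0 \<and> B = 0" using 0 by (simp add: nrmAB_def)
qed (simp add: nrmAB_def)

lemma nrm_0_iff: "nrm F = 0 \<longleftrightarrow> eqE F 0"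
proof
  assume 0: "nrm F = 0"
  obtain A B where AB: "eqE F [:A, B:]" using reduce by blast
  then have "A = 0 \<and> B = 0" using 0 nrm_eqE[OF AB] nrmAB_0_iff by (simp add: nrm_AB)
  then show "eqE F 0" using AB by simp
next
  assume "eqE F 0"
  then show "nrm F = 0" using nrm_eqE[of F 0] nrm_AB[of 0 0] by (simp add: nrmAB_def)
qed

text \<open>The coordinate ring is a domain: the norm is multiplicative, vanishes only on zero, and
  takes values in a polynomial ring over a field.\<close>

lemma eqE_mult_0: "eqE (F * G) 0 \<longleftrightarrow> eqE F 0 \<or> eqE G 0"
  by (simp add: nrm_0_iff[symmetric] nrm_mult)

lemma eqE_diff_0: "eqE F G \<longleftrightarrow> eqE (F - G) 0"
  by (simp add: eqE_def)

lemma eqE_cancel: "\<not> eqE H 0 \<Longrightarrow> eqE (H * F) (H * G) \<longleftrightarrow> eqE F G"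
  using eqE_mult_0[of H "F - G"]
  by (simp only: eqE_diff_0[of F] eqE_diff_0[of "H * F"] right_diff_distrib) blast

lemma eqE_power_0: "eqE (F ^ n) 0 \<Longrightarrow> eqE F 0"
  by (auto simp: eqE_def)

lemma reduce_unique: "eqE [:A, B:] [:A', B':] \<longleftrightarrow> A = A' \<and> B = B'"
proof
  assume "eqE [:A, B:] [:A', B':]"
  then have "eqE [:A - A', B - B':] 0" by (simp add: eqE_def algebra_simps)
  then have "nrmAB (A - A') (B - B') = 0" by (simp add: nrm_0_iff nrm_AB[symmetric])
  then show "A = A' \<and> B = B'" by (simp add: nrmAB_0_iff)
qed simp

text \<open>\<open>dg\<close> is the pole order at infinity.\<close>
definition dg :: "'b poly poly \<Rightarrow> nat" where "dg F = degree (nrm F)"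

lemma dg_mult: "\<not> eqE F 0 \<Longrightarrow> \<not> eqE G 0 \<Longrightarrow> dg (F * G) = dg F + dg G"
  by (simp add: dg_def nrm_mult degree_mult_eq nrm_0_iff)

lemma dg_eqE: "eqE F G \<Longrightarrow> dg F = dg G"
  by (simp add: dg_def nrm_eqE)

lemma dg_AB: "dg [:A, B:] = dAB A B"
  by (simp add: dg_def nrm_AB degree_nrmAB)

lemma dg_x [simp]: "dg [:[:c, 1:]:] = 2"
  using dg_AB[of "[:c,1:]" 0] by (simp add: dAB_def)

lemma dg_y [simp]: "degree A \<le> 1 \<Longrightarrow> dg [:A, 1:] = 3"
  by (simp add: dg_AB dAB_def)

lemma nz_AB: "eqE [:A, B:] 0 \<longleftrightarrow> A = 0 \<and> B = 0"
  using reduce_unique[of A B 0 0] by simp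

lemma nz_x [simp]: "\<not> eqE [:[:c, 1:]:] 0"
  using nz_AB[of "[:c,1:]" 0] by simp

lemma nz_y [simp]: "\<not> eqE [:A, 1:] 0"
  by (simp add: nz_AB)

lemma nz_1 [simp]: "\<not> eqE 1 0"
  using ex_point by (auto simp: eqE_def)

lemma dg_1 [simp]: "dg 1 = 0"
  using dg_AB[of 1 0] by (simp add: dAB_def one_pCons)

text \<open>Genus one in its elementary form: no pole order equals 1, and pole order 0 means a
  constant, which has no zero unless it is zero.\<close>

lemma dg_ge2: "\<lbrakk>\<not> eqE F 0; on_aff a x y; eval2 F x y = 0\<rbrakk> \<Longrightarrow> dg F \<ge> 2"
proof -
  assume h: "\<not> eqE F 0" "on_aff a x y" "eval2 F x y = 0"
  obtain A B where AB: "eqE F [:A, B:]" using reduce by blast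
  show "dg F \<ge> 2"
  proof (rule ccontr)
    assume "\<not> 2 \<le> dg F"
    then have "dAB A B < 2" using dg_eqE[OF AB] by (simp add: dg_AB)
    then have "B = 0" "degree A = 0" by (auto simp: dAB_def split: if_splits)
    then obtain c where "A = [:c:]" using degree_eq_zeroE by blast
    then show False using h AB \<open>B = 0\<close> by (auto simp: eqE_def)
  qed
qed

end

section \<open>Ideals of the coordinate ring\<close>

context weierstrass
begin

abbreviation xpol :: "'b \<Rightarrow> 'b poly poly" where "xpol x0 \<equiv> [:[:- x0, 1:]:]"
abbreviation ypol :: "'b \<Rightarrow> 'b poly poly" where "ypol y0 \<equiv> [:[:- y0:], 1:]"

text \<open>The quotient (\<open>cub\<close>(x) - \<open>cub\<close>(x1)) / (x - x1) minus
  \<open>a 1\<close> y. At a point over x1 its value is minus the x-derivative of the curve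
  equation, which is how nonsingularity enters later.\<close>

definition conj_quot :: "'b \<Rightarrow> 'b poly poly" where
  "conj_quot x1 = [:[:x1\<^sup>2 + a 2 * x1 + a 4, x1 + a 2, 1:], [:- a 1:]:]"

lemma ypol_conj:
  assumes "on_aff a x1 y1"
  shows "eqE (ypol y1 * ypol (negy x1 y1)) (xpol x1 * conj_quot x1)"
  unfolding eqE_def
proof safe
  fix x y assume P: "on_aff a x y"
  have "eval2 (ypol y1 * ypol (negy x1 y1)) x y - eval2 (xpol x1 * conj_quot x1) x y
    = weq a x y - weq a x1 y1"
    by (simp add: conj_quot_def weq_def negy_def algebra_simps power2_eq_square power3_eq_cube)
  then show "eval2 (ypol y1 * ypol (negy x1 y1)) x y = eval2 (xpol x1 * conj_quot x1) x y"
    using P assms by (simp add: on_aff_def)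
qed

text \<open>Ideals of the coordinate ring, kept as their preimages among bivariate polynomials;
  hence they contain everything that vanishes on the curve.\<close>

definition idl :: "'b poly poly set \<Rightarrow> bool" where
  "idl J \<longleftrightarrow> (\<forall>F. eqE F 0 \<longrightarrow> F \<in> J) \<and> (\<forall>F\<in>J. \<forall>G\<in>J. F + G \<in> J) \<and> (\<forall>F\<in>J. \<forall>H. H * F \<in> J)"

lemma idl_0: "idl J \<Longrightarrow> eqE F 0 \<Longrightarrow> F \<in> J"
  and idl_add: "idl J \<Longrightarrow> F \<in> J \<Longrightarrow> G \<in> J \<Longrightarrow> F + G \<in> J"
  and idl_mult: "idl J \<Longrightarrow> F \<in> J \<Longrightarrow> H * F \<in> J"
  by (auto simp: idl_def)

lemma idl_mult2: "idl J \<Longrightarrow> F \<in> J \<Longrightarrow> F * H \<in> J"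
  using idl_mult[of J F H] by (simp add: mult.commute)

lemma idl_diff: "idl J \<Longrightarrow> F \<in> J \<Longrightarrow> G \<in> J \<Longrightarrow> F - G \<in> J"
  using idl_add[of J F "- G"] idl_mult[of J G "-1"] by simp

lemma idl_eqE:
  assumes "idl J" "F \<in> J" "eqE G F" shows "G \<in> J"
proof -
  have "eqE (G - F) 0" using assms(3) by (simp add: eqE_def)
  then have "F + (G - F) \<in> J" using assms by (intro idl_add) (auto intro: idl_0)
  then show ?thesis by simp
qed

lemma idl_quotient: assumes J: "idl J" shows "idl {G. F * G \<in> J}"
  unfolding idl_def
proof (intro conjI allI ballI impI)
  fix G assume "eqE G 0"
  then have "eqE (F * G) 0" by (simp add: eqE_def)
  then show "G \<in> {G. F * G \<in> J}" using idl_0[OF J] by blast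
next
  fix G G' assume "G \<in> {G. F * G \<in> J}" "G' \<in> {G. F * G \<in> J}"
  then show "G + G' \<in> {G. F * G \<in> J}" using idl_add[OF J] by (simp add: distrib_left)
next
  fix G H assume "G \<in> {G. F * G \<in> J}"
  then show "H * G \<in> {G. F * G \<in> J}" using idl_mult[OF J, of "F * G" H] by (simp only: mem_Collect_eq ac_simps)
qed

text \<open>Taylor expansion followed by scaling: a member that does not vanish at the point becomes
  1 modulo the ideal of that point.\<close>

lemma idl_normalise:
  assumes "idl J" "F \<in> J" "eval2 F x0 y0 \<noteq> 0"
  obtains G H where "1 + xpol x0 * G + ypol y0 * H \<in> J"
proof -
  let ?c = "[:[:1 / eval2 F x0 y0:]:]"
  obtain G H where F: "F = [:[:eval2 F x0 y0:]:] + xpol x0 * G + ypol y0 * H"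
    using eval2_Taylor by blast
  have c: "?c * [:[:eval2 F x0 y0:]:] = 1" using assms(3) by (simp add: one_pCons)
  have "?c * F = ?c * [:[:eval2 F x0 y0:]:] + xpol x0 * (?c * G) + ypol y0 * (?c * H)"
    by (subst F) (simp only: ring_distribs ac_simps)
  also have "\<dots> = 1 + xpol x0 * (?c * G) + ypol y0 * (?c * H)" by (simp only: c)
  finally show ?thesis using that idl_mult[OF assms(1,2)] by metis
qed

text \<open>Above x1 lie only the points with ordinates \<open>y1\<close> and \<open>y2\<close>.
  \<open>J\<close> contains 1 + a and 1 + b, where a and b are multiples of y - \<open>y1\<close>
  and y - \<open>y2\<close>, and it contains ab because (y - \<open>y1\<close>)(y -
  \<open>y2\<close>) is a multiple of x - x1 on the curve. Then 1 = (1 + a) - (1 + b) a + ab. The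
  argument also covers \<open>y1 = y2\<close>.\<close>

lemma one_mem_fibre:
  assumes J: "idl J" and x: "xpol x1 \<in> J"
    and nz: "\<And>x y. on_aff a x y \<Longrightarrow> \<exists>F\<in>J. eval2 F x y \<noteq> 0"
  shows "1 \<in> J"
proof -
  obtain y1 where P: "on_aff a x1 y1" using ex_point by blast
  define y2 where "y2 = negy x1 y1"
  have P2: "on_aff a x1 y2" using P by (simp add: y2_def on_aff_negy)
  obtain G1 H1 where 1: "1 + xpol x1 * G1 + ypol y1 * H1 \<in> J"
    using nz[OF P] idl_normalise[OF J] by metis
  obtain G2 H2 where 2: "1 + xpol x1 * G2 + ypol y2 * H2 \<in> J"
    using nz[OF P2] idl_normalise[OF J] by metis
  let ?a = "ypol y1 * H1" and ?b = "ypol y2 * H2"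
  have a: "1 + ?a \<in> J" using idl_diff[OF J 1 idl_mult2[OF J x, of G1]] by (simp add: algebra_simps)
  have b: "1 + ?b \<in> J" using idl_diff[OF J 2 idl_mult2[OF J x, of G2]] by (simp add: algebra_simps)
  have "xpol x1 * conj_quot x1 \<in> J" by (rule idl_mult2[OF J x])
  then have "ypol y1 * ypol y2 \<in> J" using idl_eqE[OF J] ypol_conj[OF P] y2_def by blast
  then have "(ypol y1 * ypol y2) * (H1 * H2) \<in> J" by (rule idl_mult2[OF J])
  then have ab: "?a * ?b \<in> J" by (simp only: ac_simps)
  have "(1 + ?a) - (1 + ?b) * ?a + ?a * ?b \<in> J"
    using idl_add[OF J idl_diff[OF J a idl_mult2[OF J b, of ?a]] ab] .
  moreover have "(1 + A) - (1 + B) * A + A * B = 1" for A B :: "'b poly poly"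
    by (simp only: ring_distribs) simp
  ultimately show ?thesis by metis
qed

text \<open>The cofactor is the conjugate of \<open>F\<close>. So an ideal contains the norms of its
  members, which are polynomials in x alone.\<close>

lemma eqE_nrm_conj: "\<exists>G. eqE (F * G) [:nrm F:]"
proof -
  obtain A B where AB: "eqE F [:A, B:]" using reduce by blast
  have "eqE (F * [:A - B * lin, - B:]) [:nrm F:]"
    unfolding eqE_def
  proof safe
    fix x y assume P: "on_aff a x y"
    have "eval2 F x (negy x y) = eval2 [:A - B * lin, - B:] x y"
      using AB P on_aff_negy[of x y] by (simp add: eqE_def negy_lin algebra_simps)
    then show "eval2 (F * [:A - B * lin, - B:]) x y = eval2 [:nrm F:] x y"
      using poly_nrm[OF P, of F] by (simp only: eval2_mult) simp
  qed
  then show ?thesis by blast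
qed

text \<open>Instead of maximal ideals: divide a nonzero polynomial in \<open>J\<close> that depends on \<open>x\<close> alone by
  one of its linear factors at a time, so that only fibres \<open>x = const\<close> have to be treated.\<close>
theorem nullstellensatz:
  assumes J: "idl J" and nz: "\<And>x y. on_aff a x y \<Longrightarrow> \<exists>F\<in>J. eval2 F x y \<noteq> 0"
  shows "1 \<in> J"
proof -
  have main: "[:u:] \<in> J \<Longrightarrow> u \<noteq> 0 \<Longrightarrow> degree u = n \<Longrightarrow> 1 \<in> J" for n u
  proof (induction n arbitrary: u)
    case 0
    then obtain c where u: "u = [:c:]" using degree_eq_zeroE by blast
    then have "[:[:1 / c:]:] * [:u:] = 1" using 0 by (simp add: one_pCons)
    then show ?case using idl_mult[OF J 0(1)] by metis
  next
    case (Suc n)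
    then obtain \<alpha> where "poly u \<alpha> = 0" using closed[of u] by auto
    then obtain u' where u: "u = [:- \<alpha>, 1:] * u'" by (metis dvdE poly_eq_0_iff_dvd)
    then have "u' \<noteq> 0" using Suc.prems(2) by auto
    then have "degree ([:- \<alpha>, 1:] * u') = 1 + degree u'" by (subst degree_mult_eq) auto
    then have u': "u' \<noteq> 0" "degree u' = n" using \<open>u' \<noteq> 0\<close> Suc.prems(3) u by auto
    define J' where "J' = {G. [:u':] * G \<in> J}"
    have J': "idl J'"
      unfolding J'_def by (rule idl_quotient[OF J])
    have "[:u':] * xpol \<alpha> = [:u:]" by (simp add: u mult.commute)
    then have x: "xpol \<alpha> \<in> J'" unfolding J'_def using Suc.prems(1) by simp
    have "\<exists>F\<in>J'. eval2 F x y \<noteq> 0" if P: "on_aff a x y" for x y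
      using nz[OF P] idl_mult[OF J] unfolding J'_def by blast
    then have "1 \<in> J'" using one_mem_fibre[OF J' x] by blast
    then have "[:u':] \<in> J" by (simp add: J'_def)
    then show ?case using Suc.IH u' by blast
  qed
  obtain x y where "on_aff a x y" using ex_point by blast
  then obtain F where F: "F \<in> J" "eval2 F x y \<noteq> 0" using nz by blast
  then have "nrm F \<noteq> 0" using nrm_0_iff \<open>on_aff a x y\<close> by (auto simp: eqE_def)
  moreover obtain G where "eqE (F * G) [:nrm F:]" using eqE_nrm_conj by blast
  then have "[:nrm F:] \<in> J" using idl_eqE[OF J idl_mult2[OF J F(1)]] eqE_sym by blast
  ultimately show ?thesis using main by blast
qed

text \<open>The product of \<open>I\<close> with the maximal ideal of \<open>P\<close>, which x -
  x_P and y - y_P generate. Iterated products of this kind stand for effective divisors, with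
  multiplicities.\<close>

definition IP :: "'b \<times> 'b \<Rightarrow> 'b poly poly set \<Rightarrow> 'b poly poly set" where
  "IP P I = {F. \<exists>G\<in>I. \<exists>H\<in>I. eqE F (xpol (fst P) * G + ypol (snd P) * H)}"

fun IM :: "('b \<times> 'b) list \<Rightarrow> 'b poly poly set" where
  "IM [] = UNIV" | "IM (P # M) = IP P (IM M)"

lemma idl_UNIV: "idl UNIV" by (simp add: idl_def)

lemma IP_I: "G \<in> I \<Longrightarrow> H \<in> I \<Longrightarrow> eqE F (xpol (fst P) * G + ypol (snd P) * H) \<Longrightarrow> F \<in> IP P I"
  by (auto simp: IP_def)

lemma idl_IP: assumes I: "idl I" shows "idl (IP P I)"
  unfolding idl_def
proof (intro conjI allI ballI impI)
  fix F assume "eqE F 0"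
  then show "F \<in> IP P I" by (intro IP_I[of 0 _ 0]) (auto simp: idl_0[OF I])
next
  fix F F' assume "F \<in> IP P I" "F' \<in> IP P I"
  then obtain G H G' H' where *: "G \<in> I" "H \<in> I" "G' \<in> I" "H' \<in> I"
    "eqE F (xpol (fst P) * G + ypol (snd P) * H)" "eqE F' (xpol (fst P) * G' + ypol (snd P) * H')"
    by (auto simp: IP_def)
  show "F + F' \<in> IP P I"
  proof (rule IP_I[of "G + G'" _ "H + H'"])
    show "eqE (F + F') (xpol (fst P) * (G + G') + ypol (snd P) * (H + H'))"
      using eqE_add[OF *(5,6)] by (simp only: ring_distribs ac_simps)
  qed (use * in \<open>auto intro!: idl_add[OF I]\<close>)
next
  fix F K assume "F \<in> IP P I"
  then obtain G H where *: "G \<in> I" "H \<in> I" "eqE F (xpol (fst P) * G + ypol (snd P) * H)"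
    by (auto simp: IP_def)
  show "K * F \<in> IP P I"
  proof (rule IP_I[of "K * G" _ "K * H"])
    show "eqE (K * F) (xpol (fst P) * (K * G) + ypol (snd P) * (K * H))"
      using eqE_mult[OF eqE_refl[of K] *(3)] by (simp only: ring_distribs ac_simps)
  qed (use * in \<open>auto intro!: idl_mult[OF I]\<close>)
qed

lemma idl_IM: "idl (IM M)"
  by (induction M) (auto intro: idl_UNIV idl_IP)

lemma IP_x: "idl I \<Longrightarrow> G \<in> I \<Longrightarrow> xpol (fst P) * G \<in> IP P I"
  by (rule IP_I[of G _ 0]) (auto simp: idl_0)

lemma IP_y: "idl I \<Longrightarrow> G \<in> I \<Longrightarrow> ypol (snd P) * G \<in> IP P I"
  by (rule IP_I[of 0 _ G]) (auto simp: idl_0)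

lemma IP_comm_subset: assumes I: "idl I" shows "IP P (IP R I) \<subseteq> IP R (IP P I)"
proof
  fix F assume "F \<in> IP P (IP R I)"
  then obtain G H where G: "G \<in> IP R I" "H \<in> IP R I" "eqE F (xpol (fst P) * G + ypol (snd P) * H)"
    by (auto simp: IP_def)
  then obtain G1 G2 H1 H2 where *: "G1 \<in> I" "G2 \<in> I" "H1 \<in> I" "H2 \<in> I"
    "eqE G (xpol (fst R) * G1 + ypol (snd R) * G2)" "eqE H (xpol (fst R) * H1 + ypol (snd R) * H2)"
    by (auto simp: IP_def)
  show "F \<in> IP R (IP P I)"
  proof (rule IP_I)
    show "xpol (fst P) * G1 + ypol (snd P) * H1 \<in> IP P I"
      using * by (intro IP_I[OF _ _ eqE_refl])
    show "xpol (fst P) * G2 + ypol (snd P) * H2 \<in> IP P I"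
      using * by (intro IP_I[OF _ _ eqE_refl])
    show "eqE F (xpol (fst R) * (xpol (fst P) * G1 + ypol (snd P) * H1) +
            ypol (snd R) * (xpol (fst P) * G2 + ypol (snd P) * H2))"
      using eqE_trans[OF G(3) eqE_add[OF eqE_mult[OF eqE_refl *(5)] eqE_mult[OF eqE_refl *(6)]]]
      by (simp only: ring_distribs ac_simps)
  qed
qed

lemma IP_comm: "idl I \<Longrightarrow> IP P (IP R I) = IP R (IP P I)"
  using IP_comm_subset by blast

text \<open>\<open>g I = h I'\<close> in the coordinate ring.\<close>
definition simi :: "'b poly poly \<Rightarrow> 'b poly poly set \<Rightarrow> 'b poly poly \<Rightarrow> 'b poly poly set \<Rightarrow> bool" where
  "simi g I h I' \<longleftrightarrow> (\<forall>F\<in>I. \<exists>G\<in>I'. eqE (g * F) (h * G)) \<and> (\<forall>G\<in>I'. \<exists>F\<in>I. eqE (g * F) (h * G))"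

lemma simi_refl: "simi 1 I 1 I"
  unfolding simi_def using eqE_refl by blast

lemma simi_sym: "simi g I h I' \<Longrightarrow> simi h I' g I"
  unfolding simi_def using eqE_sym by blast

lemma simi_trans1:
  assumes "\<forall>F\<in>I. \<exists>G\<in>I'. eqE (g * F) (h * G)" "\<forall>F\<in>I'. \<exists>G\<in>I''. eqE (g' * F) (h' * G)"
  shows "\<forall>F\<in>I. \<exists>G\<in>I''. eqE ((g * g') * F) ((h * h') * G)"
proof
  fix F assume "F \<in> I"
  then obtain G where G: "G \<in> I'" "eqE (g * F) (h * G)" using assms by blast
  then obtain H where H: "H \<in> I''" "eqE (g' * G) (h' * H)" using assms by blast
  have "eqE ((g * g') * F) ((h * h') * H)"
    using eqE_trans[OF eqE_mult[OF eqE_refl[of g'] G(2)]] eqE_mult[OF eqE_refl[of h] H(2)]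
    by (simp only: ac_simps)
  then show "\<exists>G\<in>I''. eqE ((g * g') * F) ((h * h') * G)" using H by blast
qed

lemma simi_trans:
  assumes "simi g I h I'" "simi g' I' h' I''"
  shows "simi (g * g') I (h * h') I''"
proof -
  have "simi h I' g I" "simi h' I'' g' I'" using assms by (auto intro: simi_sym)
  then have "\<forall>F\<in>I''. \<exists>G\<in>I. eqE ((h' * h) * F) ((g' * g) * G)"
    using simi_trans1[of I'' I' h' g' I h g] by (simp add: simi_def)
  then have "\<forall>F\<in>I''. \<exists>G\<in>I. eqE ((g * g') * G) ((h * h') * F)"
    using eqE_sym by (metis mult.commute)
  moreover have "\<forall>F\<in>I. \<exists>G\<in>I''. eqE ((g * g') * F) ((h * h') * G)"
    using simi_trans1[of I I' g h I'' g' h'] assms by (simp add: simi_def)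
  ultimately show ?thesis unfolding simi_def by blast
qed

lemma simi_IP1:
  assumes "\<forall>F\<in>I. \<exists>G\<in>I'. eqE (g * F) (h * G)"
  shows "\<forall>F\<in>IP P I. \<exists>G\<in>IP P I'. eqE (g * F) (h * G)"
proof
  fix F assume "F \<in> IP P I"
  then obtain G H where *: "G \<in> I" "H \<in> I" "eqE F (xpol (fst P) * G + ypol (snd P) * H)"
    by (auto simp: IP_def)
  then obtain G' H' where G': "G' \<in> I'" "H' \<in> I'" "eqE (g * G) (h * G')" "eqE (g * H) (h * H')"
    using assms by meson
  let ?K = "xpol (fst P) * G' + ypol (snd P) * H'"
  have "?K \<in> IP P I'" using G' by (intro IP_I[OF _ _ eqE_refl])
  moreover have "eqE (g * F) (h * ?K)"
  proof -
    have "eqE (g * F) (xpol (fst P) * (g * G) + ypol (snd P) * (g * H))"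
      using eqE_mult[OF eqE_refl[of g] *(3)] by (simp only: ring_distribs ac_simps)
    also have "eqE \<dots> (xpol (fst P) * (h * G') + ypol (snd P) * (h * H'))"
      by (intro eqE_add eqE_mult G' eqE_refl)
    also have "\<dots> = h * ?K" by (simp only: ring_distribs ac_simps)
    finally show ?thesis .
  qed
  ultimately show "\<exists>G\<in>IP P I'. eqE (g * F) (h * G)" by blast
qed

lemma simi_IP: assumes "simi g I h I'" shows "simi g (IP P I) h (IP P I')"
proof -
  have "simi h I' g I" using assms by (rule simi_sym)
  then have "\<forall>F\<in>IP P I'. \<exists>G\<in>IP P I. eqE (h * F) (g * G)"
    by (intro simi_IP1) (auto simp: simi_def)
  moreover have "\<forall>F\<in>IP P I. \<exists>G\<in>IP P I'. eqE (g * F) (h * G)"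
    using assms by (intro simi_IP1) (auto simp: simi_def)
  ultimately show ?thesis unfolding simi_def using eqE_sym by blast
qed

text \<open>The multipliers that carry \<open>F\<close> into \<open>I'\<close> form an ideal, so the
  Nullstellensatz applies to it. Membership thereby becomes a local question that can be settled
  point by point.\<close>

lemma mem_by_multipliers:
  assumes I': "idl I'"
    and "\<And>x y. on_aff a x y \<Longrightarrow> \<exists>c. c * F \<in> I' \<and> eval2 c x y \<noteq> 0"
  shows "F \<in> I'"
proof -
  let ?J = "{c. c * F \<in> I'}"
  have "idl ?J" using idl_quotient[OF I', of F] by (simp only: mult.commute)
  then have "1 \<in> ?J" by (rule nullstellensatz) (use assms(2) in auto)
  then show ?thesis by simp
qed

text \<open>A line through the point can replace y - y0 as second generator, since the two differ by
  l (x - x0). With one common line through three points, products of generators share a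
  factor.\<close>

lemma IP_line_form:
  assumes "y0 = l * x0 + v" "idl I"
  shows "IP (x0, y0) I = {F. \<exists>G\<in>I. \<exists>H\<in>I. eqE F (xpol x0 * G + [:[:- v, - l:], 1:] * H)}"
proof safe
  fix F assume "F \<in> IP (x0, y0) I"
  then obtain G H where *: "G \<in> I" "H \<in> I" "eqE F (xpol x0 * G + ypol y0 * H)"
    by (auto simp: IP_def)
  have "G + [:[:l:]:] * H \<in> I" using * assms(2) by (intro idl_add idl_mult)
  moreover have "eqE F (xpol x0 * (G + [:[:l:]:] * H) + [:[:- v, - l:], 1:] * H)"
    using *(3) assms(1) by (simp add: eqE_def algebra_simps)
  ultimately show "\<exists>G\<in>I. \<exists>H\<in>I. eqE F (xpol x0 * G + [:[:- v, - l:], 1:] * H)" using * by blast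
next
  fix F G H assume *: "G \<in> I" "H \<in> I" "eqE F (xpol x0 * G + [:[:- v, - l:], 1:] * H)"
  show "F \<in> IP (x0, y0) I"
  proof (rule IP_I)
    show "G - [:[:l:]:] * H \<in> I" using * assms(2) by (intro idl_diff idl_mult)
    show "H \<in> I" by fact
    show "eqE F (xpol (fst (x0, y0)) * (G - [:[:l:]:] * H) + ypol (snd (x0, y0)) * H)"
      using *(3) assms(1) by (simp add: eqE_def algebra_simps)
  qed
qed

lemma IP_line_mem:
  assumes "y0 = l * x0 + v" "idl I" "G \<in> I"
  shows "[:[:- v, - l:], 1:] * G \<in> IP (x0, y0) I"
  unfolding IP_line_form[OF assms(1,2)]
  using assms(3) idl_0[OF assms(2), of 0]
  by (intro CollectI bexI[of _ 0] bexI[of _ G]) (auto simp: eqE_def)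

end

section \<open>Vertical lines and chords as products of point ideals\<close>

locale elliptic = weierstrass a for a :: "nat \<Rightarrow> 'b::field" +
  assumes nonsing: "nonsingular a"
begin

text \<open>All four products of generators are multiples of x - x0, the product of the two
  y-factors by \<open>ypol_conj\<close>. Conversely their cofactors x - x0, y - y0, y -
  \<open>negy x0 y0\<close> and \<open>conj_quot x0\<close> carry x - x0 into the ideal product; at
  a common zero both partial derivatives of the curve equation would vanish.\<close>

lemma IP_opp:
  assumes P: "on_aff a x0 y0" and I: "idl I"
  shows "simi 1 (IP (x0, y0) (IP (x0, negy x0 y0) I)) (xpol x0) I"
  unfolding simi_def
proof safe
  fix F assume "F \<in> IP (x0, y0) (IP (x0, negy x0 y0) I)"
  then obtain G H where G: "G \<in> IP (x0, negy x0 y0) I" "H \<in> IP (x0, negy x0 y0) I"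
      "eqE F (xpol x0 * G + ypol y0 * H)"
    by (auto simp: IP_def)
  then obtain G1 G2 H1 H2 where *: "G1 \<in> I" "G2 \<in> I" "H1 \<in> I" "H2 \<in> I"
    "eqE G (xpol x0 * G1 + ypol (negy x0 y0) * G2)" "eqE H (xpol x0 * H1 + ypol (negy x0 y0) * H2)"
    by (auto simp: IP_def)
  let ?K = "xpol x0 * G1 + ypol (negy x0 y0) * G2 + ypol y0 * H1 + conj_quot x0 * H2"
  have "eqE (1 * F) (xpol x0 * ?K)"
  proof -
    have "eqE (1 * F) (xpol x0 * (xpol x0 * G1 + ypol (negy x0 y0) * G2 + ypol y0 * H1) +
       (ypol y0 * ypol (negy x0 y0)) * H2)"
      using eqE_trans[OF G(3) eqE_add[OF eqE_mult[OF eqE_refl *(5)] eqE_mult[OF eqE_refl *(6)]]]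
      by (simp only: ring_distribs ac_simps mult_1_right)
    also have "eqE \<dots> (xpol x0 * (xpol x0 * G1 + ypol (negy x0 y0) * G2 + ypol y0 * H1) +
       (xpol x0 * conj_quot x0) * H2)"
      by (intro eqE_add eqE_mult ypol_conj P eqE_refl)
    also have "\<dots> = xpol x0 * ?K" by (simp only: ring_distribs ac_simps)
    finally show ?thesis .
  qed
  moreover have "?K \<in> I" using * I by (intro idl_add idl_mult)
  ultimately show "\<exists>G\<in>I. eqE (1 * F) (xpol x0 * G)" by blast
next
  fix G assume G: "G \<in> I"
  let ?I' = "IP (x0, y0) (IP (x0, negy x0 y0) I)"
  have I1: "idl (IP (x0, negy x0 y0) I)" using I by (rule idl_IP)
  then have I': "idl ?I'" by (rule idl_IP)
  have gx: "xpol x0 * G \<in> IP (x0, negy x0 y0) I" using IP_x[OF I G, of "(x0, negy x0 y0)"] by simp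
  have gy: "ypol (negy x0 y0) * G \<in> IP (x0, negy x0 y0) I" using IP_y[OF I G, of "(x0, negy x0 y0)"] by simp
  have m1: "xpol x0 * (xpol x0 * G) \<in> ?I'" using IP_x[OF I1 gx, of "(x0,y0)"] by simp
  have m2: "ypol y0 * (xpol x0 * G) \<in> ?I'" using IP_y[OF I1 gx, of "(x0,y0)"] by simp
  have m3: "ypol (negy x0 y0) * (xpol x0 * G) \<in> ?I'"
    using IP_x[OF I1 gy, of "(x0,y0)"] by (simp only: fst_conv ac_simps)
  have "ypol y0 * (ypol (negy x0 y0) * G) \<in> ?I'" using IP_y[OF I1 gy, of "(x0,y0)"] by simp
  moreover have "eqE (conj_quot x0 * (xpol x0 * G)) (ypol y0 * (ypol (negy x0 y0) * G))"
    using eqE_mult[OF eqE_sym[OF ypol_conj[OF P]] eqE_refl[of G]] by (simp only: ac_simps)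
  ultimately have m4: "conj_quot x0 * (xpol x0 * G) \<in> ?I'" using idl_eqE[OF I'] by blast
  have "xpol x0 * G \<in> ?I'"
  proof (rule mem_by_multipliers[OF I'])
    fix x y assume xy: "on_aff a x y"
    have "eval2 (xpol x0) x y \<noteq> 0 \<or> eval2 (ypol y0) x y \<noteq> 0 \<or> eval2 (ypol (negy x0 y0)) x y \<noteq> 0
      \<or> eval2 (conj_quot x0) x y \<noteq> 0"
    proof (rule ccontr)
      assume "\<not> ?thesis"
      then have *: "x = x0" "y = y0" "y = negy x0 y0" "eval2 (conj_quot x0) x y = 0" by auto
      have "2 * y + a 1 * x + a 3 = 0" using *(2,3) by (simp only: *(1)[symmetric]) (simp add: negy_def algebra_simps)
      moreover have "a 1 * y - 3 * x\<^sup>2 - 2 * a 2 * x - a 4 = 0"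
        using *(4) *(1) by (simp add: conj_quot_def algebra_simps power2_eq_square)
      ultimately show False using nonsing xy unfolding nonsingular_def on_aff_def by blast
    qed
    then show "\<exists>c. c * (xpol x0 * G) \<in> ?I' \<and> eval2 c x y \<noteq> 0"
      using m1 m2 m3 m4 by metis
  qed
  then show "\<exists>F\<in>?I'. eqE (1 * F) (xpol x0 * G)"
    by (intro bexI[of _ "xpol x0 * G"]) auto
qed

text \<open>Restricted to the line, the curve equation has a double root at x, so f_x + l f_y = 0
  there. If the point were its own negative, then f_y = 0, hence f_x = 0, and the point would be
  singular.\<close>

lemma nonvertical_tangent:
  assumes line: "\<And>x. weq a x (l * x + v) = - ((x - x1) * (x - x2) * (x - x3))"
    and double: "(x = x1 \<and> x = x2) \<or> (x = x1 \<and> x = x3) \<or> (x = x2 \<and> x = x3)"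
  shows "negy x (l * x + v) \<noteq> l * x + v"
proof
  assume two: "negy x (l * x + v) = l * x + v"
  let ?L = "[:v, l:]"
  have "?L\<^sup>2 + lin * ?L - cub = - ([:-x1,1:] * [:-x2,1:] * [:-x3,1:])"
    by (rule poly_eqI_all) (use line in \<open>simp add: weq_def lin_def cub_def algebra_simps power2_eq_square power3_eq_cube\<close>)
  then have "poly (pderiv (?L * ?L + lin * ?L - cub)) x = poly (pderiv (- ([:-x1,1:] * [:-x2,1:] * [:-x3,1:]))) x"
    by (simp add: power2_eq_square)
  also have "\<dots> = 0" using double
    by (auto simp: pderiv_mult pderiv_minus pderiv_pCons algebra_simps)
  finally have d: "poly (pderiv (?L * ?L + lin * ?L - cub)) x = 0" .
  let ?y = "l * x + v"
  have d2: "2 * ?y + a 1 * x + a 3 = 0"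
    using two by (simp add: negy_def algebra_simps eq_neg_iff_add_eq_0)
  have "poly (pderiv (?L * ?L + lin * ?L - cub)) x =
     l * (2 * ?y + a 1 * x + a 3) + (a 1 * ?y - 3 * x\<^sup>2 - 2 * a 2 * x - a 4)"
    by (simp add: pderiv_mult pderiv_diff pderiv_add pderiv_pCons lin_def cub_def algebra_simps power2_eq_square)
  then have "a 1 * ?y - 3 * x\<^sup>2 - 2 * a 2 * x - a 4 = 0" using d d2 by simp
  moreover have "weq a x ?y = 0" using line[of x] double by auto
  ultimately show False using nonsing d2 unfolding nonsingular_def by blast
qed

text \<open>With the line L as second generator of each point ideal, the only product of generators
  without a factor L is (x - x1)(x - x2)(x - x3), and on the curve this equals L L'. Conversely L^2,
  the three products of two factors x - xi, and L' carry L into the ideal product. A common zero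
  would be a double intersection point equal to its own negative, contrary to
  \<open>nonvertical_tangent\<close>.\<close>

lemma IP_line:
  assumes line: "\<And>x. weq a x (l * x + v) = - ((x - x1) * (x - x2) * (x - x3))"
    and y: "y1 = l * x1 + v" "y2 = l * x2 + v" "y3 = l * x3 + v" and I: "idl I"
  shows "simi 1 (IP (x1, y1) (IP (x2, y2) (IP (x3, y3) I))) [:[:- v, - l:], 1:] I"
    (is "simi 1 ?I1 ?l I")
proof -
  define L where "L = [:[:- v, - l:], 1:]"
  \<comment> \<open>Up to sign, the conjugate of \<open>L\<close> under y ->
    \<open>negy x y\<close>.\<close>
  define L' where "L' = [:[:a 3 + v, a 1 + l:], 1:]"
  let ?I3 = "IP (x3, y3) I" and ?I2 = "IP (x2, y2) (IP (x3, y3) I)"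
  have i3: "idl ?I3" and i2: "idl ?I2" and i1: "idl ?I1" using I by (auto intro!: idl_IP)
  have LL: "eqE (xpol x1 * (xpol x2 * xpol x3)) (L * L')"
    unfolding eqE_def
  proof safe
    fix x y assume P: "on_aff a x y"
    have "eval2 (L * L') x y = weq a x y - weq a x (l * x + v)"
      by (simp add: L_def L'_def weq_def algebra_simps power2_eq_square)
    also have "\<dots> = eval2 (xpol x1 * (xpol x2 * xpol x3)) x y"
      unfolding line using P by (simp add: on_aff_def algebra_simps)
    finally show "eval2 (xpol x1 * (xpol x2 * xpol x3)) x y = eval2 (L * L') x y" ..
  qed
  have "\<exists>G\<in>I. eqE (1 * F) (L * G)" if F: "F \<in> ?I1" for F
  proof -
    obtain A B where A: "A \<in> ?I2" "B \<in> ?I2" "eqE F (xpol x1 * A + L * B)"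
      using F unfolding IP_line_form[OF y(1) i2] L_def[symmetric] by blast
    obtain C D where C: "C \<in> ?I3" "D \<in> ?I3" "eqE A (xpol x2 * C + L * D)"
      using A(1) unfolding IP_line_form[OF y(2) i3] L_def[symmetric] by blast
    obtain G H where G: "G \<in> I" "H \<in> I" "eqE C (xpol x3 * G + L * H)"
      using C(1) unfolding IP_line_form[OF y(3) I] L_def[symmetric] by blast
    have sub: "?I3 \<subseteq> I" "?I2 \<subseteq> I"
    proof -
      have *: "IP P K \<subseteq> K" if "idl K" for P K
      proof
        fix F assume "F \<in> IP P K"
        then obtain G H where "G \<in> K" "H \<in> K" "eqE F (xpol (fst P) * G + ypol (snd P) * H)"
          by (auto simp: IP_def)
        then show "F \<in> K" using that by (meson idl_add idl_eqE idl_mult)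
      qed
      show "?I3 \<subseteq> I" "?I2 \<subseteq> I" using *[OF I] *[OF i3] by blast+
    qed
    let ?K = "L' * G + (xpol x1 * xpol x2) * H + xpol x1 * D + B"
    have "?K \<in> I" using A C G sub I by (intro idl_add idl_mult) auto
    moreover have "eqE F (L * ?K)"
    proof -
      have "eqE F (xpol x1 * (xpol x2 * (xpol x3 * G + L * H) + L * D) + L * B)"
        using A(3) C(3) G(3) by (simp add: eqE_def)
      also have "\<dots> = (xpol x1 * (xpol x2 * xpol x3)) * G + L * ((xpol x1 * xpol x2) * H + xpol x1 * D + B)"
        by (simp only: ring_distribs ac_simps)
      also have "eqE \<dots> ((L * L') * G + L * ((xpol x1 * xpol x2) * H + xpol x1 * D + B))"
        by (intro eqE_add eqE_mult LL eqE_refl)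
      also have "\<dots> = L * ?K" by (simp only: ring_distribs ac_simps)
      finally show ?thesis .
    qed
    ultimately show ?thesis by auto
  qed
  moreover have "L * G \<in> ?I1" if G: "G \<in> I" for G
  proof (rule mem_by_multipliers[OF i1])
    fix x y assume P: "on_aff a x y"
    have x3: "xpol x3 * G \<in> ?I3" using IP_x[OF I G, of "(x3,y3)"] by simp
    have l3: "L * G \<in> ?I3" using IP_line_mem[OF y(3) I G] by (simp add: L_def)
    have x2x3: "xpol x2 * (xpol x3 * G) \<in> ?I2" using IP_x[OF i3 x3, of "(x2,y2)"] by simp
    have x2l3: "xpol x2 * (L * G) \<in> ?I2" using IP_x[OF i3 l3, of "(x2,y2)"] by simp
    have l2x3: "L * (xpol x3 * G) \<in> ?I2" using IP_line_mem[OF y(2) i3 x3] by (simp add: L_def)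
    have l2l3: "L * (L * G) \<in> ?I2" using IP_line_mem[OF y(2) i3 l3] by (simp add: L_def)
    have e1: "(L * L) * (L * G) \<in> ?I1"
      using IP_line_mem[OF y(1) i2 l2l3] by (simp only: L_def[symmetric] ac_simps)
    have e2: "(xpol x1 * xpol x2) * (L * G) \<in> ?I1"
      using IP_x[OF i2 x2l3, of "(x1,y1)"] by (simp only: fst_conv ac_simps)
    have e3: "(xpol x1 * xpol x3) * (L * G) \<in> ?I1"
      using IP_x[OF i2 l2x3, of "(x1,y1)"] by (simp only: fst_conv ac_simps)
    have e4: "(xpol x2 * xpol x3) * (L * G) \<in> ?I1"
      using IP_line_mem[OF y(1) i2 x2x3] by (simp only: L_def[symmetric] ac_simps)
    have "xpol x1 * (xpol x2 * (xpol x3 * G)) \<in> ?I1" using IP_x[OF i2 x2x3, of "(x1,y1)"] by simp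
    moreover have "eqE (L' * (L * G)) (xpol x1 * (xpol x2 * (xpol x3 * G)))"
      using eqE_mult[OF eqE_sym[OF LL] eqE_refl[of G]] by (simp only: ac_simps)
    ultimately have e5: "L' * (L * G) \<in> ?I1" using idl_eqE[OF i1] by blast
    have "eval2 (L * L) x y \<noteq> 0 \<or> eval2 (xpol x1 * xpol x2) x y \<noteq> 0 \<or> eval2 (xpol x1 * xpol x3) x y \<noteq> 0
      \<or> eval2 (xpol x2 * xpol x3) x y \<noteq> 0 \<or> eval2 L' x y \<noteq> 0"
    proof (rule ccontr)
      assume "\<not> ?thesis"
      then have *: "eval2 (L * L) x y = 0" "eval2 (xpol x1 * xpol x2) x y = 0"
        "eval2 (xpol x1 * xpol x3) x y = 0" "eval2 (xpol x2 * xpol x3) x y = 0" "eval2 L' x y = 0" by auto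
      have "eval2 L x y = 0" using *(1) by (metis eval2_mult mult_eq_0_iff)
      then have yl: "y = l * x + v" by (simp add: L_def algebra_simps)
      have "negy x y = y" using *(5) by (simp add: L'_def negy_def yl algebra_simps eq_neg_iff_add_eq_0)
      moreover have "(x = x1 \<and> x = x2) \<or> (x = x1 \<and> x = x3) \<or> (x = x2 \<and> x = x3)"
        using *(2-4) unfolding eval2_mult mult_eq_0_iff by auto
      ultimately show False using nonvertical_tangent[OF line] yl by blast
    qed
    then show "\<exists>c. c * (L * G) \<in> ?I1 \<and> eval2 c x y \<noteq> 0"
      using e1 e2 e3 e4 e5 by metis
  qed
  ultimately show ?thesis unfolding simi_def L_def by (metis eqE_refl mult_1)
qed

end

section \<open>Sums of points and principal divisors\<close>

context elliptic
begin

text \<open>\<open>x3\<close> is chosen so that the curve equation along the line, plus the product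
  of the three factors, has no quadratic term. The remaining linear polynomial vanishes at
  \<open>x1\<close> and \<open>x2\<close>; if these coincide, its slope vanishes by the choice of
  the tangent slope \<open>l\<close>.\<close>

lemma chord_tangent:
  assumes P: "on_aff a x1 y1" and R: "on_aff a x2 y2"
    and nopp: "\<not> (x1 = x2 \<and> y1 + y2 + a 1 * x2 + a 3 = 0)"
    and l: "l = (if x1 \<noteq> x2 then (y2 - y1) / (x2 - x1)
                      else (3 * x1^2 + 2 * a 2 * x1 + a 4 - a 1 * y1) / (2 * y1 + a 1 * x1 + a 3))"
    and v: "v = y1 - l * x1" and x3: "x3 = l^2 + a 1 * l - a 2 - x1 - x2"
  shows "y2 = l * x2 + v" and "\<And>x. weq a x (l * x + v) = - ((x - x1) * (x - x2) * (x - x3))"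
proof -
  have tangent: "y2 = y1" if "x1 = x2"
  proof -
    have "y2 \<noteq> negy x1 y1" using nopp that by (auto simp: negy_def)
    then show ?thesis using same_x[OF P] R that by blast
  qed
  show y2: "y2 = l * x2 + v"
  proof (cases "x1 = x2")
    case False
    then have "l * (x2 - x1) = y2 - y1" using l by simp
    moreover have "l * x2 + v = y1 + l * (x2 - x1)" by (simp add: v algebra_simps)
    ultimately show ?thesis by simp
  qed (use tangent v in auto)
  define \<alpha> where "\<alpha> = 2 * l * v + a 1 * v + a 3 * l - a 4 + x1 * x2 + x1 * x3 + x2 * x3"
  define \<beta> where "\<beta> = v\<^sup>2 + a 3 * v - a 6 - x1 * x2 * x3"
  have lin: "weq a x (l * x + v) + (x - x1) * (x - x2) * (x - x3) = \<alpha> * x + \<beta>" for x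
    unfolding x3 weq_def \<alpha>_def \<beta>_def by (simp add: algebra_simps power2_eq_square power3_eq_cube)
  have 1: "\<alpha> * x1 + \<beta> = 0" using lin[of x1] P v by (simp add: on_aff_def)
  have 2: "\<alpha> * x2 + \<beta> = 0" using lin[of x2] R y2 by (simp add: on_aff_def)
  have "\<alpha> = 0"
  proof (cases "x1 = x2")
    case False
    have "\<alpha> * (x1 - x2) = (\<alpha> * x1 + \<beta>) - (\<alpha> * x2 + \<beta>)" by (simp add: algebra_simps)
    then have "\<alpha> * (x1 - x2) = 0" using 1 2 by simp
    then show ?thesis using False by simp
  next
    case True
    then have "y1 + y1 + a 1 * x1 + a 3 \<noteq> 0" using nopp tangent by metis
    then have "2 * y1 + a 1 * x1 + a 3 \<noteq> 0" by (simp only: mult_2 not_False_eq_True)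
    then have "l * (2 * y1 + a 1 * x1 + a 3) = 3 * x1^2 + 2 * a 2 * x1 + a 4 - a 1 * y1"
      using l True by simp
    moreover have "\<alpha> = l * (2 * y1 + a 1 * x1 + a 3) - (3 * x1^2 + 2 * a 2 * x1 + a 4 - a 1 * y1)"
      unfolding \<alpha>_def x3 v True[symmetric] by (simp add: algebra_simps power2_eq_square)
    ultimately show ?thesis by simp
  qed
  moreover have "\<beta> = 0" using 1 \<open>\<alpha> = 0\<close> by simp
  ultimately show "weq a x (l * x + v) = - ((x - x1) * (x - x2) * (x - x3))" for x
    using lin[of x] by (simp add: eq_neg_iff_add_eq_0)
qed

text \<open>For S = P + R, the product of the ideals of P, R, S and -S with \<open>I\<close> is
  computed in two ways: S and -S together give the vertical line x - x_S, while P, R and -S together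
  give the chord.\<close>

lemma IP_add:
  assumes P: "on_aff a x1 y1" and R: "on_aff a x2 y2" and I: "idl I"
    and sum: "ec_add a (Aff x1 y1) (Aff x2 y2) = Aff x y"
  shows "on_aff a x y \<and> (\<exists>L. dg L = 3 \<and> \<not> eqE L 0 \<and> simi (xpol x) (IP (x1, y1) (IP (x2, y2) I)) L (IP (x, y) I))"
proof -
  define l where l: "l = (if x1 \<noteq> x2 then (y2 - y1) / (x2 - x1)
                      else (3 * x1^2 + 2 * a 2 * x1 + a 4 - a 1 * y1) / (2 * y1 + a 1 * x1 + a 3))"
  define v where v: "v = y1 - l * x1"
  define x3 where x3: "x3 = l^2 + a 1 * l - a 2 - x1 - x2"
  have nopp: "\<not> (x1 = x2 \<and> y1 + y2 + a 1 * x2 + a 3 = 0)"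
    using sum by (auto simp: ec_add_def)
  have xy: "x = x3" "y = - (l + a 1) * x3 - v - a 3"
    using sum nopp unfolding ec_add_def point.case Let_def l[symmetric] v[symmetric] x3[symmetric]
    by (auto split: if_splits)
  note ct = chord_tangent[OF P R nopp l v x3]
  have y: "y = negy x (l * x + v)" by (simp add: xy negy_def algebra_simps)
  have "weq a x (l * x + v) = 0" using ct(2)[of x] xy(1) by simp
  then have on3: "on_aff a x (l * x + v)" by (simp add: on_aff_def)
  then have on: "on_aff a x y" by (simp add: y on_aff_negy)
  have ny: "negy x y = l * x + v" by (simp add: y)
  let ?J = "IP (x1, y1) (IP (x2, y2) I)"
  let ?L = "[:[:- v, - l:], 1:]"
  have "simi 1 (IP (x, y) (IP (x, l * x + v) ?J)) (xpol x) ?J"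
    using IP_opp[OF on, of ?J] idl_IP I ny by simp
  moreover have "IP (x, y) (IP (x, l * x + v) ?J) = IP (x1, y1) (IP (x2, y2) (IP (x, l * x + v) (IP (x, y) I)))"
    using I by (simp add: IP_comm idl_IP)
  moreover have "simi 1 (IP (x1, y1) (IP (x2, y2) (IP (x, l * x + v) (IP (x, y) I)))) ?L (IP (x, y) I)"
    by (rule IP_line) (use ct xy(1) v I in \<open>auto intro: idl_IP\<close>)
  ultimately have "simi (xpol x * 1) ?J (1 * ?L) (IP (x, y) I)"
    by (metis simi_sym simi_trans)
  moreover have "dg ?L = 3" by (rule dg_y) simp
  ultimately show ?thesis using on nz_y by (metis mult_1 mult_1_right)
qed

definition psum :: "('b \<times> 'b) list \<Rightarrow> 'b point" where
  "psum M = foldr (\<lambda>P S. ec_add a (Aff (fst P) (snd P)) S) M Inf"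

lemma psum_simps [simp]:
  "psum [] = Inf" "psum (P # M) = ec_add a (Aff (fst P) (snd P)) (psum M)"
  by (simp_all add: psum_def)

text \<open>\<open>I\<close> and \<open>I'\<close> are equivalent ideals, cutting out divisors of degree \<open>m\<close> and \<open>n\<close>.\<close>
definition reduces_to :: "nat \<Rightarrow> 'b poly poly set \<Rightarrow> nat \<Rightarrow> 'b poly poly set \<Rightarrow> bool" where
  "reduces_to m I n I' \<longleftrightarrow> (\<exists>g h. \<not> eqE g 0 \<and> \<not> eqE h 0 \<and> simi g I h I' \<and> dg g + m = dg h + n)"

text \<open>Both ideals gain a point while the indices stay, which is consistent because only the
  difference of \<open>m\<close> and \<open>n\<close> enters the degree balance.\<close>

lemma reduces_to_IP: "reduces_to m I n I' \<Longrightarrow> reduces_to m (IP P I) n (IP P I')"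
  unfolding reduces_to_def using simi_IP by blast

lemma reduces_to_trans:
  assumes "reduces_to m I n I'" "reduces_to m' I' n' I''"
  shows "reduces_to (m + m') I (n + n') I''"
proof -
  obtain g h g' h' where *: "\<not> eqE g 0" "\<not> eqE h 0" "simi g I h I'" "dg g + m = dg h + n"
     "\<not> eqE g' 0" "\<not> eqE h' 0" "simi g' I' h' I''" "dg g' + m' = dg h' + n'"
    using assms unfolding reduces_to_def by blast
  then have "simi (g * g') I (h * h') I''" "dg (g * g') + (m + m') = dg (h * h') + (n + n')"
    "\<not> eqE (g * g') 0" "\<not> eqE (h * h') 0"
    using simi_trans dg_mult eqE_mult_0 by (auto simp: dg_mult)
  then show ?thesis unfolding reduces_to_def by blast
qed

text \<open>Each step replaces two points of the divisor by their sum, at the price of a line through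
  them and a vertical line; no associativity is used.\<close>
theorem reduces_to_psum:
  assumes "\<forall>P\<in>set M. on_aff a (fst P) (snd P)"
  shows "case psum M of Inf \<Rightarrow> reduces_to (length M) (IM M) 0 UNIV
    | Aff x y \<Rightarrow> on_aff a x y \<and> reduces_to (length M) (IM M) 1 (IP (x, y) UNIV)"
  using assms
proof (induction M)
  case Nil
  have "reduces_to 0 UNIV 0 UNIV"
    unfolding reduces_to_def by (intro exI[of _ 1]) (simp add: simi_refl)
  then show ?case by simp
next
  case (Cons P M)
  obtain x1 y1 where P: "P = (x1, y1)" by force
  have on: "on_aff a x1 y1" using Cons.prems P by simp
  show ?case
  proof (cases "psum M")
    case Inf
    then have "reduces_to (length M) (IM M) 0 UNIV" using Cons by simp
    then have "reduces_to (length M) (IM (P # M)) 0 (IP P UNIV)" using reduces_to_IP by simp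
    then have "reduces_to (length (P # M)) (IM (P # M)) 1 (IP P UNIV)"
      unfolding reduces_to_def by simp
    then show ?thesis using Inf P on by (simp add: ec_add_def)
  next
    case (Aff x2 y2)
    then have on2: "on_aff a x2 y2" and r: "reduces_to (length M) (IM M) 1 (IP (x2, y2) UNIV)"
      using Cons by auto
    then have r: "reduces_to (length M) (IM (P # M)) 1 (IP P (IP (x2, y2) UNIV))"
      using reduces_to_IP by simp
    show ?thesis
    proof (cases "ec_add a (Aff x1 y1) (Aff x2 y2)")
      case sum: Inf
      then have "x1 = x2" "y2 = negy x1 y1"
        by (auto simp: ec_add_def Let_def negy_def algebra_simps eq_neg_iff_add_eq_0 split: if_splits)
      then have "simi 1 (IP P (IP (x2, y2) UNIV)) (xpol x1) UNIV"
        using IP_opp[OF on idl_UNIV] P by simp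
      then have "reduces_to 2 (IP P (IP (x2, y2) UNIV)) 0 UNIV"
        unfolding reduces_to_def by (intro exI[of _ 1] exI[of _ "xpol x1"]) simp
      from reduces_to_trans[OF r this] have "reduces_to (length (P # M)) (IM (P # M)) 0 UNIV"
        unfolding reduces_to_def by simp
      then show ?thesis using sum Aff P by simp
    next
      case sum: (Aff x y)
      obtain L where L: "on_aff a x y" "dg L = 3" "\<not> eqE L 0"
        "simi (xpol x) (IP (x1, y1) (IP (x2, y2) UNIV)) L (IP (x, y) UNIV)"
        using IP_add[OF on on2 idl_UNIV sum] by blast
      \<comment> \<open>The balance is 2 + 1 = 3 + 0: the vertical line has pole order 2 and the
        chord pole order 3.\<close>
      then have "reduces_to 1 (IP P (IP (x2, y2) UNIV)) 0 (IP (x, y) UNIV)"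
        unfolding reduces_to_def P by (intro exI[of _ "xpol x"] exI[of _ L]) simp
      from reduces_to_trans[OF r this] have "reduces_to (length (P # M)) (IM (P # M)) 1 (IP (x, y) UNIV)"
        by simp
      then show ?thesis using sum Aff P L(1) by simp
    qed
  qed
qed

lemma IP_vanish: "F \<in> IP (x, y) I \<Longrightarrow> on_aff a x y \<Longrightarrow> eval2 F x y = 0"
  by (auto simp: IP_def eqE_def)

text \<open>Carrying \<open>F\<close> along the reduction leaves a nonzero \<open>r\<close> with dg
  F - length M equal to dg r if the sum is \<open>Inf\<close>, and to dg r - 1 otherwise. In the
  second case \<open>r\<close> vanishes at the sum, so dg r is at least 2 and equality is
  impossible.\<close>

lemma dg_in_IM:
  assumes M: "\<forall>P\<in>set M. on_aff a (fst P) (snd P)" and F: "F \<in> IM M" "\<not> eqE F 0"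
  shows "length M \<le> dg F" and "dg F = length M \<Longrightarrow> psum M = Inf"
proof -
  have *: "length M \<le> dg F \<and> (dg F = length M \<longrightarrow> psum M = Inf)"
  proof (cases "psum M")
    case Inf
    then obtain g h where gh: "\<not> eqE g 0" "\<not> eqE h 0" "simi g (IM M) h UNIV" "dg g + length M = dg h"
      using reduces_to_psum[OF M] by (auto simp: reduces_to_def)
    then obtain r where r: "eqE (g * F) (h * r)" using F by (auto simp: simi_def)
    have "\<not> eqE r 0"
      using r F gh(1) eqE_mult_0[of g F] eqE_mult_0[of h r] eqE_trans[of "g * F" "h * r" 0] by blast
    then have "dg g + dg F = dg h + dg r" using dg_eqE[OF r] F gh by (simp add: dg_mult)
    then show ?thesis using Inf gh by simp
  next
    case (Aff x y)
    then obtain g h where gh: "\<not> eqE g 0" "\<not> eqE h 0" "simi g (IM M) h (IP (x, y) UNIV)"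
        "dg g + length M = dg h + 1" and on: "on_aff a x y"
      using reduces_to_psum[OF M] by (auto simp: reduces_to_def)
    then obtain r where r: "r \<in> IP (x, y) UNIV" "eqE (g * F) (h * r)" using F by (meson simi_def)
    have nr: "\<not> eqE r 0"
      using r F gh(1) eqE_mult_0[of g F] eqE_mult_0[of h r] eqE_trans[of "g * F" "h * r" 0] by blast
    then have "dg g + dg F = dg h + dg r" using dg_eqE[OF r(2)] F gh by (simp add: dg_mult)
    moreover have "dg r \<ge> 2" using dg_ge2[OF nr on] IP_vanish[OF r(1) on] .
    ultimately show ?thesis using gh(4) by linarith
  qed
  show "length M \<le> dg F" using * by blast
  show "dg F = length M \<Longrightarrow> psum M = Inf" using * by blast
qed

lemma ex_in_IM:
  assumes M: "\<forall>P\<in>set M. on_aff a (fst P) (snd P)" and sum: "psum M = Inf"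
  obtains F where "F \<in> IM M" "\<not> eqE F 0" "dg F = length M"
proof -
  obtain g h where gh: "\<not> eqE g 0" "\<not> eqE h 0" "simi g (IM M) h UNIV" "dg g + length M = dg h"
    using reduces_to_psum[OF M] sum by (auto simp: reduces_to_def)
  then obtain F where F: "F \<in> IM M" "eqE (g * F) (h * 1)" by (meson UNIV_I simi_def)
  have nF: "\<not> eqE F 0"
    using F(2) gh eqE_mult_0[of g F] eqE_mult_0[of h 1] eqE_trans[OF eqE_sym[OF F(2)], of 0] nz_1 by blast
  then have "dg g + dg F = dg h + dg 1" using dg_eqE[OF F(2)] gh dg_mult[of h 1] by (simp add: dg_mult)
  then show ?thesis using that F nF gh by simp
qed

lemma IM_vanish: "F \<in> IM M \<Longrightarrow> (x, y) \<in> set M \<Longrightarrow> on_aff a x y \<Longrightarrow> eval2 F x y = 0"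
proof (induction M arbitrary: F)
  case (Cons P M)
  obtain G H where G: "G \<in> IM M" "H \<in> IM M" "eqE F (xpol (fst P) * G + ypol (snd P) * H)"
    using Cons.prems(1) by (auto simp: IP_def)
  show ?case
  proof (cases "P = (x, y)")
    case True
    then show ?thesis using IP_vanish Cons.prems by auto
  next
    case False
    then have "eval2 G x y = 0" "eval2 H x y = 0" using Cons G by auto
    then show ?thesis using G(3) Cons.prems(3) by (auto simp: eqE_def)
  qed
qed simp

lemma IM_separates:
  assumes "(x, y) \<notin> set M"
  shows "\<exists>e\<in>IM M. eval2 e x y \<noteq> 0"
  using assms
proof (induction M)
  case Nil
  show ?case by (auto intro!: exI[of _ 1])
next
  case (Cons P M)
  then obtain e where e: "e \<in> IM M" "eval2 e x y \<noteq> 0" by auto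
  show ?case
  proof (cases "fst P = x")
    case True
    then have "snd P \<noteq> y" using Cons.prems by auto
    then show ?thesis
      using IP_y[OF idl_IM e(1), of P] e(2)
      by (intro bexI[of _ "ypol (snd P) * e"]) (simp_all only: eval2_mult IM.simps, simp)
  next
    case False
    then show ?thesis
      using IP_x[OF idl_IM e(1), of P] e(2)
      by (intro bexI[of _ "xpol (fst P) * e"]) (simp_all only: eval2_mult IM.simps, simp)
  qed
qed

text \<open>Chinese remaindering one point at a time. With \<open>e\<close> in the ideal of the
  remaining points and e - 1 in the ideal of the new point, F = e F - F (e - 1) lies in the product:
  in each term one factor lies in the ideal of the new point and the other in the ideal of the
  rest.\<close>

lemma vanish_IM:
  assumes "distinct M" "\<And>x y. (x, y) \<in> set M \<Longrightarrow> eval2 F x y = 0"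
  shows "F \<in> IM M"
  using assms
proof (induction M)
  case (Cons P M)
  obtain x y where P: "P = (x, y)" by force
  have F: "F \<in> IM M" using Cons by auto
  obtain G H where GH: "F = xpol x * G + ypol y * H"
    using eval2_Taylor[of F x y] Cons.prems(2)[of x y] P by auto
  have "(x, y) \<notin> set M" using Cons.prems P by auto
  then obtain e0 where "e0 \<in> IM M" "eval2 e0 x y \<noteq> 0" using IM_separates by blast
  then obtain A B where e: "1 + xpol x * A + ypol y * B \<in> IM M"
    using idl_normalise[OF idl_IM] by metis
  define e where "e = 1 + xpol x * A + ypol y * B"
  have "F = e * (xpol x * G + ypol y * H) - F * (xpol x * A + ypol y * B)"
    unfolding GH[symmetric] e_def by (simp only: ring_distribs ac_simps) simp
  also have "\<dots> = xpol x * (e * G - A * F) + ypol y * (e * H - B * F)"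
    by (simp only: ring_distribs ac_simps) simp
  finally have "eqE F (xpol x * (e * G - A * F) + ypol y * (e * H - B * F))" by (metis eqE_refl)
  moreover have "e * G - A * F \<in> IM M" "e * H - B * F \<in> IM M"
    using idl_diff[OF idl_IM idl_mult2[OF idl_IM e[folded e_def]] idl_mult[OF idl_IM F]] by blast+
  ultimately have "F \<in> IP P (IM M)" unfolding P by (intro IP_I[of "e * G - A * F" _ "e * H - B * F"]) simp_all
  then show ?case by simp
qed simp

end

section \<open>Linear codes and weight distributions\<close>

text \<open>Rewriting C(i,m) C(m,j) as C(i,j) C(i-j,m-j) leaves the alternating sum of the row i - j
  of Pascal's triangle.\<close>

lemma binomial_orthogonality:
  assumes "i \<le> n"
  shows "(\<Sum>m=j..n. (-1) ^ (m - j) * int (m choose j) * int (i choose m)) = (if i = j then 1 else 0)"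
proof (cases "i < j")
  case True
  then show ?thesis by (intro trans[OF sum.neutral]) auto
next
  case False
  have "(\<Sum>m=j..n. (-1) ^ (m - j) * int (m choose j) * int (i choose m)) =
      (\<Sum>m=j..i. (-1) ^ (m - j) * int (m choose j) * int (i choose m))"
    using assms by (intro sum.mono_neutral_right) auto
  also have "\<dots> = (\<Sum>m=j..i. (-1) ^ (m - j) * int (i choose j) * int ((i - j) choose (m - j)))"
  proof (intro sum.cong refl)
    fix m assume m: "m \<in> {j..i}"
    have "(i choose m) * (m choose j) = (i choose j) * ((i - j) choose (m - j))"
      using m by (intro choose_mult) auto
    then have "int (m choose j) * int (i choose m) = int (i choose j) * int ((i - j) choose (m - j))"
      by (metis mult.commute of_nat_mult)
    then show "(-1) ^ (m - j) * int (m choose j) * int (i choose m) =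
       (-1) ^ (m - j) * int (i choose j) * int ((i - j) choose (m - j))" by (simp add: mult.assoc)
  qed
  also have "\<dots> = (\<Sum>t\<le>i - j. (-1) ^ t * int (i choose j) * int ((i - j) choose t))"
    by (rule sum.reindex_bij_witness[of _ "\<lambda>t. t + j" "\<lambda>m. m - j"]) (use False in auto)
  also have "\<dots> = int (i choose j) * (\<Sum>t\<le>i - j. (-1) ^ t * int ((i - j) choose t))"
    by (simp add: sum_distrib_left mult_ac)
  also have "\<dots> = (if i = j then 1 else 0)"
  proof (cases "i = j")
    case False
    then show ?thesis using \<open>\<not> i < j\<close> choose_alternating_sum[of "i - j", where 'a = int] by simp
  qed simp
  finally show ?thesis .
qed

lemma binomial_inversion:
  fixes f B :: "nat \<Rightarrow> int"
  assumes B: "\<And>m. m \<le> n \<Longrightarrow> (\<Sum>i\<le>n. f i * int (i choose m)) = B m" and j: "j \<le> n"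
  shows "f j = (\<Sum>m=j..n. (-1) ^ (m - j) * int (m choose j) * B m)"
proof -
  have "(\<Sum>m=j..n. (-1) ^ (m - j) * int (m choose j) * B m) =
    (\<Sum>m=j..n. \<Sum>i\<le>n. f i * ((-1) ^ (m - j) * int (m choose j) * int (i choose m)))"
    by (intro sum.cong refl) (simp add: B[symmetric] sum_distrib_left mult_ac)
  also have "\<dots> = (\<Sum>i\<le>n. f i * (\<Sum>m=j..n. (-1) ^ (m - j) * int (m choose j) * int (i choose m)))"
    by (subst sum.swap) (simp add: sum_distrib_left)
  also have "\<dots> = (\<Sum>i\<le>n. f i * (if i = j then 1 else 0))"
    by (intro sum.cong refl) (subst binomial_orthogonality, auto)
  also have "\<dots> = f j" using j by (simp add: if_distrib sum.delta cong: if_cong)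
  finally show ?thesis ..
qed

text \<open>\<open>K\<close> is the dimension. The prescribed moments are those of an MDS code with
  an excess \<open>M\<close> at m = K, so \<open>M\<close> is the one free parameter; it turns out
  to be the number of words of weight n - K.\<close>

lemma nmds_weight_distribution:
  fixes W :: "nat \<Rightarrow> nat" and n K q M :: nat
  assumes K: "K < n"
    and B: "\<And>m. m \<le> n \<Longrightarrow> (\<Sum>w\<le>n. W w * ((n - w) choose m)) =
      (n choose m) * (if m < K then q ^ (K - m) else 1) + (if m = K then M else 0)"
  shows "W (n - K) = M"
    and "s \<in> {1..K} \<Longrightarrow> int (W (n - K + s)) =
          int (n choose (K - s)) * (\<Sum>j<s. (-1)^j * int ((n - K + s) choose j) * (int q ^ (s - j) - 1))
          + (-1)^s * int (K choose s) * int M"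
proof -
  \<comment> \<open>The moments without the contribution C(n,m) of the zero word. They vanish for m
    > K, so the inversion sums stop at \<open>K\<close>; the subtracted part inverts to zero at
    every index below \<open>n\<close>.\<close>
  define D where "D m = int (n choose m) * (if m < K then int q ^ (K - m) - 1 else 0) + (if m = K then int M else 0)" for m
  have "(\<Sum>i\<le>n. int (W (n - i)) * int (i choose m)) = int (n choose m) + D m" if "m \<le> n" for m
  proof -
    have "(\<Sum>i\<le>n. int (W (n - i)) * int (i choose m)) = (\<Sum>w\<le>n. int (W w) * int ((n - w) choose m))"
      by (rule sum.reindex_bij_witness[of _ "\<lambda>i. n - i" "\<lambda>i. n - i"]) auto
    also have "\<dots> = int (\<Sum>w\<le>n. W w * ((n - w) choose m))" by simp
    also have "\<dots> = int (n choose m) + D m"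
      unfolding B[OF that] D_def by (auto simp: algebra_simps)
    finally show ?thesis .
  qed
  note inv = binomial_inversion[of n "\<lambda>i. int (W (n - i))", OF this]
  have W: "int (W (n - j)) = (\<Sum>m=j..K. (-1) ^ (m - j) * int (m choose j) * D m)" if j: "j < n" for j
  proof -
    have "int (W (n - j)) = (\<Sum>m=j..n. (-1) ^ (m - j) * int (m choose j) * int (n choose m))
        + (\<Sum>m=j..n. (-1) ^ (m - j) * int (m choose j) * D m)"
      using inv[of j] j by (simp add: algebra_simps sum.distrib)
    also have "(\<Sum>m=j..n. (-1) ^ (m - j) * int (m choose j) * int (n choose m)) = 0"
      using binomial_orthogonality[of n n j] j by simp
    also have "(\<Sum>m=j..n. (-1) ^ (m - j) * int (m choose j) * D m) = (\<Sum>m=j..K. (-1) ^ (m - j) * int (m choose j) * D m)"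
      using K by (intro sum.mono_neutral_right) (auto simp: D_def)
    finally show ?thesis by simp
  qed
  show "W (n - K) = M" using W[OF K] by (simp add: D_def)
  assume s: "s \<in> {1..K}"
  let ?j = "K - s"
  have "int (W (n - ?j)) = (\<Sum>m=?j..<K. (-1) ^ (m - ?j) * int (m choose ?j) * D m) + (-1) ^ s * int (K choose ?j) * D K"
  proof -
    have "{?j..K} = insert K {?j..<K}" using s by auto
    then show ?thesis using W[of ?j] K s by simp
  qed
  also have "(\<Sum>m=?j..<K. (-1) ^ (m - ?j) * int (m choose ?j) * D m)
     = (\<Sum>i<s. int (n choose ?j) * ((-1) ^ i * int ((n - K + s) choose i) * (int q ^ (s - i) - 1)))"
  proof (rule sum.reindex_bij_witness[of _ "\<lambda>i. ?j + i" "\<lambda>m. m - ?j"])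
    fix m assume m: "m \<in> {?j..<K}"
    have "(n choose m) * (m choose ?j) = (n choose ?j) * ((n - ?j) choose (m - ?j))"
      using m K by (intro choose_mult) auto
    then have c: "int (m choose ?j) * int (n choose m) = int (n choose ?j) * int ((n - ?j) choose (m - ?j))"
      by (metis mult.commute of_nat_mult)
    have e: "n - ?j = n - K + s" "K - m = s - (m - ?j)" using m s K by auto
    have "(-1) ^ (m - ?j) * int (m choose ?j) * D m =
       (-1) ^ (m - ?j) * (int (m choose ?j) * int (n choose m)) * (int q ^ (K - m) - 1)"
      using m by (simp add: D_def)
    also have "\<dots> = int (n choose ?j) * ((-1) ^ (m - ?j) * int ((n - K + s) choose (m - ?j)) * (int q ^ (s - (m - ?j)) - 1))"
      unfolding c e(1) by (simp add: e(2) mult_ac)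
    finally show "int (n choose ?j) * ((-1) ^ (m - ?j) * int ((n - K + s) choose (m - ?j)) * (int q ^ (s - (m - ?j)) - 1))
       = (-1) ^ (m - ?j) * int (m choose ?j) * D m" by simp
  qed (use s in auto)
  also have "K choose ?j = K choose s" using s binomial_symmetric[of s K] by simp
  also have "n - ?j = n - K + s" using s K by auto
  finally show "int (W (n - K + s)) =
          int (n choose (K - s)) * (\<Sum>j<s. (-1)^j * int ((n - K + s) choose j) * (int q ^ (s - j) - 1))
          + (-1)^s * int (K choose s) * int M"
    by (simp add: sum_distrib_left D_def)
qed

text \<open>Pairs of a codeword and an m-subset of its zero positions, counted by codewords and by
  subsets.\<close>

lemma binomial_moments:
  assumes I: "finite I" and C: "finite C"
  shows "(\<Sum>w\<le>card I. wdist I C w * ((card I - w) choose m)) =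
    (\<Sum>T | T \<subseteq> I \<and> card T = m. card {c \<in> C. \<forall>i\<in>T. c i = 0})"
proof -
  let ?Z = "\<lambda>c. {i \<in> I. c i = 0}"
  have hw: "hweight I c \<le> card I" for c unfolding hweight_def using I by (intro card_mono) auto
  have Z: "card (?Z c) = card I - hweight I c" for c
  proof -
    have "card (?Z c) + hweight I c = card I"
      unfolding hweight_def using I by (subst card_Un_disjoint[symmetric]) (auto intro: arg_cong[where f = card])
    then show ?thesis by simp
  qed
  have "(\<Sum>w\<le>card I. wdist I C w * ((card I - w) choose m)) =
     (\<Sum>w\<le>card I. \<Sum>c | c \<in> C \<and> hweight I c = w. (card I - hweight I c) choose m)"
    by (intro sum.cong refl) (simp add: wdist_def)
  also have "\<dots> = (\<Sum>c\<in>C. (card I - hweight I c) choose m)"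
    using C hw by (intro sum.group) auto
  also have "\<dots> = (\<Sum>c\<in>C. card {T. T \<subseteq> ?Z c \<and> card T = m})"
    using I by (intro sum.cong refl) (simp add: n_subsets Z)
  also have "\<dots> = (\<Sum>c\<in>C. card {T \<in> {T. T \<subseteq> I \<and> card T = m}. \<forall>i\<in>T. c i = 0})"
    by (intro sum.cong refl arg_cong[where f = card]) auto
  also have "\<dots> = (\<Sum>T | T \<subseteq> I \<and> card T = m. card {c \<in> C. \<forall>i\<in>T. c i = 0})"
    using I C by (subst sum_multicount_gen[symmetric]) auto
  finally show ?thesis .
qed

section \<open>Linear functionals over a finite field and dual codes\<close>

locale finite_subfield =
  fixes F :: "'b::field set"
  assumes finite: "finite F" and one: "1 \<in> F"
    and add: "x \<in> F \<Longrightarrow> y \<in> F \<Longrightarrow> x + y \<in> F" and diff: "x \<in> F \<Longrightarrow> y \<in> F \<Longrightarrow> x - y \<in> F"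
    and mult: "x \<in> F \<Longrightarrow> y \<in> F \<Longrightarrow> x * y \<in> F" and inv: "x \<in> F \<Longrightarrow> inverse x \<in> F"
begin

lemma zero: "0 \<in> F" using diff[OF one one] by simp
lemma minus: "x \<in> F \<Longrightarrow> - x \<in> F" using diff[OF zero] by simp
lemma divide: "x \<in> F \<Longrightarrow> y \<in> F \<Longrightarrow> x / y \<in> F" using mult inv by (simp add: divide_inverse)
lemma power: "x \<in> F \<Longrightarrow> x ^ n \<in> F" by (induction n) (auto intro: one mult)
lemma sum: "(\<And>i. i \<in> S \<Longrightarrow> f i \<in> F) \<Longrightarrow> sum f S \<in> F"
  by (induction S rule: infinite_finite_induct) (auto intro: zero add)

lemma card_gt_1: "card F > 1"
proof -
  have "card {0, 1::'b} \<le> card F" using zero one finite by (intro card_mono) auto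
  then show ?thesis by simp
qed

definition linear_code :: "('i \<Rightarrow> 'b) set \<Rightarrow> bool" where
  "linear_code V \<longleftrightarrow> finite V \<and> (\<lambda>_. 0) \<in> V \<and> (\<forall>u\<in>V. \<forall>v\<in>V. (\<lambda>i. u i + v i) \<in> V) \<and>
     (\<forall>t\<in>F. \<forall>v\<in>V. (\<lambda>i. t * v i) \<in> V)"

definition functional :: "('i \<Rightarrow> 'b) set \<Rightarrow> (('i \<Rightarrow> 'b) \<Rightarrow> 'b) \<Rightarrow> bool" where
  "functional V \<phi> \<longleftrightarrow> (\<forall>v\<in>V. \<phi> v \<in> F) \<and> (\<forall>u\<in>V. \<forall>v\<in>V. \<phi> (\<lambda>i. u i + v i) = \<phi> u + \<phi> v) \<and>
     (\<forall>t\<in>F. \<forall>v\<in>V. \<phi> (\<lambda>i. t * v i) = t * \<phi> v)"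

text \<open>Every fibre is the kernel translated by a multiple of a vector on which the functional
  takes the value 1.\<close>

lemma card_kernel:
  assumes V: "linear_code V" and \<phi>: "functional V \<phi>" and nz: "\<exists>v\<in>V. \<phi> v \<noteq> 0"
  shows "card V = card F * card {v \<in> V. \<phi> v = 0}"
proof -
  obtain v0 where v0: "v0 \<in> V" "\<phi> v0 \<noteq> 0" using nz by blast
  define v1 where "v1 = (\<lambda>i. inverse (\<phi> v0) * v0 i)"
  have v1: "v1 \<in> V" "\<phi> v1 = 1"
    using V \<phi> v0 inv unfolding linear_code_def functional_def v1_def by auto
  have fib: "card {v \<in> V. \<phi> v = t} = card {v \<in> V. \<phi> v = 0}" if t: "t \<in> F" for t
  proof (rule bij_betw_same_card, rule bij_betw_byWitness[of _ "\<lambda>v i. v i + t * v1 i" "\<lambda>v i. v i + (- t) * v1 i"])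
    have step: "(\<lambda>i. v i + c * v1 i) \<in> V \<and> \<phi> (\<lambda>i. v i + c * v1 i) = \<phi> v + c" if "v \<in> V" "c \<in> F" for v c
    proof -
      have "(\<lambda>i. c * v1 i) \<in> V" using V v1 that by (auto simp: linear_code_def)
      moreover have "\<phi> (\<lambda>i. c * v1 i) = c" using \<phi> v1 that by (auto simp: functional_def)
      ultimately show ?thesis using V \<phi> that by (auto simp: linear_code_def functional_def)
    qed
    show "(\<lambda>v i. v i + - t * v1 i) ` {v \<in> V. \<phi> v = t} \<subseteq> {v \<in> V. \<phi> v = 0}"
      using step t minus by fastforce
    show "(\<lambda>v i. v i + t * v1 i) ` {v \<in> V. \<phi> v = 0} \<subseteq> {v \<in> V. \<phi> v = t}"
      using step t by fastforce
  qed auto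
  have "card V = (\<Sum>v\<in>V. 1)" by simp
  also have "\<dots> = (\<Sum>t\<in>F. \<Sum>v | v \<in> V \<and> \<phi> v = t. 1)"
    using V \<phi> finite by (subst sum.group) (auto simp: linear_code_def functional_def)
  also have "\<dots> = card F * card {v \<in> V. \<phi> v = 0}" using fib by simp
  finally show ?thesis .
qed

lemma card_kernel_le:
  assumes V: "linear_code V" and \<phi>: "functional V \<phi>"
  shows "card V \<le> card F * card {v \<in> V. \<phi> v = 0}"
proof (cases "\<exists>v\<in>V. \<phi> v \<noteq> 0")
  case False
  then have "{v \<in> V. \<phi> v = 0} = V" by auto
  then show ?thesis using card_gt_1 by simp
qed (use card_kernel[OF V \<phi>] in simp)

text \<open>Count the orthogonal pairs of a vector supported on \<open>T\<close> and a codeword in two ways.\<close>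
lemma card_dual_support:
  assumes C: "linear_code C" and val: "\<And>c i. c \<in> C \<Longrightarrow> i \<in> I \<Longrightarrow> c i \<in> F"
    and I: "finite I" and T: "T \<subseteq> I"
  shows "card {v \<in> dual_code F I C. \<forall>i\<in>I - T. v i = 0} * card C =
     card F ^ card T * card {c \<in> C. \<forall>i\<in>T. c i = 0}"
proof -
  let ?q = "card F"
  have fT: "finite T" using I T finite_subset by blast
  define V where "V = {v. (\<forall>i. i \<notin> T \<longrightarrow> v i = 0) \<and> (\<forall>i\<in>T. v i \<in> F)}"
  define D where "D = {v \<in> dual_code F I C. \<forall>i\<in>I - T. v i = 0}"
  define ip where "ip v c = (\<Sum>i\<in>T. v i * c i)" for v c :: "'a \<Rightarrow> 'b"
  have bij: "bij_betw (\<lambda>v. restrict v T) V (T \<rightarrow>\<^sub>E F)"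
    by (rule bij_betw_byWitness[of _ "\<lambda>v i. if i \<in> T then v i else 0"])
      (auto simp: V_def fun_eq_iff restrict_def PiE_def extensional_def)
  have cV: "card V = ?q ^ card T"
    using bij_betw_same_card[OF bij] fT by (simp add: card_PiE)
  have fV: "finite V" using bij_betw_finite[OF bij] fT finite by (simp add: finite_PiE)
  have V: "linear_code V" unfolding linear_code_def using fV by (auto simp: V_def intro: zero add mult)
  have fC: "finite C" using C by (simp add: linear_code_def)
  have fun1: "functional V (\<lambda>v. ip v c)" if "c \<in> C" for c
    unfolding functional_def ip_def using val[OF that] T
    by (auto simp: V_def sum.distrib sum_distrib_left algebra_simps intro!: sum mult)
  have fun2: "functional C (ip v)" if "v \<in> V" for v
    unfolding functional_def ip_def using that val T
    by (auto simp: V_def sum.distrib sum_distrib_left algebra_simps intro!: sum mult)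
  have D: "D = {v \<in> V. \<forall>c\<in>C. ip v c = 0}"
  proof -
    have ip: "(\<Sum>i\<in>I. v i * c i) = ip v c" if "\<forall>i\<in>I - T. v i = 0" for v c
      unfolding ip_def using I T that by (intro sum.mono_neutral_right) auto
    have "v \<in> D \<longleftrightarrow> v \<in> V \<and> (\<forall>c\<in>C. ip v c = 0)" for v
    proof
      assume v: "v \<in> D"
      then have z: "\<forall>i\<in>I - T. v i = 0" by (simp add: D_def)
      with v T show "v \<in> V \<and> (\<forall>c\<in>C. ip v c = 0)"
        by (auto simp: D_def V_def dual_code_def ip[symmetric])
    next
      assume v: "v \<in> V \<and> (\<forall>c\<in>C. ip v c = 0)"
      then have z: "\<forall>i\<in>I - T. v i = 0" by (simp add: V_def)
      have "\<forall>i. i \<notin> I \<longrightarrow> v i = 0" using v T by (auto simp: V_def)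
      moreover have "v i \<in> F" if "i \<in> I" for i
        using v that zero by (cases "i \<in> T") (auto simp: V_def)
      ultimately show "v \<in> D" using v z by (simp add: D_def dual_code_def ip)
    qed
    then show ?thesis by blast
  qed
  have DV: "D \<subseteq> V" by (auto simp: D)
  let ?Z = "{c \<in> C. \<forall>i\<in>T. c i = 0}"
  \<comment> \<open>After multiplication by q, every row and every column contributes the same
    amount, plus a surplus of q - 1 times that amount on the radical. The common part |V| |C|
    cancels when the two counts are compared, leaving the two radicals.\<close>
  have rows: "?q * card {c \<in> C. ip v c = 0} = (if v \<in> D then ?q * card C else card C)" if v: "v \<in> V" for v
  proof (cases "v \<in> D")
    case True
    then have "{c \<in> C. ip v c = 0} = C" by (auto simp: D)
    then show ?thesis using True by simp
  next
    case False
    then have "\<exists>c\<in>C. ip v c \<noteq> 0" using v by (auto simp: D)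
    then show ?thesis using card_kernel[OF C fun2[OF v]] False by simp
  qed
  have cols: "?q * card {v \<in> V. ip v c = 0} = (if c \<in> ?Z then ?q * card V else card V)" if c: "c \<in> C" for c
  proof (cases "c \<in> ?Z")
    case True
    then have "{v \<in> V. ip v c = 0} = V" by (auto simp: ip_def)
    then show ?thesis using True by simp
  next
    case False
    then obtain i where i: "i \<in> T" "c i \<noteq> 0" using c by blast
    let ?e = "\<lambda>j. if j = i then 1 else 0 :: 'b"
    have "?e \<in> V" using i by (auto simp: V_def zero one)
    moreover have "ip ?e c = c i" using i fT by (simp add: ip_def if_distrib[of "\<lambda>x. x * _"] sum.delta cong: if_cong)
    ultimately have "\<exists>v\<in>V. ip v c \<noteq> 0" using i by metis
    then show ?thesis using card_kernel[OF V fun1[OF c]] False by (simp only: if_False)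
  qed
  have "?q * (\<Sum>v\<in>V. card {c \<in> C. ip v c = 0}) = (\<Sum>v\<in>V. if v \<in> D then ?q * card C else card C)"
    unfolding sum_distrib_left by (intro sum.cong refl rows)
  also have "\<dots> = (\<Sum>v\<in>V. card C + (if v \<in> D then (?q - 1) * card C else 0))"
    using card_gt_1 by (intro sum.cong refl) (simp add: diff_mult_distrib)
  also have "\<dots> = card V * card C + card D * ((?q - 1) * card C)"
    using fV DV by (simp add: sum.distrib sum.If_cases Int_absorb1 inf.absorb2)
  finally have 1: "?q * (\<Sum>v\<in>V. card {c \<in> C. ip v c = 0}) = card V * card C + card D * ((?q - 1) * card C)" .
  have "?q * (\<Sum>c\<in>C. card {v \<in> V. ip v c = 0}) = (\<Sum>c\<in>C. if c \<in> ?Z then ?q * card V else card V)"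
    unfolding sum_distrib_left by (intro sum.cong refl cols)
  also have "\<dots> = (\<Sum>c\<in>C. card V + (if c \<in> ?Z then (?q - 1) * card V else 0))"
    using card_gt_1 by (intro sum.cong refl) (simp add: diff_mult_distrib)
  also have "\<dots> = card C * card V + card ?Z * ((?q - 1) * card V)"
    using fC by (simp only: sum.distrib sum.If_cases) (simp add: Int_def Collect_conj_eq[symmetric] conj_ac cong: conj_cong)
  finally have 2: "?q * (\<Sum>c\<in>C. card {v \<in> V. ip v c = 0}) = card C * card V + card ?Z * ((?q - 1) * card V)" .
  have "(\<Sum>v\<in>V. card {c \<in> C. ip v c = 0}) = (\<Sum>c\<in>C. card {v \<in> V. ip v c = 0})"
    using sum_multicount_gen[OF fV fC, of "\<lambda>v c. ip v c = 0" "\<lambda>c. card {v \<in> V. ip v c = 0}"] by simp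
  then have "(?q - 1) * (card D * card C) = (?q - 1) * (card ?Z * card V)" using 1 2 by (simp add: algebra_simps)
  then show ?thesis using card_gt_1 unfolding D_def[symmetric] cV by (simp add: mult.commute)
qed

end

lemma coeff_prod_linear:
  fixes f :: "'i \<Rightarrow> 'c::comm_ring_1"
  assumes "finite S"
  shows "coeff (\<Prod>i\<in>S. [:1, f i:]) m = (\<Sum>T | T \<subseteq> S \<and> card T = m. \<Prod>i\<in>T. f i)"
proof -
  have "(\<Prod>i\<in>S. [:1, f i:]) = (\<Prod>i\<in>S. [:0, f i:] + 1)" by (simp add: one_pCons)
  also have "\<dots> = (\<Sum>T\<in>Pow S. (\<Prod>i\<in>T. [:0, f i:]) * (\<Prod>i\<in>S - T. 1))" using assms by (rule prod_add)
  also have "\<dots> = (\<Sum>T\<in>Pow S. monom (\<Prod>i\<in>T. f i) (card T))"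
  proof (intro sum.cong refl)
    fix T assume "T \<in> Pow S"
    then have "finite T" using assms finite_subset by auto
    then have "(\<Prod>i\<in>T. [:0, f i:]) = monom (\<Prod>i\<in>T. f i) (card T)"
      by (induction T) (simp_all add: monom_Suc mult_monom[symmetric] one_pCons monom_0 smult_monom)
    then show "(\<Prod>i\<in>T. [:0, f i:]) * (\<Prod>i\<in>S - T. 1) = monom (\<Prod>i\<in>T. f i) (card T)" by simp
  qed
  finally have "coeff (\<Prod>i\<in>S. [:1, f i:]) m = (\<Sum>T\<in>Pow S. if card T = m then \<Prod>i\<in>T. f i else 0)"
    by (simp add: coeff_sum)
  also have "\<dots> = (\<Sum>T | T \<subseteq> S \<and> card T = m. \<Prod>i\<in>T. f i)"
    using assms by (subst sum.inter_filter[symmetric]) (auto intro: sum.cong)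
  finally show ?thesis .
qed

section \<open>Characters of Z_p x Z_p and zero-sum subsets\<close>

context
  fixes p :: nat and \<omega> :: complex
  assumes prm: "prime p" and odd: "odd p"
  defines "\<omega> \<equiv> cis (2 * pi / p)"
begin

lemma p_pos: "p > 0" using prm prime_gt_0_nat by blast

lemma omega_pow_eq_1: "\<omega> ^ n = 1 \<longleftrightarrow> p dvd n"
proof -
  have "\<omega> ^ n = cis (2 * pi * n / p)" unfolding \<omega>_def by (simp add: DeMoivre mult_ac)
  also have "\<dots> = 1 \<longleftrightarrow> cos (2 * pi * n / p) = 1"
  proof
    assume c: "cos (2 * pi * n / p) = 1"
    then have "(sin (2 * pi * n / p))\<^sup>2 = 0" using sin_squared_eq[of "2 * pi * n / p"] by simp
    then show "cis (2 * pi * n / p) = 1" using c by (simp add: complex_eq_iff)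
  qed (simp add: complex_eq_iff)
  also have "\<dots> \<longleftrightarrow> (\<exists>k::int. 2 * pi * n / p = 2 * pi * k)"
    by (simp only: cos_one_2pi_int mult_ac)
  also have "\<dots> \<longleftrightarrow> (\<exists>k::int. int n = int p * k)"
  proof (intro ex_cong1)
    fix k :: int
    have "2 * pi * n / p = 2 * pi * k \<longleftrightarrow> real n = real p * k" using p_pos by (simp add: field_simps)
    also have "\<dots> \<longleftrightarrow> real_of_int (int n) = real_of_int (int p * k)" by simp
    finally show "2 * pi * n / p = 2 * pi * k \<longleftrightarrow> int n = int p * k" by linarith
  qed
  also have "\<dots> \<longleftrightarrow> p dvd n" by (metis dvd_def int_dvd_int_iff)
  finally show ?thesis .
qed

lemma omega_mod: "\<omega> ^ (n mod p) = \<omega> ^ n"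
proof -
  have "\<omega> ^ n = (\<omega> ^ p) ^ (n div p) * \<omega> ^ (n mod p)"
    by (simp add: power_mult[symmetric] power_add[symmetric])
  then show ?thesis using omega_pow_eq_1[of p] by simp
qed

lemma omega_inj: "inj_on (\<lambda>j. \<omega> ^ j) {..<p}"
proof -
  have main: "i = j" if "i \<le> j" "j < p" "\<omega> ^ i = \<omega> ^ j" for i j
  proof -
    have "\<omega> \<noteq> 0" by (simp add: \<omega>_def)
    have "\<omega> ^ (i + (j - i)) = \<omega> ^ i * \<omega> ^ (j - i)" by (rule power_add)
    then have "\<omega> ^ j = \<omega> ^ i * \<omega> ^ (j - i)" using that by simp
    then have "\<omega> ^ (j - i) = 1" using that \<open>\<omega> \<noteq> 0\<close> by simp
    then show "i = j" using that by (auto simp: omega_pow_eq_1 dest: dvd_imp_le)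
  qed
  show ?thesis
    by (rule inj_onI) (metis main lessThan_iff nle_le)
qed

lemma omega_sum: "(\<Sum>j<p. (\<omega> ^ n) ^ j) = (if p dvd n then of_nat p else 0)"
proof (cases "p dvd n")
  case False
  then have "\<omega> ^ n \<noteq> 1" by (simp add: omega_pow_eq_1)
  moreover have "(\<omega> ^ n) ^ p = 1" using omega_pow_eq_1[of "n * p"] by (simp add: power_mult)
  ultimately show ?thesis using False by (simp add: sum_gp_strict)
qed (simp add: omega_pow_eq_1[THEN iffD2])

text \<open>Both sides have degree at most p and agree at p + 1 points: at 0, where both are 1, and
  at the p numbers - \<omega>^(-j), where both vanish. The right side vanishes there because p is
  odd.\<close>

lemma omega_prod: "(\<Prod>j<p. [:1, \<omega> ^ j:]) = 1 + monom 1 p"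
proof (rule poly_eqI_degree[of "insert 0 ((\<lambda>j. - inverse (\<omega> ^ j)) ` {..<p})"])
  have nz: "\<omega> \<noteq> 0" by (simp add: \<omega>_def)
  let ?R = "(\<lambda>j. - inverse (\<omega> ^ j)) ` {..<p}"
  have "inj_on (\<lambda>j. - inverse (\<omega> ^ j)) {..<p}" using omega_inj by (auto simp: inj_on_def)
  then have "card ?R = p" by (simp add: card_image)
  moreover have "0 \<notin> ?R" using nz by auto
  ultimately have c: "card (insert 0 ?R) = Suc p" by simp
  have "degree (\<Prod>j<p. [:1, \<omega> ^ j:]) \<le> (\<Sum>j<p. degree [:1, \<omega> ^ j:])" using degree_prod_sum_le[of "{..<p}" "\<lambda>j. [:1, \<omega> ^ j:]"] by (simp only: o_def finite_lessThan)
  also have "\<dots> \<le> p" using nz by simp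
  finally show "degree (\<Prod>j<p. [:1, \<omega> ^ j:]) < card (insert 0 ?R)" using c by simp
  have "degree (1 + monom (1::complex) p) \<le> p"
    by (intro degree_add_le) (auto simp: degree_monom_le)
  then show "degree (1 + monom (1::complex) p) < card (insert 0 ?R)" using c by simp
  fix x assume "x \<in> insert 0 ?R"
  then consider "x = 0" | j where "j < p" "x = - inverse (\<omega> ^ j)" by auto
  then show "poly (\<Prod>j<p. [:1, \<omega> ^ j:]) x = poly (1 + monom 1 p) x"
  proof cases
    case 1
    then show ?thesis using p_pos by (simp add: poly_prod poly_monom)
  next
    case 2
    have "poly (\<Prod>j<p. [:1, \<omega> ^ j:]) x = 0"
      unfolding poly_prod using 2 nz by (intro prod_zero bexI[of _ j]) auto
    moreover have "(\<omega> ^ j) ^ p = 1" using omega_pow_eq_1[of "j * p"] by (simp add: power_mult)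
    then have "x ^ p = -1" using 2 odd by (simp add: power_inverse)
    ultimately show ?thesis by (simp add: poly_monom)
  qed
qed

text \<open>x -> a x + c permutes the residues modulo p, so the factors are only reordered.\<close>

lemma shifted_prod:
  assumes "0 < a" "a < p"
  shows "(\<Prod>x<p. [:1, \<omega> ^ (a * x + c):]) = 1 + monom 1 p"
proof -
  have cop: "coprime a p"
    using prm assms by (metis coprime_commute dvd_imp_le not_less prime_imp_coprime)
  have inj: "inj_on (\<lambda>x. (a * x + c) mod p) {..<p}"
  proof (rule inj_onI)
    have main: "x = y" if "y \<le> x" "x < p" "(a * x + c) mod p = (a * y + c) mod p" for x y
    proof -
      have "p dvd (a * x + c) - (a * y + c)"
        using that by (simp add: mod_eq_dvd_iff_nat)
      then have "p dvd a * (x - y)" by (simp add: diff_mult_distrib2)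
      then have "p dvd x - y" using cop by (simp add: coprime_dvd_mult_right_iff coprime_commute)
      then show ?thesis using that by (auto dest: dvd_imp_le)
    qed
    fix x y assume "x \<in> {..<p}" "y \<in> {..<p}" "(a * x + c) mod p = (a * y + c) mod p"
    then show "x = y" using main[of x y] main[of y x] by (metis lessThan_iff nle_le)
  qed
  have "(\<lambda>x. (a * x + c) mod p) ` {..<p} = {..<p}"
    using inj p_pos by (intro endo_inj_surj) auto
  then have "bij_betw (\<lambda>x. (a * x + c) mod p) {..<p} {..<p}" using inj by (simp add: bij_betw_def)
  then have "(\<Prod>j<p. [:1, \<omega> ^ j:]) = (\<Prod>x<p. [:1, \<omega> ^ ((a * x + c) mod p):])"
    by (rule prod.reindex_bij_betw[symmetric])
  then show ?thesis by (simp add: omega_mod omega_prod)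
qed

lemma coeff_binomial_monom:
  assumes "p dvd m"
  shows "coeff ((1 + monom (1::complex) p) ^ p) m = of_nat (p choose (m div p))"
proof -
  obtain r where r: "m = p * r" using assms by blast
  have "(1 + monom (1::complex) p) ^ p = (\<Sum>k\<le>p. of_nat (p choose k) * monom 1 (p * k))"
    by (subst add.commute, subst binomial_ring) (simp add: monom_power)
  then have "coeff ((1 + monom (1::complex) p) ^ p) m =
      (\<Sum>k\<le>p. coeff (of_nat (p choose k) * monom (1::complex) (p * k)) m)"
    by (simp only: coeff_sum)
  also have "\<dots> = (\<Sum>k\<le>p. if k = r then of_nat (p choose k) else 0)"
    by (intro sum.cong refl) (use p_pos in \<open>auto simp: of_nat_poly r\<close>)
  also have "\<dots> = of_nat (p choose r)" by (subst sum.delta) (auto simp: binomial_eq_0)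
  finally show ?thesis using r p_pos by simp
qed

text \<open>Summing the product of character values over \<open>T\<close> over all p^2 characters
  yields p^2 if \<open>T\<close> has sum zero and 0 otherwise. Exchanging the sums, the trivial
  character counts all m-subsets. For each of the other p^2 - 1, one coordinate of \<open>u\<close>
  is nonzero; summation over the matching coordinate makes the generating product (1 +
  X^p)^p.\<close>

lemma card_zero_sum_subsets:
  assumes "p dvd m"
  shows "card {T. T \<subseteq> {..<p} \<times> {..<p} \<and> card T = m \<and> p dvd (\<Sum>g\<in>T. fst g) \<and> p dvd (\<Sum>g\<in>T. snd g)} * p\<^sup>2
     = (p\<^sup>2 choose m) + (p\<^sup>2 - 1) * (p choose (m div p))"
proof -
  let ?G = "{..<p} \<times> {..<p}"
  let ?S = "{T. T \<subseteq> ?G \<and> card T = m}"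
  let ?\<chi> = "\<lambda>u g. \<omega> ^ (fst u * fst g + snd u * snd g)"
  have fS: "finite ?S" by (rule finite_subset[of _ "Pow ?G"]) auto
  define N where "N = card {T \<in> ?S. p dvd (\<Sum>g\<in>T. fst g) \<and> p dvd (\<Sum>g\<in>T. snd g)}"
  have inner: "(\<Sum>T\<in>?S. \<Prod>g\<in>T. ?\<chi> u g) = of_nat (p choose (m div p))" if u: "u \<in> ?G - {(0,0)}" for u
  proof -
    have P: "(\<Prod>g\<in>?G. [:1, ?\<chi> u g:]) = (1 + monom 1 p) ^ p"
    proof (cases "fst u = 0")
      case False
      have "(\<Prod>g\<in>?G. [:1, ?\<chi> u g:]) = (\<Prod>y<p. \<Prod>x<p. [:1, \<omega> ^ (fst u * x + snd u * y):])"
        by (subst prod.swap) (simp add: prod.cartesian_product case_prod_beta)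
      then show ?thesis using False u by (auto simp: shifted_prod)
    next
      case True
      have "(\<Prod>g\<in>?G. [:1, ?\<chi> u g:]) = (\<Prod>x<p. \<Prod>y<p. [:1, \<omega> ^ (snd u * y + fst u * x):])"
        by (simp add: prod.cartesian_product case_prod_beta add.commute)
      moreover have "0 < snd u" "snd u < p" using True u by (cases u, auto)+
      ultimately show ?thesis by (simp only: shifted_prod prod_constant card_lessThan)
    qed
    have "(\<Sum>T\<in>?S. \<Prod>g\<in>T. ?\<chi> u g) = coeff (\<Prod>g\<in>?G. [:1, ?\<chi> u g:]) m"
      by (subst coeff_prod_linear) auto
    then show ?thesis unfolding P using coeff_binomial_monom[OF assms] by simp
  qed
  have "(\<Sum>u\<in>?G. \<Sum>T\<in>?S. \<Prod>g\<in>T. ?\<chi> u g) =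
     (\<Sum>T\<in>?S. \<Prod>g\<in>T. ?\<chi> (0,0) g) + (\<Sum>u\<in>?G - {(0,0)}. \<Sum>T\<in>?S. \<Prod>g\<in>T. ?\<chi> u g)"
    using p_pos by (intro sum.remove) auto
  also have "\<dots> = of_nat (card ?S) + of_nat (card (?G - {(0,0)})) * of_nat (p choose (m div p))"
    using inner by simp
  also have "card ?S = p\<^sup>2 choose m" by (simp add: n_subsets power2_eq_square)
  also have "card (?G - {(0,0)}) = p\<^sup>2 - 1" using p_pos by (simp add: power2_eq_square)
  finally have 1: "(\<Sum>u\<in>?G. \<Sum>T\<in>?S. \<Prod>g\<in>T. ?\<chi> u g) =
     of_nat ((p\<^sup>2 choose m) + (p\<^sup>2 - 1) * (p choose (m div p)))" by simp
  have "(\<Sum>u\<in>?G. \<Sum>T\<in>?S. \<Prod>g\<in>T. ?\<chi> u g) = (\<Sum>T\<in>?S. \<Sum>u\<in>?G. \<Prod>g\<in>T. ?\<chi> u g)" by (rule sum.swap)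
  also have "\<dots> = (\<Sum>T\<in>?S. if p dvd (\<Sum>g\<in>T. fst g) \<and> p dvd (\<Sum>g\<in>T. snd g) then of_nat (p\<^sup>2) else 0)"
  proof (intro sum.cong refl)
    fix T assume "T \<in> ?S"
    let ?X = "\<Sum>g\<in>T. fst g" and ?Y = "\<Sum>g\<in>T. snd g"
    have "(\<Prod>g\<in>T. ?\<chi> u g) = (\<omega> ^ ?X) ^ fst u * (\<omega> ^ ?Y) ^ snd u" for u :: "nat \<times> nat"
    proof -
      have "(\<Prod>g\<in>T. ?\<chi> u g) = \<omega> ^ (\<Sum>g\<in>T. fst u * fst g + snd u * snd g)" by (rule power_sum[symmetric])
      also have "(\<Sum>g\<in>T. fst u * fst g + snd u * snd g) = ?X * fst u + ?Y * snd u"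
        by (simp add: sum.distrib sum_distrib_left mult.commute)
      finally show ?thesis by (simp add: power_add power_mult)
    qed
    then have "(\<Sum>u\<in>?G. \<Prod>g\<in>T. ?\<chi> u g) = (\<Sum>u\<in>?G. (\<omega> ^ ?X) ^ fst u * (\<omega> ^ ?Y) ^ snd u)" by simp
    also have "\<dots> = (\<Sum>a<p. (\<omega> ^ ?X) ^ a) * (\<Sum>b<p. (\<omega> ^ ?Y) ^ b)"
      by (simp add: sum_product sum.cartesian_product case_prod_beta)
    finally show "(\<Sum>u\<in>?G. \<Prod>g\<in>T. ?\<chi> u g) = (if p dvd ?X \<and> p dvd ?Y then of_nat (p\<^sup>2) else 0)"
      by (simp add: omega_sum power2_eq_square)
  qed
  also have "\<dots> = of_nat (N * p\<^sup>2)"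
    using fS by (simp add: sum.inter_filter[symmetric] N_def)
  finally have "(of_nat (N * p\<^sup>2) :: complex) = of_nat ((p\<^sup>2 choose m) + (p\<^sup>2 - 1) * (p choose (m div p)))"
    using 1 by simp
  then have "N * p\<^sup>2 = (p\<^sup>2 choose m) + (p\<^sup>2 - 1) * (p choose (m div p))" by (simp only: of_nat_eq_iff)
  moreover have "N = card {T. T \<subseteq> ?G \<and> card T = m \<and> p dvd (\<Sum>g\<in>T. fst g) \<and> p dvd (\<Sum>g\<in>T. snd g)}"
    unfolding N_def by (intro arg_cong[where f = card]) auto
  ultimately show ?thesis by simp
qed

end

section \<open>Frobenius, rational functions and the chart at infinity\<close>

text \<open>Applied below to X^q - X, whose derivative is -1 in characteristic dividing q.\<close>

lemma card_roots_separable: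
  fixes f :: "'b::field poly"
  assumes closed: "\<And>f :: 'b poly. degree f > 0 \<Longrightarrow> \<exists>x. poly f x = 0"
    and sep: "\<And>x. poly f x = 0 \<Longrightarrow> poly (pderiv f) x \<noteq> 0" and f: "f \<noteq> 0"
  shows "card {x. poly f x = 0} = degree f"
proof -
  have "degree f = n \<Longrightarrow> f \<noteq> 0 \<Longrightarrow> (\<And>x. poly f x = 0 \<Longrightarrow> poly (pderiv f) x \<noteq> 0) \<Longrightarrow>
      card {x. poly f x = 0} = n" for n and f :: "'b poly"
  proof (induction n arbitrary: f)
    case 0
    then obtain c where "f = [:c:]" using degree_eq_zeroE by blast
    then show ?case using 0 by simp
  next
    case (Suc n)
    then obtain r where "poly f r = 0" using closed[of f] by auto
    then obtain g where g: "f = [:- r, 1:] * g" by (metis dvdE poly_eq_0_iff_dvd)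
    then have g0: "g \<noteq> 0" using Suc.prems by auto
    then have "degree ([:- r, 1:] * g) = 1 + degree g" by (subst degree_mult_eq) auto
    then have dg: "degree g = n" using g Suc.prems by simp
    have d: "pderiv f = g + [:- r, 1:] * pderiv g"
      unfolding g by (simp only: pderiv_mult) (simp add: pderiv_pCons algebra_simps)
    have gr: "poly g r \<noteq> 0" using Suc.prems(3)[of r] g d by auto
    have "poly (pderiv g) x \<noteq> 0" if "poly g x = 0" for x
      using Suc.prems(3)[of x] g d that by auto
    then have "card {x. poly g x = 0} = n" using Suc.IH[OF dg g0] by blast
    moreover have "{x. poly f x = 0} = insert r {x. poly g x = 0}" using g by auto
    moreover have "finite {x. poly g x = 0}" by (rule poly_roots_finite[OF g0])
    ultimately show ?case using gr by simp
  qed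
  then show ?thesis using sep f by blast
qed

lemma coeffs_in_pCons: "coeffs_in (pCons c F) S \<longleftrightarrow> (\<forall>j. coeff c j \<in> S) \<and> coeffs_in F S"
  unfolding coeffs_in_def by (auto simp: coeff_pCons split: nat.splits)

section \<open>The Frobenius map and descent to the field with q elements\<close>

locale elliptic_fq = elliptic a for a :: "nat \<Rightarrow> 'b::field" +
  fixes q :: nat
  assumes qpow: "\<exists>l e. prime l \<and> e > 0 \<and> q = l ^ e \<and> of_nat l = (0::'b)"
    and coeffs: "\<forall>i\<in>{1,2,3,4,6}. a i \<in> Fsub q"
begin

abbreviation F :: "'b set" where "F \<equiv> Fsub q"

lemma frob_add: "(x + y) ^ q = x ^ q + (y :: 'b) ^ q" and q_gt_1: "q > 1" and of_nat_q: "of_nat q = (0::'b)"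
proof -
  obtain l e where l: "prime l" "e > 0" "q = l ^ e" "of_nat l = (0::'b)" using qpow by blast
  then have "CHAR('b) dvd l" by (simp add: of_nat_eq_0_iff_char_dvd)
  moreover have "CHAR('b) \<noteq> 1" by simp
  ultimately have "CHAR('b) = l" using l(1) by (metis prime_nat_iff)
  then show "(x + y) ^ q = x ^ q + (y :: 'b) ^ q" using l freshmans_dream'[where 'a = 'b, of q e] by simp
  show "q > 1" using l by (metis one_less_power prime_gt_1_nat)
  show "of_nat q = (0::'b)" using l by simp
qed

lemma frob_zero: "(0::'b) ^ q = 0" using q_gt_1 by simp

lemma frob_minus: "(- x) ^ q = - ((x :: 'b) ^ q)"
  using frob_add[of x "- x"] frob_zero by (simp add: eq_neg_iff_add_eq_0 add.commute)

lemma frob_diff: "(x - y) ^ q = x ^ q - (y :: 'b) ^ q"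
  using frob_add[of x "- y"] by (simp add: frob_minus)

lemma frob_surj: "\<exists>z. z ^ q = (x :: 'b)"
proof -
  have "degree (monom 1 q + [:- x:]) = q"
    using q_gt_1 by (subst degree_add_eq_left) (auto simp: degree_monom_eq)
  then show ?thesis using closed[of "monom 1 q + [:- x:]"] q_gt_1 by (auto simp: poly_monom)
qed

lemma card_F: "card F = q" and finite_F: "finite F"
proof -
  let ?f = "monom 1 q + [:0, - 1:] :: 'b poly"
  have F: "F = {x. poly ?f x = 0}" by (auto simp: Fsub_def poly_monom)
  have d: "degree ?f = q"
    using q_gt_1 by (subst degree_add_eq_left) (auto simp: degree_monom_eq)
  then have nz: "?f \<noteq> 0" using q_gt_1 by auto
  have "pderiv ?f = [:- 1:]" by (simp add: pderiv_add pderiv_monom pderiv_pCons of_nat_q)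
  then have "poly (pderiv ?f) x \<noteq> 0" for x by simp
  then have "card {x. poly ?f x = 0} = q" using card_roots_separable[OF closed, of ?f] nz d by simp
  then show "card F = q" "finite F" using F poly_roots_finite[OF nz] by simp_all
qed

sublocale F: finite_subfield F
  by unfold_locales (use finite_F in \<open>auto simp: Fsub_def frob_add frob_diff power_mult_distrib power_inverse\<close>)

lemma F_iff: "x \<in> F \<longleftrightarrow> x ^ q = x" by (simp add: Fsub_def)

definition fpol :: "'b poly \<Rightarrow> 'b poly" where "fpol A = map_poly (\<lambda>c. c ^ q) A"

lemma coeff_fpol: "coeff (fpol A) i = coeff A i ^ q"
  by (simp add: fpol_def coeff_map_poly frob_zero)

lemma poly_fpol: "poly (fpol A) (x ^ q) = poly A x ^ q"
proof (induction A)
  case (pCons c A)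
  have "fpol (pCons c A) = pCons (c ^ q) (fpol A)"
    by (rule poly_eqI) (simp add: coeff_fpol coeff_pCons split: nat.split)
  then show ?case using pCons by (simp add: frob_add power_mult_distrib)
qed (simp add: fpol_def frob_zero)

lemma fpol_fixed: "(\<forall>i. coeff A i \<in> F) \<longleftrightarrow> fpol A = A"
  by (simp add: poly_eq_iff coeff_fpol F_iff)

lemma eval2_frob: "coeffs_in G F \<Longrightarrow> eval2 G (x ^ q) (y ^ q) = eval2 G x y ^ q"
proof (induction G)
  case (pCons c G)
  then have "fpol c = c" using fpol_fixed coeffs_in_pCons by blast
  then have "poly c (x ^ q) = poly c x ^ q" using poly_fpol[of c x] by simp
  then show ?case using pCons by (simp add: coeffs_in_pCons frob_add power_mult_distrib)
qed (simp add: frob_zero)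

lemma weq_frob: "weq a (x ^ q) (y ^ q) = weq a x y ^ q"
proof -
  have c: "a 1 ^ q = a 1" "a 2 ^ q = a 2" "a 3 ^ q = a 3" "a 4 ^ q = a 4" "a 6 ^ q = a 6"
    using coeffs by (auto simp: F_iff)
  have p: "(x ^ n) ^ q = (x ^ q) ^ n" for x :: 'b and n by (simp add: power_mult[symmetric] mult.commute)
  show ?thesis
    unfolding weq_def by (simp only: frob_add frob_diff power_mult_distrib c p)
qed

lemma frob_point_surj:
  assumes "on_aff a x y" obtains x' y' where "on_aff a x' y'" "x = x' ^ q" "y = y' ^ q"
proof -
  obtain x' y' where "x' ^ q = x" "y' ^ q = y" using frob_surj by metis
  moreover from this have "on_aff a x' y'"
    using assms weq_frob[of x' y'] by (simp add: on_aff_def)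
  ultimately show ?thesis using that by blast
qed

text \<open>Every point of the curve is a Frobenius image, so raising the identity to the power q
  yields the same identity with \<open>fpol A\<close> and \<open>fpol B\<close>. Cancelling
  \<open>D\<close> and uniqueness of the normal form then show that A and B are fixed.\<close>

lemma galois_descent:
  assumes N: "coeffs_in N F" and D: "coeffs_in D F" "\<not> eqE D 0" and eq: "eqE N (D * [:A, B:])"
  shows "\<forall>i. coeff A i \<in> F" "\<forall>i. coeff B i \<in> F"
proof -
  have "eqE N (D * [:fpol A, fpol B:])"
    unfolding eqE_def
  proof safe
    fix x y assume "on_aff a x y"
    then obtain x' y' where P: "on_aff a x' y'" "x = x' ^ q" "y = y' ^ q" by (rule frob_point_surj)
    have "eval2 N x y = (eval2 N x' y') ^ q" by (simp add: P eval2_frob N)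
    also have "\<dots> = (eval2 (D * [:A, B:]) x' y') ^ q" using eq P(1) by (simp add: eqE_def)
    also have "\<dots> = eval2 (D * [:fpol A, fpol B:]) x y"
      unfolding eval2_mult P by (simp add: frob_add power_mult_distrib eval2_frob D poly_fpol)
    finally show "eval2 N x y = eval2 (D * [:fpol A, fpol B:]) x y" .
  qed
  then have "eqE (D * [:A, B:]) (D * [:fpol A, fpol B:])" using eq eqE_sym eqE_trans by blast
  then have "fpol A = A" "fpol B = B" by (simp_all only: eqE_cancel[OF D(2)] reduce_unique)
  then show "\<forall>i. coeff A i \<in> F" "\<forall>i. coeff B i \<in> F" by (simp_all only: fpol_fixed)
qed

end

section \<open>Rational functions, and regularity in the chart at infinity\<close>

context weierstrass
begin

lemma rf_valid_iff: "rf_valid a f \<longleftrightarrow> \<not> eqE (snd f) 0"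
  by (auto simp: rf_valid_def eqE_def)

text \<open>\<open>rf_same\<close> compares values only where both denominators are nonzero.
  Multiplying by both denominators makes the identity hold on the whole curve, and they cancel
  because the ring is a domain.\<close>

lemma rf_same_iff:
  assumes "\<not> eqE (snd f) 0" "\<not> eqE (snd g) 0"
  shows "rf_same a f g \<longleftrightarrow> eqE (fst f * snd g) (fst g * snd f)"
proof
  assume r: "rf_same a f g"
  have "eqE ((snd f * snd g) * (fst f * snd g)) ((snd f * snd g) * (fst g * snd f))"
    unfolding eqE_def
  proof safe
    fix x y assume P: "on_aff a x y"
    show "eval2 (snd f * snd g * (fst f * snd g)) x y = eval2 (snd f * snd g * (fst g * snd f)) x y"
    proof (cases "eval2 (snd f) x y = 0 \<or> eval2 (snd g) x y = 0")
      case False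
      then have "eval2 (fst f) x y / eval2 (snd f) x y = eval2 (fst g) x y / eval2 (snd g) x y"
        using r P by (simp add: rf_same_def)
      then show ?thesis using False by (simp add: field_simps)
    qed auto
  qed
  then show "eqE (fst f * snd g) (fst g * snd f)"
    using assms eqE_mult_0 eqE_cancel[of "snd f * snd g" "fst f * snd g" "fst g * snd f"] by blast
next
  assume "eqE (fst f * snd g) (fst g * snd f)"
  then show "rf_same a f g" by (simp add: rf_same_def eqE_def field_simps)
qed

lemma regular_with_Aff:
  assumes "on_aff a x y" "rf_valid a f"
  shows "regular_with a (Aff x y) f c \<longleftrightarrow>
    (\<exists>g h. eval2 h x y \<noteq> 0 \<and> c = eval2 g x y / eval2 h x y \<and> eqE (fst f * h) (g * snd f))"
proof -
  have "rf_same a f (g, h) \<longleftrightarrow> eqE (fst f * h) (g * snd f)" if "eval2 h x y \<noteq> 0" for g h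
  proof -
    have "\<not> eqE h 0" using that assms(1) by (auto simp: eqE_def)
    then show ?thesis using assms(2) rf_same_iff[of f "(g, h)"] by (simp add: rf_valid_iff)
  qed
  then show ?thesis
    unfolding regular_with_def by (simp cong: conj_cong)
qed

lemma regular_with_Aff_unique:
  assumes P: "on_aff a x y" and f: "rf_valid a f"
    and "regular_with a (Aff x y) f c" "regular_with a (Aff x y) f c'"
  shows "c = c'"
proof -
  obtain g h g' h' where *: "eval2 h x y \<noteq> 0" "c = eval2 g x y / eval2 h x y" "eqE (fst f * h) (g * snd f)"
    "eval2 h' x y \<noteq> 0" "c' = eval2 g' x y / eval2 h' x y" "eqE (fst f * h') (g' * snd f)"
    using assms by (auto simp: regular_with_Aff)
  have "eqE (snd f * (g * h')) (snd f * (g' * h))"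
    using eqE_trans[OF eqE_sym[OF eqE_mult[OF *(3) eqE_refl[of h']]]]
      eqE_mult[OF *(6) eqE_refl[of h]] by (simp only: ac_simps)
  then have "eqE (g * h') (g' * h)"
    using f[unfolded rf_valid_iff] eqE_cancel[of "snd f" "g * h'" "g' * h"] by blast
  then have "eval2 g x y * eval2 h' x y = eval2 g' x y * eval2 h x y" using P by (simp add: eqE_def)
  then show ?thesis unfolding *(2,5) using *(1,4) by (simp add: frac_eq_eq)
qed

lemma dAB_add: "dAB (A + A') (B + B') \<le> max (dAB A B) (dAB A' B')"
proof -
  have 1: "degree (A + A') \<le> max (degree A) (degree A')" by (rule degree_add_le_max)
  have 2: "degree (B + B') \<le> max (degree B) (degree B')" by (rule degree_add_le_max)
  show ?thesis
  proof (cases "B + B' = 0")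
    case True
    then have "B = - B'" by (simp add: eq_neg_iff_add_eq_0)
    then show ?thesis using 1 True by (auto simp: dAB_def)
  next
    case False
    then show ?thesis using 1 2 by (cases "B = 0"; cases "B' = 0") (auto simp: dAB_def)
  qed
qed

lemma dg_add: "dg (G + H) \<le> max (dg G) (dg H)"
proof -
  obtain A B A' B' where AB: "eqE G [:A, B:]" "eqE H [:A', B':]" using reduce by metis
  then have "eqE (G + H) [:A + A', B + B':]" using eqE_add[OF AB] by simp
  then have "dg (G + H) = dAB (A + A') (B + B')" using dg_eqE by (simp add: dg_AB)
  moreover have "dg G = dAB A B" "dg H = dAB A' B'" using dg_eqE AB by (simp_all add: dg_AB)
  ultimately show ?thesis using dAB_add by simp
qed

lemma dg_mult_le: "dg (G * H) \<le> dg G + dg H"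
  by (simp add: dg_def nrm_mult degree_mult_le)

lemma dg_Y_power: "dg ([:0, 1:] ^ d) = 3 * d" and nz_Y_power: "\<not> eqE ([:0, 1:] ^ d) 0"
proof -
  have "dg ([:0, 1:] ^ d) = 3 * d \<and> \<not> eqE ([:0, 1:] ^ d) 0"
  proof (induction d)
    case (Suc d)
    then have "dg ([:0, 1:] * [:0, 1:] ^ d) = dg [:0, 1:] + dg ([:0, 1:] ^ d)"
      using nz_y[of 0] by (intro dg_mult) auto
    moreover have "\<not> eqE ([:0, 1:] * [:0, 1:] ^ d) 0"
      using Suc nz_y[of 0] eqE_mult_0 by blast
    ultimately show ?case using Suc dg_y[of 0] by (simp only: power_Suc) simp
  qed simp
  then show "dg ([:0, 1:] ^ d) = 3 * d" "\<not> eqE ([:0, 1:] ^ d) 0" by auto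
qed

lemma dg_const: "dg [:[:c:]:] = 0"
  using dg_AB[of "[:c:]" 0] by (simp add: dAB_def)

text \<open>\<open>L\<close> is the homogenisation in degree \<open>d\<close> of a polynomial in \<open>u = x/y\<close>, \<open>w = 1/y\<close>; its pole
  order at infinity is governed by the constant term, since \<open>y\<close> has a triple pole there.\<close>
definition homogenises :: "('b \<Rightarrow> 'b \<Rightarrow> 'b) \<Rightarrow> 'b \<Rightarrow> nat \<Rightarrow> 'b poly poly \<Rightarrow> bool" where
  "homogenises \<phi> c d L \<longleftrightarrow> (\<forall>x y. y \<noteq> 0 \<longrightarrow> y ^ d * \<phi> (x / y) (1 / y) = eval2 L x y) \<and>
     dg (L - [:[:c:]:] * [:0, 1:] ^ d) < 3 * d"

lemma homogenises_dg: "homogenises \<phi> c d L \<Longrightarrow> dg L \<le> 3 * d"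
proof -
  assume h: "homogenises \<phi> c d L"
  have "dg L \<le> max (dg (L - [:[:c:]:] * [:0, 1:] ^ d)) (dg ([:[:c:]:] * [:0, 1:] ^ d))"
    using dg_add[of "L - [:[:c:]:] * [:0, 1:] ^ d" "[:[:c:]:] * [:0, 1:] ^ d"] by (simp only: diff_add_cancel)
  moreover have "dg ([:[:c:]:] * [:0, 1:] ^ d) \<le> 3 * d"
    using dg_mult_le[of "[:[:c:]:]" "[:0, 1:] ^ d"] by (simp only: dg_const dg_Y_power add_0)
  ultimately show "dg L \<le> 3 * d" using h by (auto simp: homogenises_def simp del: mult_pCons_left)
qed

lemma homogenises_nz:
  assumes "homogenises \<phi> c d L" "c \<noteq> 0" shows "\<not> eqE L 0"
proof
  assume L: "eqE L 0"
  have "eqE (L - [:[:c:]:] * [:0, 1:] ^ d) ([:[:- c:]:] * [:0, 1:] ^ d)"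
    using L by (simp add: eqE_def)
  then have "dg (L - [:[:c:]:] * [:0, 1:] ^ d) = dg ([:[:- c:]:] * [:0, 1:] ^ d)" by (rule dg_eqE)
  also have "\<not> eqE [:[:- c:]:] 0" using assms(2) nz_AB[of "[:- c:]" 0] by simp
  then have "dg ([:[:- c:]:] * [:0, 1:] ^ d) = dg [:[:- c:]:] + dg ([:0, 1:] ^ d)"
    using nz_Y_power by (intro dg_mult)
  then have "dg ([:[:- c:]:] * [:0, 1:] ^ d) = 3 * d"
    by (simp only: dg_const dg_Y_power add_0)
  finally show False using assms(1) by (simp only: homogenises_def less_irrefl simp_thms)
qed

lemma homogenises_poly: "\<exists>d L. homogenises (\<lambda>u w. poly A u) (poly A 0) d L"
proof (induction A)
  case 0
  \<comment> \<open>Degree 1 instead of 0, because the error term must have pole order strictly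
    below 3d.\<close>
  have "homogenises (\<lambda>u w. poly 0 u) (poly 0 0) 1 0"
    using dg_const[of 0] by (simp add: homogenises_def)
  then show ?case by blast
next
  case (pCons c A)
  then obtain d L where h: "homogenises (\<lambda>u w. poly A u) (poly A 0) d L" by blast
  let ?L = "[:[:c:]:] * [:0, 1:] ^ Suc d + xpol 0 * L"
  have "dg (xpol 0 * L) < 3 * Suc d"
    by (rule le_less_trans[OF order_trans[OF dg_mult_le add_mono[OF eq_refl[OF dg_x] homogenises_dg[OF h]]]]) simp
  moreover have "?L - [:[:c:]:] * [:0, 1:] ^ Suc d = xpol 0 * L" by (simp only: add_diff_cancel_left')
  moreover have "y ^ Suc d * poly (pCons c A) (x / y) = eval2 ?L x y" if "y \<noteq> 0" for x y
  proof -
    have "y ^ d * poly A (x / y) = eval2 L x y" using h that by (simp add: homogenises_def)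
    then show ?thesis using that by (simp add: field_simps)
  qed
  ultimately have "homogenises (\<lambda>u w. poly (pCons c A) u) (poly (pCons c A) 0) (Suc d) ?L"
    unfolding homogenises_def by (simp only: poly_0_coeff_0 coeff_pCons_0) simp
  then show ?case by blast
qed

lemma homogenises_eval2: "\<exists>d L. homogenises (eval2 G) (eval2 G 0 0) d L"
proof (induction G)
  case 0
  have "homogenises (eval2 0) (eval2 0 0 0) 1 0"
    using dg_const[of 0] by (simp add: homogenises_def)
  then show ?case by blast
next
  case (pCons c G)
  then obtain d L where h: "homogenises (eval2 G) (eval2 G 0 0) d L" by blast
  obtain e K where k: "homogenises (\<lambda>u w. poly c u) (poly c 0) e K" using homogenises_poly by blast
  let ?Y = "[:0, 1:] :: 'b poly poly" and ?c = "[:[:poly c 0:]:]"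
  let ?L = "K * ?Y ^ Suc d + L * ?Y ^ e"
  have e1: "?L - ?c * ?Y ^ (e + Suc d) = (K - ?c * ?Y ^ e) * ?Y ^ Suc d + L * ?Y ^ e"
    by (simp only: power_add ring_distribs ac_simps add_diff_eq)
  have e2: "dg ((K - ?c * ?Y ^ e) * ?Y ^ Suc d) < 3 * (e + Suc d)"
  proof -
    have "dg (K - ?c * ?Y ^ e) < 3 * e" using k unfolding homogenises_def by blast
    then have "dg ((K - ?c * ?Y ^ e) * ?Y ^ Suc d) < 3 * e + 3 * Suc d"
      by (rule le_less_trans[OF dg_mult_le add_less_le_mono[OF _ eq_refl[OF dg_Y_power]]])
    then show ?thesis by (simp only: distrib_left)
  qed
  have e3: "dg (L * ?Y ^ e) < 3 * (e + Suc d)"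
    by (rule le_less_trans[OF order_trans[OF dg_mult_le add_mono[OF homogenises_dg[OF h] eq_refl[OF dg_Y_power]]]]) simp
  have "dg (?L - ?c * ?Y ^ (e + Suc d)) < 3 * (e + Suc d)"
    unfolding e1 by (rule le_less_trans[OF dg_add]) (use e2 e3 in \<open>simp only: max_less_iff_conj\<close>)
  moreover have "y ^ (e + Suc d) * eval2 (pCons c G) (x / y) (1 / y) = eval2 ?L x y" if "y \<noteq> 0" for x y
  proof -
    have "y ^ d * eval2 G (x / y) (1 / y) = eval2 L x y" "y ^ e * poly c (x / y) = eval2 K x y"
      using h k that by (auto simp: homogenises_def)
    then show ?thesis unfolding eval2_add eval2_mult eval2_power
      using that by (simp add: power_add algebra_simps)
  qed
  ultimately have "homogenises (eval2 (pCons c G)) (eval2 (pCons c G) 0 0) (e + Suc d) ?L"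
    unfolding homogenises_def by simp
  then show ?case by blast
qed

text \<open>A density statement: a chart polynomial that is nonzero at infinity has a nonzero
  homogenisation, and in a domain its product with \<open>D\<close> and y is nonzero, hence nonzero
  at some affine point.\<close>

lemma chart_nonvanishing:
  assumes "eval2 G 0 0 \<noteq> 0" "\<not> eqE D 0"
  obtains x y where "on_aff a x y" "y \<noteq> 0" "eval2 D x y \<noteq> 0" "eval2 G (x / y) (1 / y) \<noteq> 0"
proof -
  obtain d L where h: "homogenises (eval2 G) (eval2 G 0 0) d L" using homogenises_eval2 by blast
  have "\<not> eqE (L * (D * [:0, 1:])) 0"
    using homogenises_nz[OF h assms(1)] assms(2) nz_y[of 0] by (simp only: eqE_mult_0) simp
  then obtain x y where "on_aff a x y" "eval2 (L * (D * [:0, 1:])) x y \<noteq> 0" by (auto simp: eqE_def)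
  then have *: "on_aff a x y" "y \<noteq> 0" "eval2 D x y \<noteq> 0" "eval2 L x y \<noteq> 0" by auto
  moreover from this have "eval2 G (x / y) (1 / y) \<noteq> 0"
    using h unfolding homogenises_def by (metis mult_zero_right)
  ultimately show ?thesis using that by blast
qed

abbreviation agrees :: "'b poly poly \<Rightarrow> ('b \<Rightarrow> 'b \<Rightarrow> 'b) \<Rightarrow> 'b poly poly \<Rightarrow> 'b poly poly \<Rightarrow> bool" where
  "agrees D \<phi> G H \<equiv> \<forall>x y. on_aff a x y \<and> y \<noteq> 0 \<and> eval2 D x y \<noteq> 0 \<and> eval2 H (x / y) (1 / y) \<noteq> 0 \<longrightarrow>
     \<phi> x y = eval2 G (x / y) (1 / y) / eval2 H (x / y) (1 / y)"

text \<open>Regularity at infinity for an arbitrary function on the curve, with \<open>D\<close>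
  recording where it is to be compared. Detached from a numerator and denominator, it is closed
  under sums and products and applies to 1 / (x - x0) directly.\<close>

definition reginf :: "'b poly poly \<Rightarrow> ('b \<Rightarrow> 'b \<Rightarrow> 'b) \<Rightarrow> 'b \<Rightarrow> bool" where
  "reginf D \<phi> c \<longleftrightarrow> (\<exists>G H. eval2 H 0 0 \<noteq> 0 \<and> c = eval2 G 0 0 / eval2 H 0 0 \<and> agrees D \<phi> G H)"

lemma regular_with_Inf: "regular_with a Inf f c \<longleftrightarrow> reginf (snd f) (\<lambda>x y. eval2 (fst f) x y / eval2 (snd f) x y) c"
  by (simp add: regular_with_def reginf_def)

text \<open>If the values differed, G H' - G' H would be nonzero at infinity, hence nonzero at an
  affine point where both quotients represent the function.\<close>

lemma reginf_unique:
  assumes D: "\<not> eqE D 0" and 1: "reginf D \<phi> c" and 2: "reginf D \<phi> c'"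
  shows "c = c'"
proof (rule ccontr)
  assume ne: "c \<noteq> c'"
  obtain G H where G: "eval2 H 0 0 \<noteq> 0" "c = eval2 G 0 0 / eval2 H 0 0" "agrees D \<phi> G H"
    using 1 unfolding reginf_def by blast
  obtain G' H' where G': "eval2 H' 0 0 \<noteq> 0" "c' = eval2 G' 0 0 / eval2 H' 0 0" "agrees D \<phi> G' H'"
    using 2 unfolding reginf_def by blast
  have "eval2 ((G * H' - G' * H) * (H * H')) 0 0 \<noteq> 0"
    unfolding eval2_mult eval2_diff using ne G(1,2) G'(1,2) by (simp add: field_simps)
  then obtain x y where P: "on_aff a x y" "y \<noteq> 0" "eval2 D x y \<noteq> 0"
    "eval2 ((G * H' - G' * H) * (H * H')) (x / y) (1 / y) \<noteq> 0"
    using chart_nonvanishing D by blast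
  then have h: "eval2 H (x / y) (1 / y) \<noteq> 0" "eval2 H' (x / y) (1 / y) \<noteq> 0" by auto
  then have "eval2 G (x / y) (1 / y) / eval2 H (x / y) (1 / y) = eval2 G' (x / y) (1 / y) / eval2 H' (x / y) (1 / y)"
    using G(3) G'(3) P by metis
  then show False using h P(4) by (simp add: field_simps)
qed

lemma reginf_cong:
  assumes "reginf D \<phi> c" "\<And>x y. on_aff a x y \<Longrightarrow> eval2 D' x y \<noteq> 0 \<Longrightarrow> eval2 D x y \<noteq> 0"
    "\<And>x y. on_aff a x y \<Longrightarrow> eval2 D' x y \<noteq> 0 \<Longrightarrow> \<phi> x y = \<phi>' x y"
  shows "reginf D' \<phi>' c"
  using assms unfolding reginf_def by metis

lemma reginf_mult:
  assumes "reginf D \<phi> c" "reginf D \<phi>' c'" shows "reginf D (\<lambda>x y. \<phi> x y * \<phi>' x y) (c * c')"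
proof -
  obtain G H where G: "eval2 H 0 0 \<noteq> 0" "c = eval2 G 0 0 / eval2 H 0 0" "agrees D \<phi> G H"
    using assms(1) unfolding reginf_def by blast
  obtain G' H' where G': "eval2 H' 0 0 \<noteq> 0" "c' = eval2 G' 0 0 / eval2 H' 0 0" "agrees D \<phi>' G' H'"
    using assms(2) unfolding reginf_def by blast
  show ?thesis unfolding reginf_def
    by (rule exI[of _ "G * G'"], rule exI[of _ "H * H'"]) (use G G' in auto)
qed

lemma reginf_add:
  assumes "reginf D \<phi> c" "reginf D \<phi>' c'" shows "reginf D (\<lambda>x y. \<phi> x y + \<phi>' x y) (c + c')"
proof -
  obtain G H where G: "eval2 H 0 0 \<noteq> 0" "c = eval2 G 0 0 / eval2 H 0 0" "agrees D \<phi> G H"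
    using assms(1) unfolding reginf_def by blast
  obtain G' H' where G': "eval2 H' 0 0 \<noteq> 0" "c' = eval2 G' 0 0 / eval2 H' 0 0" "agrees D \<phi>' G' H'"
    using assms(2) unfolding reginf_def by blast
  show ?thesis unfolding reginf_def
    by (rule exI[of _ "G * H' + G' * H"], rule exI[of _ "H * H'"])
      (use G G' in \<open>auto simp: add_frac_eq\<close>)
qed

lemma reginf_const: "reginf D (\<lambda>x y. c) c"
  unfolding reginf_def by (rule exI[of _ "[:[:c:]:]"], rule exI[of _ 1]) simp

lemma reginf_power: "reginf D \<phi> c \<Longrightarrow> reginf D (\<lambda>x y. \<phi> x y ^ n) (c ^ n)"
  by (induction n) (auto intro: reginf_const reginf_mult)

lemma reginf_sum:
  "(\<And>i. i \<in> S \<Longrightarrow> reginf D (\<phi> i) (c i)) \<Longrightarrow> reginf D (\<lambda>x y. \<Sum>i\<in>S. \<phi> i x y) (\<Sum>i\<in>S. c i)"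
  by (induction S rule: infinite_finite_induct) (auto intro: reginf_const reginf_add)

end

section \<open>The Riemann-Roch space\<close>

context weierstrass
begin

text \<open>In the coordinates \<open>u = x/y\<close>, \<open>w = 1/y\<close> the curve is \<open>w U = u^3\<close>, with \<open>U\<close> equal to \<open>1\<close> at infinity.\<close>
definition chart_U :: "'b poly poly" where
  "chart_U = [:[:1, a 1, - a 2:], [:a 3, - a 4:], [:- a 6:]:]"
text \<open>The curve rewritten as w V = u^2 (u - x0 w), so V = x^2 (x - x0) / y^2. Hence near
  infinity 1 / (x - x0) = u^2 / V, x / (x - x0) = U / V and y / (x - x0)^2 = u U / V^2, with values
  0, 1 and 0.\<close>

definition chart_V :: "'b \<Rightarrow> 'b poly poly" where
  "chart_V x0 = chart_U - [:[:0, 0, x0:]:]"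

lemma chart_U: assumes "on_aff a x y" "y \<noteq> 0" shows "eval2 chart_U (x / y) (1 / y) = x ^ 3 / y\<^sup>2"
proof -
  have "y\<^sup>2 * eval2 chart_U (x / y) (1 / y) = y\<^sup>2 + a 1 * x * y + a 3 * y - (a 2 * x\<^sup>2 + a 4 * x + a 6)"
    using assms(2) by (simp add: chart_U_def field_simps power2_eq_square)
  also have "\<dots> = x ^ 3" using assms(1) by (simp add: on_aff_def weq_def algebra_simps)
  finally show ?thesis using assms(2) by (simp add: field_simps)
qed

lemma chart_V: "on_aff a x y \<Longrightarrow> y \<noteq> 0 \<Longrightarrow> eval2 (chart_V x0) (x / y) (1 / y) = x\<^sup>2 * (x - x0) / y\<^sup>2"
  by (simp add: chart_V_def chart_U field_simps power2_eq_square power3_eq_cube)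

lemma chart_UV_0: "eval2 chart_U 0 0 = 1" "eval2 (chart_V x0) 0 0 = 1"
  by (simp_all add: chart_U_def chart_V_def)

lemma reginf_x_inv: "reginf (xpol x0) (\<lambda>x y. 1 / (x - x0)) 0"
  unfolding reginf_def
proof (intro exI conjI allI impI)
  show "eval2 (chart_V x0) 0 0 \<noteq> 0" by (simp add: chart_UV_0)
  show "0 = eval2 [:[:0, 0, 1:]:] 0 0 / eval2 (chart_V x0) 0 0" by simp
  fix x y
  assume *: "on_aff a x y \<and> y \<noteq> 0 \<and> eval2 (xpol x0) x y \<noteq> 0 \<and> eval2 (chart_V x0) (x / y) (1 / y) \<noteq> 0"
  have e: "eval2 [:[:0, 0, 1:]:] (x / y) (1 / y) = x\<^sup>2 / y\<^sup>2" by (simp add: power2_eq_square)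
  have V: "eval2 (chart_V x0) (x / y) (1 / y) = x\<^sup>2 * (x - x0) / y\<^sup>2" using * chart_V by blast
  then have nz: "x \<noteq> 0" "x - x0 \<noteq> 0" "y \<noteq> 0" using * by auto
  show "1 / (x - x0) = eval2 [:[:0, 0, 1:]:] (x / y) (1 / y) / eval2 (chart_V x0) (x / y) (1 / y)"
    unfolding e V using nz by (simp add: field_simps)
qed

lemma reginf_x: "reginf (xpol x0) (\<lambda>x y. x / (x - x0)) 1"
  unfolding reginf_def
proof (intro exI conjI allI impI)
  show "eval2 (chart_V x0) 0 0 \<noteq> 0" by (simp add: chart_UV_0)
  show "1 = eval2 chart_U 0 0 / eval2 (chart_V x0) 0 0" by (simp add: chart_UV_0)
  fix x y
  assume *: "on_aff a x y \<and> y \<noteq> 0 \<and> eval2 (xpol x0) x y \<noteq> 0 \<and> eval2 (chart_V x0) (x / y) (1 / y) \<noteq> 0"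
  have U: "eval2 chart_U (x / y) (1 / y) = x ^ 3 / y\<^sup>2" using * chart_U by blast
  have V: "eval2 (chart_V x0) (x / y) (1 / y) = x\<^sup>2 * (x - x0) / y\<^sup>2" using * chart_V by blast
  then have nz: "x \<noteq> 0" "x - x0 \<noteq> 0" "y \<noteq> 0" using * by auto
  show "x / (x - x0) = eval2 chart_U (x / y) (1 / y) / eval2 (chart_V x0) (x / y) (1 / y)"
    unfolding U V using nz by (simp add: field_simps power2_eq_square power3_eq_cube)
qed

lemma reginf_y: "reginf (xpol x0) (\<lambda>x y. y / (x - x0)\<^sup>2) 0"
  unfolding reginf_def
proof (intro exI conjI allI impI)
  show "eval2 (chart_V x0 ^ 2) 0 0 \<noteq> 0" by (simp add: chart_UV_0)
  show "0 = eval2 ([:[:0, 1:]:] * chart_U) 0 0 / eval2 (chart_V x0 ^ 2) 0 0" by (simp add: chart_UV_0)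
  fix x y
  assume *: "on_aff a x y \<and> y \<noteq> 0 \<and> eval2 (xpol x0) x y \<noteq> 0 \<and> eval2 (chart_V x0 ^ 2) (x / y) (1 / y) \<noteq> 0"
  have U: "eval2 chart_U (x / y) (1 / y) = x ^ 3 / y\<^sup>2" using * chart_U by blast
  have V: "eval2 (chart_V x0) (x / y) (1 / y) = x\<^sup>2 * (x - x0) / y\<^sup>2" using * chart_V by blast
  then have nz: "x \<noteq> 0" "x - x0 \<noteq> 0" "y \<noteq> 0" using * by auto
  have e: "eval2 [:[:0, 1:]:] (x / y) (1 / y) = x / y" by simp
  show "y / (x - x0)\<^sup>2 = eval2 ([:[:0, 1:]:] * chart_U) (x / y) (1 / y) / eval2 (chart_V x0 ^ 2) (x / y) (1 / y)"
    unfolding eval2_mult eval2_power e U V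
  proof -
    have "y / z\<^sup>2 = x / y * (x ^ 3 / y\<^sup>2) / (x\<^sup>2 * z / y\<^sup>2)\<^sup>2" if "z \<noteq> 0" for z
      using nz(1,3) that by (simp add: field_simps power2_eq_square power3_eq_cube)
    then show "y / (x - x0)\<^sup>2 = x / y * (x ^ 3 / y\<^sup>2) / (x\<^sup>2 * (x - x0) / y\<^sup>2)\<^sup>2"
      using nz(2) by blast
  qed
qed

text \<open>\<open>chart_V\<close> vanishes on the fibre over \<open>x0\<close> but not at infinity.\<close>
lemma reginf_extend:
  assumes "reginf (D * xpol x0) \<phi> c" shows "reginf D \<phi> c"
proof -
  obtain G H where G: "eval2 H 0 0 \<noteq> 0" "c = eval2 G 0 0 / eval2 H 0 0" "agrees (D * xpol x0) \<phi> G H"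
    using assms unfolding reginf_def by blast
  show ?thesis
    unfolding reginf_def
  proof (intro exI conjI allI impI)
    show "eval2 (H * chart_V x0) 0 0 \<noteq> 0" "c = eval2 (G * chart_V x0) 0 0 / eval2 (H * chart_V x0) 0 0"
      using G by (simp_all add: chart_UV_0)
    fix x y assume "on_aff a x y \<and> y \<noteq> 0 \<and> eval2 D x y \<noteq> 0 \<and> eval2 (H * chart_V x0) (x / y) (1 / y) \<noteq> 0"
    then have *: "on_aff a x y" "y \<noteq> 0" "eval2 D x y \<noteq> 0" "eval2 H (x / y) (1 / y) \<noteq> 0"
      "eval2 (chart_V x0) (x / y) (1 / y) \<noteq> 0" by auto
    then have "x \<noteq> x0" using chart_V[of x y x0] by auto
    then have "eval2 (D * xpol x0) x y \<noteq> 0" using *(3) unfolding eval2_mult by simp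
    then show "\<phi> x y = eval2 (G * chart_V x0) (x / y) (1 / y) / eval2 (H * chart_V x0) (x / y) (1 / y)"
      using G(3) * unfolding eval2_mult by simp
  qed
qed

abbreviation quot :: "'b poly \<Rightarrow> 'b poly \<Rightarrow> 'b \<Rightarrow> nat \<Rightarrow> 'b \<Rightarrow> 'b \<Rightarrow> 'b" where
  "quot A B x0 n \<equiv> \<lambda>x y. (poly A x + poly B x * y) / (x - x0) ^ n"

lemma poly_sum_le: "degree (A :: 'b poly) \<le> n \<Longrightarrow> poly A x = (\<Sum>i\<le>n. coeff A i * x ^ i)"
  unfolding poly_altdef by (rule sum.mono_neutral_left) (auto simp: coeff_eq_0)

text \<open>Each x^i / (x - x0)^n is a product of i factors x / (x - x0) and n - i factors 1 / (x -
  x0), whose values at infinity are 1 and 0; only i = n survives.\<close>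

lemma reginf_poly:
  assumes "degree A \<le> n"
  shows "reginf (xpol x0) (\<lambda>x y. poly A x / (x - x0) ^ n) (coeff A n)"
proof -
  have "reginf (xpol x0) (\<lambda>x y. \<Sum>i\<le>n. coeff A i * ((x / (x - x0)) ^ i * (1 / (x - x0)) ^ (n - i)))
     (\<Sum>i\<le>n. coeff A i * (1 ^ i * 0 ^ (n - i)))"
    by (intro reginf_sum reginf_mult reginf_power reginf_const reginf_x reginf_x_inv)
  also have "(\<Sum>i\<le>n. coeff A i * (1 ^ i * 0 ^ (n - i))) = (\<Sum>i\<le>n. if i = n then coeff A n else 0)"
    by (intro sum.cong refl) (auto simp: power_0_left)
  also have "\<dots> = coeff A n" by simp
  finally show ?thesis
  proof (rule reginf_cong)
    fix x y assume "eval2 (xpol x0) x y \<noteq> 0"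
    then have x: "x - x0 \<noteq> 0" by simp
    have "coeff A i * ((x / (x - x0)) ^ i * (1 / (x - x0)) ^ (n - i)) = coeff A i * x ^ i / (x - x0) ^ n"
      if "i \<in> {..n}" for i
    proof -
      have "(x - x0) ^ n = (x - x0) ^ i * (x - x0) ^ (n - i)" using that by (simp add: power_add[symmetric])
      then show ?thesis by (simp add: power_divide)
    qed
    then show "(\<Sum>i\<le>n. coeff A i * ((x / (x - x0)) ^ i * (1 / (x - x0)) ^ (n - i))) = poly A x / (x - x0) ^ n"
      by (simp add: poly_sum_le[OF assms] sum_divide_distrib)
  qed
qed

lemma reginf_AB:
  assumes "degree A \<le> n" "degree B \<le> n - 2" "n \<ge> 2"
  shows "reginf (xpol x0) (quot A B x0 n) (coeff A n)"
proof -
  have "reginf (xpol x0) (\<lambda>x y. poly A x / (x - x0) ^ n + poly B x / (x - x0) ^ (n - 2) * (y / (x - x0)\<^sup>2))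
    (coeff A n + coeff B (n - 2) * 0)"
    using assms by (intro reginf_add reginf_mult reginf_poly reginf_y)
  moreover have "(x - x0) ^ n = (x - x0) ^ (n - 2) * (x - x0)\<^sup>2" for x
    using assms(3) by (metis le_add_diff_inverse2 power_add)
  ultimately show ?thesis by (simp add: add_divide_distrib)
qed

text \<open>If a degree were too large, multiplying by a suitable factor that vanishes at infinity
  would bring the quotient to exact order 0. Its value at infinity would then be a leading
  coefficient, and also zero.\<close>

lemma reginf_degree:
  assumes n: "n \<ge> 2" and D: "\<not> eqE D 0" and Dx: "\<And>x y. eval2 D x y \<noteq> 0 \<Longrightarrow> x \<noteq> x0"
    and reg: "reginf D (quot A B x0 n) c"
  shows "degree A \<le> n \<and> degree B \<le> n - 2"
proof (rule ccontr)
  assume "\<not> ?thesis"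
  then have big: "degree A > n \<or> degree B > n - 2" by auto
  have lift: "reginf D \<phi> c" if "reginf (xpol x0) \<phi> c" for \<phi> c
    by (rule reginf_cong[OF that]) (use Dx in auto)
  show False
  \<comment> \<open>The case distinction asks whether A or B y has the larger pole at
    infinity.\<close>
  proof (cases "degree B = 0 \<and> degree A > n \<or> degree B + 2 \<le> degree A")
    case True
    then have d: "degree A > n" "degree B \<le> degree A - 2" using big n by auto
    let ?m = "degree A"
    have "reginf D (quot A B x0 ?m) (coeff A ?m)"
      using d n by (intro lift reginf_AB) auto
    moreover have "reginf D (\<lambda>x y. (poly A x + poly B x * y) / (x - x0) ^ n * (1 / (x - x0)) ^ (?m - n)) (c * 0 ^ (?m - n))"
      by (intro reginf_mult reg reginf_power lift reginf_x_inv)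
    then have "reginf D (quot A B x0 ?m) (c * 0 ^ (?m - n))"
    proof (rule reginf_cong)
      fix x y :: 'b
      have "(x - x0) ^ ?m = (x - x0) ^ n * (x - x0) ^ (?m - n)" using d by (simp add: power_add[symmetric])
      then show "(poly A x + poly B x * y) / (x - x0) ^ n * (1 / (x - x0)) ^ (?m - n) = (poly A x + poly B x * y) / (x - x0) ^ ?m"
        by (simp add: power_divide)
    qed
    ultimately have "coeff A ?m = c * 0 ^ (?m - n)" by (rule reginf_unique[OF D])
    then have "A = 0" using d by (simp add: power_0_left)
    then show False using d by simp
  next
    case False
    then have d: "degree B > n - 2" "degree A \<le> degree B + 1" using big by auto
    then have B: "B \<noteq> 0" by auto
    let ?m = "degree B + 3"
    \<comment> \<open>Multiplying by y turns A + B y into \<open>A' + B' y\<close>, where now the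
      polynomial part dominates: it has degree deg B + 3 and the leading coefficient of B.\<close>
    define A' where "A' = B * cub"
    define B' where "B' = A - B * lin"
    have "degree A' = ?m" using B by (simp add: A'_def degree_mult_eq degree_cub)
    moreover have "coeff A' ?m = lead_coeff B"
      using coeff_mult_degree_sum[of B cub] by (simp add: A'_def degree_cub lead_coeff_cub)
    moreover have "degree B' \<le> ?m - 2"
    proof -
      have "degree (B * lin) \<le> degree B + 1" using degree_mult_le[of B lin] degree_lin by linarith
      then show ?thesis unfolding B'_def using d by (intro degree_diff_le) auto
    qed
    ultimately have "reginf D (quot A' B' x0 ?m) (lead_coeff B)"
      using lift reginf_AB[of A' ?m B' x0] by simp
    moreover have "reginf D (\<lambda>x y. (poly A x + poly B x * y) / (x - x0) ^ n * (y / (x - x0)\<^sup>2 * (1 / (x - x0)) ^ (?m - n - 2)))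
        (c * (0 * 0 ^ (?m - n - 2)))"
      by (intro reginf_mult reg reginf_power lift reginf_x_inv reginf_y)
    then have "reginf D (quot A' B' x0 ?m) (c * (0 * 0 ^ (?m - n - 2)))"
    proof (rule reginf_cong)
      fix x y assume P: "on_aff a x y"
      have e: "(x - x0) ^ ?m = (x - x0) ^ n * (x - x0)\<^sup>2 * (x - x0) ^ (?m - n - 2)"
      proof -
        have "?m = n + 2 + (?m - n - 2)" using d n by simp
        then show ?thesis by (metis power_add)
      qed
      have "(poly A x + poly B x * y) * y = poly A x * y + poly B x * y\<^sup>2"
        by (simp add: algebra_simps power2_eq_square)
      also have "\<dots> = poly A' x + poly B' x * y"
        by (simp only: P[unfolded on_aff_iff]) (simp add: A'_def B'_def algebra_simps)
      finally show "(poly A x + poly B x * y) / (x - x0) ^ n * (y / (x - x0)\<^sup>2 * (1 / (x - x0)) ^ (?m - n - 2)) =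
          (poly A' x + poly B' x * y) / (x - x0) ^ ?m"
        unfolding e by (simp add: power_divide)
    qed
    ultimately have "lead_coeff B = c * (0 * 0 ^ (?m - n - 2))" by (rule reginf_unique[OF D])
    then show False using B by simp
  qed
qed

text \<open>The hypothesis \<open>ne\<close> makes y - \<open>negy x0 y0\<close> a unit at the
  point, so \<open>ypol_conj\<close> writes y - y0 as x - x0 times a regular function. Every
  function vanishing at the point is then a multiple of x - x0.\<close>

lemma uniformizer_x:
  assumes P: "on_aff a x0 y0" and ne: "negy x0 y0 \<noteq> y0"
  shows "uniformizer a (Aff x0 y0) (xpol x0, 1)"
  unfolding uniformizer_def
proof (intro conjI allI impI)
  show v: "rf_valid a (xpol x0, 1)" by (simp add: rf_valid_iff)
  show "in_maxideal a (Aff x0 y0) (xpol x0, 1)"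
    unfolding in_maxideal_def regular_with_Aff[OF P v]
    by (intro exI[of _ "xpol x0"] exI[of _ 1]) simp
  fix f assume f: "rf_valid a f \<and> in_maxideal a (Aff x0 y0) f"
  then obtain g h where gh: "eval2 h x0 y0 \<noteq> 0" "0 = eval2 g x0 y0 / eval2 h x0 y0" "eqE (fst f * h) (g * snd f)"
    unfolding in_maxideal_def by (auto simp: regular_with_Aff[OF P])
  then have "eval2 g x0 y0 = 0" by simp
  then obtain G H where g: "g = xpol x0 * G + ypol y0 * H"
    using eval2_Taylor[of g x0 y0] by auto
  define r1 where "r1 = G * ypol (negy x0 y0) + conj_quot x0 * H"
  define r2 where "r2 = h * ypol (negy x0 y0)"
  have r2: "eval2 r2 x0 y0 \<noteq> 0" unfolding r2_def eval2_mult using gh(1) ne by auto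
  then have nr2: "\<not> eqE r2 0" using P by (auto simp: eqE_def)
  have "eqE (g * ypol (negy x0 y0)) (xpol x0 * r1)"
  proof -
    have "g * ypol (negy x0 y0) = xpol x0 * G * ypol (negy x0 y0) + ypol y0 * ypol (negy x0 y0) * H"
      unfolding g by (simp only: ring_distribs ac_simps)
    also have "eqE \<dots> (xpol x0 * G * ypol (negy x0 y0) + xpol x0 * conj_quot x0 * H)"
      by (intro eqE_add eqE_mult eqE_refl ypol_conj P)
    also have "\<dots> = xpol x0 * r1" unfolding r1_def by (simp only: ring_distribs ac_simps)
    finally show ?thesis .
  qed
  from eqE_mult[OF this eqE_refl[of "snd f"]] eqE_mult[OF gh(3) eqE_refl[of "ypol (negy x0 y0)"]]
  have "eqE (fst f * r2) (xpol x0 * r1 * snd f)"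
    unfolding r2_def using eqE_trans by (simp only: ac_simps; blast)
  then have s: "rf_same a f (rf_mult (xpol x0, 1) (r1, r2))"
    using f nr2 by (subst rf_same_iff) (auto simp: rf_mult_def rf_valid_iff)
  have vr: "rf_valid a (r1, r2)" using nr2 by (simp add: rf_valid_iff)
  then have "regular_at a (Aff x0 y0) (r1, r2)"
    unfolding regular_at_def regular_with_Aff[OF P vr] using r2
    by (intro exI conjI) (auto intro: eqE_refl)
  then show "\<exists>r. rf_valid a r \<and> regular_at a (Aff x0 y0) r \<and> rf_same a f (rf_mult (xpol x0, 1) r)"
    using vr s by blast
qed

lemma regular_AffE:
  assumes "on_aff a x y" "rf_valid a f" "regular_at a (Aff x y) f"
  obtains g h where "eval2 h x y \<noteq> 0" "eqE (fst f * h) (g * snd f)"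
  using assms by (auto simp: regular_at_def regular_with_Aff)

text \<open>If \<open>t\<close> is the uniformizer that witnesses the bound, then \<open>x - x0 = t r\<close> with \<open>r\<close> regular, so
  \<open>(x - x0)^k\<close> cancels the pole as \<open>t^k\<close> does; \<open>c\<close> clears the denominators of both representations.\<close>
lemma ord_ge_multiplier:
  assumes P: "on_aff a x0 y0" and f: "rf_valid a f" and o: "ord_ge a (Aff x0 y0) f (- int k)"
  shows "\<exists>c g. eval2 c x0 y0 \<noteq> 0 \<and> eqE (c * (fst f * xpol x0 ^ k)) (g * snd f)"
proof -
  obtain t where t: "uniformizer a (Aff x0 y0) t" "regular_at a (Aff x0 y0) (rf_mult f (rf_ipow t (int k)))"
    using o by (auto simp: ord_ge_def)
  then have vt: "\<not> eqE (snd t) 0" by (simp add: uniformizer_def rf_valid_iff)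
  have m: "rf_mult f (rf_ipow t (int k)) = (fst f * fst t ^ k, snd f * snd t ^ k)"
    by (simp add: rf_mult_def rf_ipow_def)
  have vm: "rf_valid a (rf_mult f (rf_ipow t (int k)))"
    using f vt unfolding m by (auto simp: rf_valid_iff eqE_mult_0 dest: eqE_power_0)
  obtain g h where gh: "eval2 h x0 y0 \<noteq> 0" "eqE (fst f * fst t ^ k * h) (g * (snd f * snd t ^ k))"
    using regular_AffE[OF P vm t(2)] unfolding m fst_conv snd_conv by blast
  have vx: "rf_valid a (xpol x0, 1)" by (simp add: rf_valid_iff)
  have "in_maxideal a (Aff x0 y0) (xpol x0, 1)"
    unfolding in_maxideal_def regular_with_Aff[OF P vx] by (intro exI[of _ "xpol x0"] exI[of _ 1]) simp
  then obtain r where r: "rf_valid a r" "regular_at a (Aff x0 y0) r" "rf_same a (xpol x0, 1) (rf_mult t r)"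
    using t(1) vx unfolding uniformizer_def by blast
  have vr: "\<not> eqE (snd r) 0" using r(1) by (simp add: rf_valid_iff)
  then have s: "eqE (xpol x0 * (snd t * snd r)) (fst t * fst r)"
    using r(3) vt by (subst (asm) rf_same_iff) (auto simp: rf_mult_def eqE_mult_0)
  obtain g' h' where gh': "eval2 h' x0 y0 \<noteq> 0" "eqE (fst r * h') (g' * snd r)"
    using regular_AffE[OF P r(1,2)] by blast
  have "eqE (snd r * (xpol x0 * snd t * h')) (snd r * (fst t * g'))"
    using eqE_trans[OF eqE_mult[OF s eqE_refl[of h']]] eqE_mult[OF eqE_refl[of "fst t"] gh'(2)]
    by (simp only: ac_simps)
  then have u: "eqE (xpol x0 * snd t * h') (fst t * g')"
    using eqE_cancel[OF vr] by blast
  have uk: "eqE ((xpol x0 * snd t * h') ^ k) ((fst t * g') ^ k)" by (rule eqE_power[OF u])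
  have "eqE (snd t ^ k * ((h' ^ k * h) * (fst f * xpol x0 ^ k))) (snd t ^ k * ((g * g' ^ k) * snd f))"
  proof -
    have "snd t ^ k * ((h' ^ k * h) * (fst f * xpol x0 ^ k)) = (xpol x0 * snd t * h') ^ k * (fst f * h)"
      by (simp only: power_mult_distrib ac_simps)
    also have "eqE \<dots> ((fst t * g') ^ k * (fst f * h))" by (intro eqE_mult uk eqE_refl)
    also have "\<dots> = (fst f * fst t ^ k * h) * g' ^ k" by (simp only: power_mult_distrib ac_simps)
    also have "eqE \<dots> ((g * (snd f * snd t ^ k)) * g' ^ k)" by (intro eqE_mult gh(2) eqE_refl)
    also have "\<dots> = snd t ^ k * ((g * g' ^ k) * snd f)" by (simp only: ac_simps)
    finally show ?thesis .
  qed
  moreover have "\<not> eqE (snd t ^ k) 0" using vt eqE_power_0 by blast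
  ultimately have "eqE ((h' ^ k * h) * (fst f * xpol x0 ^ k)) ((g * g' ^ k) * snd f)"
    using eqE_cancel by blast
  moreover have "eval2 (h' ^ k * h) x0 y0 \<noteq> 0" using gh gh' by simp
  ultimately show ?thesis by blast
qed

text \<open>The admissible denominators of \<open>N\<close> / \<open>D\<close> form an ideal without
  a common zero, so it contains 1: a function regular at all affine points belongs to the coordinate
  ring.\<close>

lemma everywhere_regular:
  assumes "\<And>x y. on_aff a x y \<Longrightarrow> \<exists>c g. eval2 c x y \<noteq> 0 \<and> eqE (c * N) (g * D)"
  shows "\<exists>A B. eqE N (D * [:A, B:])"
proof -
  let ?J = "{c. \<exists>g. eqE (c * N) (g * D)}"
  have "idl ?J"
    unfolding idl_def
  proof (intro conjI allI ballI impI)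
    fix c assume "eqE c 0"
    then have "eqE (c * N) (0 * D)" by (simp add: eqE_def)
    then show "c \<in> ?J" by blast
  next
    fix c c' assume "c \<in> ?J" "c' \<in> ?J"
    then obtain g g' where "eqE (c * N) (g * D)" "eqE (c' * N) (g' * D)" by blast
    from eqE_add[OF this] have "eqE ((c + c') * N) ((g + g') * D)" by (simp only: ring_distribs)
    then show "c + c' \<in> ?J" by blast
  next
    fix c h assume "c \<in> ?J"
    then obtain g where "eqE (c * N) (g * D)" by blast
    from eqE_mult[OF eqE_refl[of h] this] have "eqE ((h * c) * N) ((h * g) * D)" by (simp only: ac_simps)
    then show "h * c \<in> ?J" by blast
  qed
  then have "1 \<in> ?J" by (rule nullstellensatz) (use assms in blast)
  then obtain g where g: "eqE N (g * D)" by auto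
  obtain A B where "eqE g [:A, B:]" using reduce by blast
  from eqE_mult[OF this eqE_refl[of D]] g have "eqE N (D * [:A, B:])"
    using eqE_trans by (simp only: mult.commute[of D]; blast)
  then show ?thesis by blast
qed

end

section \<open>Explicit description of the Riemann-Roch space and of the values\<close>

locale conjugate_points = elliptic_fq a q for a :: "nat \<Rightarrow> 'b::field" and q :: nat +
  fixes x0 y0 :: 'b and k :: nat
  assumes x0: "x0 \<in> Fsub q" and Q_on: "on_aff a x0 y0" and Q_ne: "negy x0 y0 \<noteq> y0"
    and frob_y0: "y0 ^ q = negy x0 y0" and k2: "k \<ge> 2"
begin

text \<open>The numerators f (x - x0)^k: functions over \<open>F\<close> with pole order at most 2k
  at infinity, where 2 deg B + 3 \<le> 2k means deg B \<le> k - 2. The total number of free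
  coefficients is (k + 1) + (k - 1) = 2k.\<close>

definition RR :: "('b poly \<times> 'b poly) set" where
  "RR = {(A, B). (\<forall>i. coeff A i \<in> F) \<and> (\<forall>i. coeff B i \<in> F) \<and> degree A \<le> k \<and> degree B \<le> k - 2}"

text \<open>At \<open>Inf\<close> the quotient of A + B y by (x - x0)^k takes the coefficient of x^k
  as its value, by \<open>reginf_AB\<close>.\<close>

definition val :: "'b poly \<times> 'b poly \<Rightarrow> 'b point \<Rightarrow> 'b" where
  "val AB P = (case P of Inf \<Rightarrow> coeff (fst AB) k
     | Aff x y \<Rightarrow> (poly (fst AB) x + poly (snd AB) x * y) / (x - x0) ^ k)"

lemma frob_Q: "frob q (Aff x0 y0) = Aff x0 (negy x0 y0)"
  using x0 frob_y0 by (simp add: frob_def Fsub_def)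

lemma nz_xpow: "\<not> eqE (xpol x0 ^ k) 0"
  using nz_x eqE_power_0 by blast

lemma coeffs_in_mult: "coeffs_in G F \<Longrightarrow> coeffs_in H F \<Longrightarrow> coeffs_in (G * H) F"
  unfolding coeffs_in_def by (auto simp: coeff_mult coeff_sum intro!: F.sum F.mult)

lemma coeffs_in_xpow: "coeffs_in (xpol x0 ^ n) F"
proof -
  have c: "coeff (coeff (xpol x0) i) j \<in> F" for i j
    using x0 F.minus F.one F.zero by (auto simp: coeff_pCons split: nat.splits)
  have 1: "coeffs_in 1 F" unfolding coeffs_in_def using F.one F.zero by (auto simp: coeff_1)
  have x: "coeffs_in (xpol x0) F" using c by (simp only: coeffs_in_def simp_thms)
  show ?thesis
  proof (induction n)
    case (Suc n)
    then show ?case unfolding power_Suc by (rule coeffs_in_mult[OF x])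
  qed (simp only: power_0 1)
qed

lemma regular_value:
  assumes f: "rf_valid a f" and AB: "AB \<in> RR" and eq: "eqE (fst f * xpol x0 ^ k) (snd f * [:fst AB, snd AB:])"
    and P: "on_curve a P" "P \<noteq> Aff x0 y0" "P \<noteq> Aff x0 (negy x0 y0)"
  shows "regular_with a P f (val AB P)" "value_at a P f = val AB P"
proof -
  have "regular_with a P f (val AB P) \<and> (\<forall>c. regular_with a P f c \<longrightarrow> c = val AB P)"
  proof (cases P)
    case Inf
    have "reginf (xpol x0) (quot (fst AB) (snd AB) x0 k) (coeff (fst AB) k)"
      using AB k2 by (intro reginf_AB) (auto simp: RR_def)
    \<comment> \<open>The two expressions are compared off the fibre over x0 only;
      \<open>reginf_extend\<close> removes this restriction afterwards.\<close>
    then have "reginf (snd f * xpol x0) (\<lambda>x y. eval2 (fst f) x y / eval2 (snd f) x y) (coeff (fst AB) k)"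
    proof (rule reginf_cong)
      fix x y assume o: "on_aff a x y" and nz: "eval2 (snd f * xpol x0) x y \<noteq> 0"
      then have "eval2 (fst f) x y * (x - x0) ^ k = eval2 (snd f) x y * (poly (fst AB) x + poly (snd AB) x * y)"
        using eq[unfolded eqE_def] by (simp only: eval2_mult eval2_power) (simp add: mult.commute)
      then show "(poly (fst AB) x + poly (snd AB) x * y) / (x - x0) ^ k = eval2 (fst f) x y / eval2 (snd f) x y"
        using nz by (simp only: eval2_mult) (auto simp: field_simps)
    qed auto
    then have "regular_with a P f (coeff (fst AB) k)"
      unfolding Inf regular_with_Inf by (rule reginf_extend)
    then have r: "regular_with a P f (val AB P)" by (simp add: val_def Inf)
    then show ?thesis
      using reginf_unique[OF f[unfolded rf_valid_iff], of _ _ "val AB P"] unfolding Inf regular_with_Inf by blast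
  next
    case (Aff x y)
    have on: "on_aff a x y" using P(1) Aff by (simp add: on_curve_def)
    have ne: "x - x0 \<noteq> 0"
    proof
      assume "x - x0 = 0"
      then have "x = x0" by simp
      then have "y = y0 \<or> y = negy x0 y0" using same_x[OF Q_on] on by blast
      then show False using P(2,3) Aff \<open>x = x0\<close> by blast
    qed
    have "regular_with a P f (val AB P)"
      unfolding Aff regular_with_Aff[OF on f]
    proof (intro exI conjI)
      show "eval2 (xpol x0 ^ k) x y \<noteq> 0" using ne by simp
      show "val AB (Aff x y) = eval2 [:fst AB, snd AB:] x y / eval2 (xpol x0 ^ k) x y"
        by (simp add: val_def mult.commute)
      show "eqE (fst f * xpol x0 ^ k) ([:fst AB, snd AB:] * snd f)" using eq by (simp only: mult.commute)
    qed
    then show ?thesis using regular_with_Aff_unique[OF on f] unfolding Aff by blast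
  qed
  then show "regular_with a P f (val AB P)" "value_at a P f = val AB P"
    unfolding value_at_def by (blast, blast intro: the_equality)
qed

text \<open>The order bounds at the two conjugate points make f (x - x0)^k regular at every affine
  point, hence of the form A + B y. Descent puts the coefficients into \<open>F\<close>, and
  regularity of f at infinity bounds the degrees.\<close>

lemma LD_imp_RR:
  assumes f: "f \<in> LD a q (Aff x0 y0) k"
  obtains AB where "AB \<in> RR" "eqE (fst f * xpol x0 ^ k) (snd f * [:fst AB, snd AB:])"
proof -
  have v: "rf_valid a f" and c: "coeffs_in (fst f) F" "coeffs_in (snd f) F"
    and reg: "\<And>P. on_curve a P \<Longrightarrow> P \<noteq> Aff x0 y0 \<Longrightarrow> P \<noteq> Aff x0 (negy x0 y0) \<Longrightarrow> regular_at a P f"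
    and o1: "ord_ge a (Aff x0 y0) f (- int k)" and o2: "ord_ge a (Aff x0 (negy x0 y0)) f (- int k)"
    using f unfolding LD_def frob_Q by auto
  have Q'_on: "on_aff a x0 (negy x0 y0)" using Q_on by (simp add: on_aff_negy)
  have "\<exists>A B. eqE (fst f * xpol x0 ^ k) (snd f * [:A, B:])"
  proof (rule everywhere_regular)
    fix x y assume P: "on_aff a x y"
    consider "Aff x y = Aff x0 y0" | "Aff x y = Aff x0 (negy x0 y0)"
      | "Aff x y \<noteq> Aff x0 y0" "Aff x y \<noteq> Aff x0 (negy x0 y0)" by blast
    then show "\<exists>c g. eval2 c x y \<noteq> 0 \<and> eqE (c * (fst f * xpol x0 ^ k)) (g * snd f)"
    proof cases
      case 1
      then show ?thesis using ord_ge_multiplier[OF Q_on v o1] by simp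
    next
      case 2
      then show ?thesis using ord_ge_multiplier[OF Q'_on v o2] by simp
    next
      case 3
      then have "regular_at a (Aff x y) f" using reg P by (simp add: on_curve_def)
      then obtain g h where gh: "eval2 h x y \<noteq> 0" "eqE (fst f * h) (g * snd f)"
        by (rule regular_AffE[OF P v])
      from eqE_mult[OF this(2) eqE_refl[of "xpol x0 ^ k"]]
      have "eqE (h * (fst f * xpol x0 ^ k)) ((g * xpol x0 ^ k) * snd f)" by (simp only: ac_simps)
      then show ?thesis using gh(1) by blast
    qed
  qed
  then obtain A B where AB: "eqE (fst f * xpol x0 ^ k) (snd f * [:A, B:])" by blast
  have "\<forall>i. coeff A i \<in> F" "\<forall>i. coeff B i \<in> F"
    using galois_descent[OF coeffs_in_mult[OF c(1) coeffs_in_xpow] c(2) _ AB] v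
    by (auto simp: rf_valid_iff)
  moreover have "degree A \<le> k \<and> degree B \<le> k - 2"
  proof -
    have "regular_at a Inf f" using reg by (simp add: on_curve_def)
    then obtain c where "reginf (snd f) (\<lambda>x y. eval2 (fst f) x y / eval2 (snd f) x y) c"
      unfolding regular_at_def regular_with_Inf by blast
    then have "reginf (snd f * xpol x0) (quot A B x0 k) c"
    proof (rule reginf_cong)
      fix x y assume o: "on_aff a x y" and nz: "eval2 (snd f * xpol x0) x y \<noteq> 0"
      then show "eval2 (snd f) x y \<noteq> 0" unfolding eval2_mult by simp
      have "eval2 (fst f) x y * (x - x0) ^ k = eval2 (snd f) x y * (poly A x + poly B x * y)"
        using AB[unfolded eqE_def] o by (simp only: eval2_mult eval2_power) (simp add: mult.commute)
      then show "eval2 (fst f) x y / eval2 (snd f) x y = (poly A x + poly B x * y) / (x - x0) ^ k"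
        using nz by (simp only: eval2_mult) (auto simp: field_simps)
    qed
    then show ?thesis
    proof (rule reginf_degree[OF k2, rotated 2])
      show "\<not> eqE (snd f * xpol x0) 0" using v nz_x eqE_mult_0 unfolding rf_valid_iff by blast
      show "\<And>x y. eval2 (snd f * xpol x0) x y \<noteq> 0 \<Longrightarrow> x \<noteq> x0" unfolding eval2_mult by auto
    qed
  qed
  ultimately have "(A, B) \<in> RR" by (simp add: RR_def)
  then show ?thesis using that AB by simp
qed

lemma ord_ge_RR:
  assumes P: "on_aff a x0 y" "negy x0 y \<noteq> y"
  shows "ord_ge a (Aff x0 y) (G, xpol x0 ^ k) (- int k)"
  unfolding ord_ge_def
proof (intro exI conjI)
  show "uniformizer a (Aff x0 y) (xpol x0, 1)" using uniformizer_x[OF P] .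
  let ?f = "rf_mult (G, xpol x0 ^ k) (rf_ipow (xpol x0, 1) (- (- int k)))"
  have m: "?f = (G * xpol x0 ^ k, xpol x0 ^ k)" by (simp add: rf_mult_def rf_ipow_def)
  have v: "rf_valid a ?f" unfolding m using nz_xpow by (simp only: rf_valid_iff snd_conv not_False_eq_True)
  show "regular_at a (Aff x0 y) ?f"
    unfolding regular_at_def regular_with_Aff[OF P(1) v]
    unfolding m fst_conv snd_conv
  proof (intro exI conjI)
    show "eval2 1 x0 y \<noteq> 0" "eval2 G x0 y = eval2 G x0 y / eval2 1 x0 y" by simp_all
    show "eqE (G * xpol x0 ^ k * 1) (G * xpol x0 ^ k)" by (simp only: mult_1_right eqE_refl)
  qed
qed

lemma RR_imp_LD:
  assumes AB: "AB \<in> RR" shows "([:fst AB, snd AB:], xpol x0 ^ k) \<in> LD a q (Aff x0 y0) k"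
  unfolding LD_def frob_Q
proof (intro CollectI conjI allI impI)
  let ?f = "([:fst AB, snd AB:], xpol x0 ^ k)"
  show v: "rf_valid a ?f" using nz_xpow by (simp only: rf_valid_iff snd_conv not_False_eq_True)
  show "coeffs_in (fst ?f) F" using AB F.zero
    by (auto simp: RR_def coeffs_in_def coeff_pCons split: nat.splits)
  show "coeffs_in (snd ?f) F" using coeffs_in_xpow by simp
  show "ord_ge a (Aff x0 y0) ?f (- int k)" using ord_ge_RR Q_on Q_ne by blast
  show "ord_ge a (Aff x0 (negy x0 y0)) ?f (- int k)"
    using ord_ge_RR[of "negy x0 y0"] Q_on Q_ne by (simp add: on_aff_negy)
  fix P assume "on_curve a P \<and> P \<noteq> Aff x0 y0 \<and> P \<noteq> Aff x0 (negy x0 y0)"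
  then show "regular_at a P ?f"
    unfolding regular_at_def using regular_value(1)[OF v AB]
    by (metis eqE_refl fst_conv mult.commute snd_conv)
qed

lemma AG_code_RR:
  assumes Ps: "\<And>P. P \<in> Ps \<Longrightarrow> on_curve a P" "Aff x0 y0 \<notin> Ps" "Aff x0 (negy x0 y0) \<notin> Ps"
  shows "AG_code a q Ps (Aff x0 y0) k = (\<lambda>AB P. if P \<in> Ps then val AB P else 0) ` RR"
proof -
  have vals: "(\<lambda>P. if P \<in> Ps then value_at a P f else 0) = (\<lambda>P. if P \<in> Ps then val AB P else 0)"
    if "rf_valid a f" "AB \<in> RR" "eqE (fst f * xpol x0 ^ k) (snd f * [:fst AB, snd AB:])" for f AB
    using regular_value(2)[OF that] Ps by (intro ext) auto
  show ?thesis
  proof (intro equalityI subsetI)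
    fix c assume "c \<in> AG_code a q Ps (Aff x0 y0) k"
    then obtain f where f: "f \<in> LD a q (Aff x0 y0) k" "c = (\<lambda>P. if P \<in> Ps then value_at a P f else 0)"
      by (auto simp: AG_code_def)
    moreover from f(1) obtain AB where "AB \<in> RR" "eqE (fst f * xpol x0 ^ k) (snd f * [:fst AB, snd AB:])"
      by (rule LD_imp_RR)
    moreover have "rf_valid a f" using f(1) by (simp add: LD_def)
    ultimately show "c \<in> (\<lambda>AB P. if P \<in> Ps then val AB P else 0) ` RR" using vals by auto
  next
    fix c assume "c \<in> (\<lambda>AB P. if P \<in> Ps then val AB P else 0) ` RR"
    then obtain AB where AB: "AB \<in> RR" "c = (\<lambda>P. if P \<in> Ps then val AB P else 0)" by blast
    let ?f = "([:fst AB, snd AB:], xpol x0 ^ k)"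
    have "rf_valid a ?f" using RR_imp_LD[OF AB(1)] by (simp add: LD_def)
    moreover have "eqE (fst ?f * xpol x0 ^ k) (snd ?f * [:fst AB, snd AB:])"
      by (metis eqE_refl fst_conv mult.commute snd_conv)
    ultimately have "(\<lambda>P. if P \<in> Ps then value_at a P ?f else 0) = c" using vals AB by simp
    then show "c \<in> AG_code a q Ps (Aff x0 y0) k" using RR_imp_LD[OF AB(1)] unfolding AG_code_def by blast
  qed
qed

end

section \<open>The code\<close>

text \<open>\<open>R\<close> marks the exceptional sets of size \<open>K\<close>, those on which a
  one-dimensional space of codewords vanishes. Each adds q - 1 to the count expected of an MDS
  code.\<close>

lemma nmds_moments:
  assumes I: "finite I" and C: "finite C" and q: "q \<ge> 1"
    and Z: "\<And>T. T \<subseteq> I \<Longrightarrow> card {c \<in> C. \<forall>i\<in>T. c i = 0} =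
      (if card T < K then q ^ (K - card T) else if card T = K \<and> R T then q else (1::nat))"
  shows "(\<Sum>w\<le>card I. wdist I C w * ((card I - w) choose m)) =
      (card I choose m) * (if m < K then q ^ (K - m) else 1) +
      (if m = K then (q - 1) * card {T. T \<subseteq> I \<and> card T = K \<and> R T} else 0)"
proof -
  let ?S = "{T. T \<subseteq> I \<and> card T = m}"
  have fS: "finite ?S" by (rule finite_subset[of _ "Pow I"]) (use I in auto)
  have cS: "card ?S = card I choose m" using I by (rule n_subsets)
  have "(\<Sum>w\<le>card I. wdist I C w * ((card I - w) choose m)) =
     (\<Sum>T\<in>?S. if m < K then q ^ (K - m) else if m = K \<and> R T then q else 1)"
    unfolding binomial_moments[OF I C] by (intro sum.cong refl) (simp add: Z)
  also have "\<dots> = (\<Sum>T\<in>?S. (if m < K then q ^ (K - m) else 1) + (if m = K \<and> R T then q - 1 else 0))"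
    using q by (intro sum.cong refl) auto
  also have "\<dots> = (card I choose m) * (if m < K then q ^ (K - m) else 1) + (\<Sum>T\<in>?S. if m = K \<and> R T then q - 1 else 0)"
    by (simp only: sum.distrib sum_constant cS of_nat_id)
  also have "(\<Sum>T\<in>?S. if m = K \<and> R T then q - 1 else 0) =
      (if m = K then (q - 1) * card {T. T \<subseteq> I \<and> card T = K \<and> R T} else 0)"
  proof (cases "m = K")
    case True
    have "(\<Sum>T\<in>?S. if R T then q - 1 else 0) = (\<Sum>T\<in>{T \<in> ?S. R T}. q - 1)"
      using fS by (rule sum.inter_filter[symmetric])
    also have "{T \<in> ?S. R T} = {T. T \<subseteq> I \<and> card T = K \<and> R T}" using True by auto
    finally show ?thesis using True by simp
  qed simp
  finally show ?thesis .
qed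

context elliptic_fq
begin

lemma numeral_F: "numeral n \<in> F"
  by (induction n) (auto simp only: numeral.simps intro: F.add F.one)

lemma poly_F: "(\<forall>i. coeff A i \<in> F) \<Longrightarrow> x \<in> F \<Longrightarrow> poly A x \<in> F"
  unfolding poly_altdef by (intro F.sum F.mult F.power) auto

lemma coeff_in_F: "a 1 \<in> F" "a 2 \<in> F" "a 3 \<in> F" "a 4 \<in> F" "a 6 \<in> F"
  using coeffs by auto

lemma rat_points_add:
  assumes P: "P \<in> rat_points a q" and R: "R \<in> rat_points a q"
  shows "ec_add a P R \<in> rat_points a q"
proof (cases P)
  case Inf
  then show ?thesis using R by (simp add: ec_add_def)
next
  case P': (Aff x1 y1)
  show ?thesis
  proof (cases R)
    case Inf
    then show ?thesis using P P' by (simp add: ec_add_def)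
  next
    case R': (Aff x2 y2)
    have 1: "on_aff a x1 y1" "x1 \<in> F" "y1 \<in> F" "on_aff a x2 y2" "x2 \<in> F" "y2 \<in> F"
      using P R P' R' by (auto simp: rat_points_def)
    show ?thesis
    proof (cases "ec_add a P R")
      case sum: (Aff x y)
      have "on_aff a x y" using IP_add[OF 1(1,4) idl_UNIV] sum P' R' by simp
      moreover have "x \<in> F \<and> y \<in> F"
      proof -
        define l where "l = (if x1 \<noteq> x2 then (y2 - y1) / (x2 - x1)
                      else (3 * x1^2 + 2 * a 2 * x1 + a 4 - a 1 * y1) / (2 * y1 + a 1 * x1 + a 3))"
        have l: "l \<in> F" unfolding l_def
          by (simp only: split: if_split)
            (intro conjI impI F.divide F.add F.diff F.mult F.power numeral_F coeff_in_F 1)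
        define x3 where "x3 = l^2 + a 1 * l - a 2 - x1 - x2"
        have x3: "x3 \<in> F" unfolding x3_def
          by (intro F.add F.diff F.mult F.power numeral_F coeff_in_F 1 l)
        have nopp: "(x1 = x2 \<and> y1 + y2 + a 1 * x2 + a 3 = 0) = False"
          using sum unfolding P' R' ec_add_def point.case by (metis point.distinct(1))
        have xy: "x = x3" "y = - (l + a 1) * x3 - (y1 - l * x1) - a 3"
          using sum nopp unfolding P' R' ec_add_def point.case Let_def l_def[symmetric] x3_def[symmetric]
          by (simp_all only: if_False point.inject, blast+)
        have "y \<in> F" unfolding xy
          by (intro F.diff F.mult F.minus F.add coeff_in_F 1 l x3)
        then show ?thesis using xy x3 by simp
      qed
      ultimately show ?thesis using sum by (simp add: rat_points_def)
    qed (simp add: rat_points_def)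
  qed
qed

lemma card_poly_F:
  "card {A. (\<forall>i. coeff A i \<in> F) \<and> degree A \<le> n} = q ^ Suc n \<and>
   finite {A. (\<forall>i. coeff A i \<in> F) \<and> degree A \<le> n}"
proof (induction n)
  case 0
  have "{A. (\<forall>i. coeff A i \<in> F) \<and> degree A \<le> 0} = (\<lambda>c. [:c:]) ` F"
  proof (intro equalityI subsetI)
    fix A assume A: "A \<in> {A. (\<forall>i. coeff A i \<in> F) \<and> degree A \<le> 0}"
    then have "degree A = 0" by simp
    then obtain c where "A = [:c:]" by (rule degree_eq_zeroE)
    moreover have "coeff A 0 \<in> F" using A by blast
    then have "c \<in> F" using \<open>A = [:c:]\<close> by simp
    ultimately show "A \<in> (\<lambda>c. [:c:]) ` F" by blast
  qed (auto simp: coeff_pCons F.zero split: nat.splits)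
  moreover have "inj_on (\<lambda>c. [:c:]) F" by (auto simp: inj_on_def)
  ultimately show ?case using finite_F card_F by (simp add: card_image)
next
  case (Suc n)
  let ?S = "{A. (\<forall>i. coeff A i \<in> F) \<and> degree A \<le> n}"
  have "{A. (\<forall>i. coeff A i \<in> F) \<and> degree A \<le> Suc n} = (\<lambda>(c, A). pCons c A) ` (F \<times> ?S)"
  proof (intro equalityI subsetI)
    fix A assume A: "A \<in> {A. (\<forall>i. coeff A i \<in> F) \<and> degree A \<le> Suc n}"
    obtain c B where AB: "A = pCons c B" by (cases A)
    have coeff: "coeff A i \<in> F" for i using A by blast
    have "c \<in> F" using coeff[of 0] AB by simp
    moreover have "coeff B i \<in> F" for i using coeff[of "Suc i"] AB by simp
    moreover have "degree B \<le> n" using A AB by (cases "B = 0") auto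
    ultimately show "A \<in> (\<lambda>(c, A). pCons c A) ` (F \<times> ?S)" using AB by auto
  next
    fix A assume "A \<in> (\<lambda>(c, A). pCons c A) ` (F \<times> ?S)"
    then show "A \<in> {A. (\<forall>i. coeff A i \<in> F) \<and> degree A \<le> Suc n}"
      by (auto simp: coeff_pCons degree_pCons_le intro: order_trans[OF degree_pCons_le] split: nat.splits)
  qed
  moreover have "inj_on (\<lambda>(c, A). pCons c A) (F \<times> ?S)" by (auto simp: inj_on_def)
  ultimately show ?case using Suc finite_F card_F by (simp add: card_image card_cartesian_product)
qed

lemma fpol_vanish:
  assumes "eval2 [:A, B:] x y = 0" "x \<in> F" "y \<in> F" shows "eval2 [:fpol A, fpol B:] x y = 0"
proof -
  have x: "x ^ q = x" "y ^ q = y" using assms by (auto simp: F_iff)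
  have "eval2 [:fpol A, fpol B:] x y = poly (fpol A) (x ^ q) + y ^ q * poly (fpol B) (x ^ q)"
    by (simp add: x)
  also have "\<dots> = (eval2 [:A, B:] x y) ^ q"
    by (simp add: poly_fpol frob_add power_mult_distrib)
  finally show ?thesis using assms(1) frob_zero by simp
qed

lemma fpol_degree: "degree (fpol A) \<le> degree A"
  by (rule degree_le) (simp add: coeff_fpol coeff_eq_0 frob_zero)

lemma dAB_fpol: "dAB (fpol A) (fpol B) \<le> dAB A B"
proof (cases "B = 0")
  case True
  then show ?thesis using fpol_degree[of A] by (simp add: dAB_def fpol_def)
next
  case False
  then show ?thesis using fpol_degree[of A] fpol_degree[of B] by (auto simp: dAB_def)
qed

end

section \<open>Codewords vanishing on prescribed sets of rational points\<close>

locale zp2_code = conjugate_points a q x0 y0 k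
  for a :: "nat \<Rightarrow> 'b::field" and q :: nat and x0 y0 :: 'b and k :: nat +
  fixes p :: nat and g :: "'b point \<Rightarrow> nat \<times> nat"
  assumes prime_p: "prime p" and odd_p: "odd p" and p_dvd: "p dvd k" and k_bound: "2 * k < p\<^sup>2"
    and g_bij: "bij_betw g (rat_points a q) ({..<p} \<times> {..<p})"
    and g_add: "\<And>P R. P \<in> rat_points a q \<Longrightarrow> R \<in> rat_points a q \<Longrightarrow>
      g (ec_add a P R) = ((fst (g P) + fst (g R)) mod p, (snd (g P) + snd (g R)) mod p)"
begin

definition Ps :: "'b point set" where "Ps = rat_points a q"
definition C :: "('b point \<Rightarrow> 'b) set" where "C = AG_code a q Ps (Aff x0 y0) k"
definition cw :: "'b poly \<times> 'b poly \<Rightarrow> 'b point \<Rightarrow> 'b" where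
  "cw AB P = (if P \<in> Ps then val AB P else 0)"
definition zs :: "'b point set \<Rightarrow> bool" where
  "zs T \<longleftrightarrow> p dvd (\<Sum>P\<in>T. fst (g P)) \<and> p dvd (\<Sum>P\<in>T. snd (g P))"
definition Z :: "'b point set \<Rightarrow> ('b point \<Rightarrow> 'b) set" where
  "Z T = {c \<in> C. \<forall>P\<in>T. c P = 0}"

lemma finite_Ps: "finite Ps" and card_Ps: "card Ps = p\<^sup>2"
  using bij_betw_finite[OF g_bij] bij_betw_same_card[OF g_bij]
  by (simp_all add: Ps_def power2_eq_square)

lemma g_range: "P \<in> Ps \<Longrightarrow> fst (g P) < p \<and> snd (g P) < p"
  using bij_betw_apply[OF g_bij] by (fastforce simp: Ps_def)

lemma Inf_Ps: "Inf \<in> Ps" by (simp add: Ps_def rat_points_def)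

text \<open>\<open>Inf\<close> is its own double, and 0 is the only residue u with u = 2u modulo
  p.\<close>

lemma g_Inf: "g Inf = (0, 0)"
proof -
  have dbl: "u = 0" if "u < p" "u = (u + u) mod p" for u
  proof (cases "u + u < p")
    case False
    then have "(u + u) mod p = (u + u - p) mod p" by (simp add: le_mod_geq)
    also have "\<dots> = u + u - p" using that(1) by (intro mod_less) linarith
    finally have "(u + u) mod p = u + u - p" .
    then show ?thesis using that False by linarith
  qed (use that in auto)
  have "g Inf = ((fst (g Inf) + fst (g Inf)) mod p, (snd (g Inf) + snd (g Inf)) mod p)"
    using g_add[of Inf Inf] Inf_Ps by (simp add: ec_add_def Ps_def)
  then have "fst (g Inf) = 0" "snd (g Inf) = 0"
    using g_range[OF Inf_Ps] by (metis dbl fst_conv, metis dbl snd_conv)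
  then show ?thesis by (simp add: prod_eq_iff)
qed

lemma g_eq_0: "P \<in> Ps \<Longrightarrow> g P = (0, 0) \<longleftrightarrow> P = Inf"
  using g_bij Inf_Ps g_Inf by (auto simp: bij_betw_def inj_on_def Ps_def)

lemma Aff_Ps: "Aff x y \<in> Ps \<longleftrightarrow> on_aff a x y \<and> x \<in> F \<and> y \<in> F"
  by (auto simp: Ps_def rat_points_def)

lemma y0_notin: "y0 \<notin> F" "negy x0 y0 \<notin> F"
proof -
  show 1: "y0 \<notin> F" using frob_y0 Q_ne by (auto simp: F_iff)
  show "negy x0 y0 \<notin> F"
  proof
    assume "negy x0 y0 \<in> F"
    then have "negy x0 (negy x0 y0) \<in> F"
      unfolding negy_def[of x0 "negy x0 y0"] by (intro F.diff F.minus F.mult coeff_in_F x0)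
    then show False using 1 by simp
  qed
qed

lemma x_ne_x0: assumes "Aff x y \<in> Ps" shows "x - x0 \<noteq> 0"
proof
  assume "x - x0 = 0"
  then have "x = x0" by simp
  then have "y = y0 \<or> y = negy x0 y0" using same_x[OF Q_on] assms Aff_Ps by blast
  then show False using assms Aff_Ps y0_notin by blast
qed

lemma C_eq: "C = cw ` RR"
proof -
  have "AG_code a q Ps (Aff x0 y0) k = (\<lambda>AB P. if P \<in> Ps then val AB P else 0) ` RR"
    using y0_notin Aff_Ps
    by (intro AG_code_RR) (auto simp: Ps_def rat_points_def on_curve_def split: point.splits)
  then show ?thesis unfolding C_def cw_def by simp
qed

lemma val_Aff_0: "Aff x y \<in> Ps \<Longrightarrow> val (A, B) (Aff x y) = 0 \<longleftrightarrow> eval2 [:A, B:] x y = 0"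
  using x_ne_x0[of x y] by (simp add: val_def mult.commute)

definition pts :: "'b point set \<Rightarrow> ('b \<times> 'b) set" where "pts T = {(x, y). Aff x y \<in> T}"

lemma pts_image: "(\<lambda>(x, y). Aff x y) ` pts T = T - {Inf}"
proof (intro equalityI subsetI)
  fix P assume "P \<in> T - {Inf}"
  then show "P \<in> (\<lambda>(x, y). Aff x y) ` pts T" by (cases P) (auto simp: pts_def)
qed (auto simp: pts_def)

lemma inj_Aff: "inj_on (\<lambda>(x, y). Aff x y) S" by (auto simp: inj_on_def)

lemma pts_card: "card (pts T) = card (T - {Inf})"
  using card_image[OF inj_Aff, of "pts T"] pts_image by metis

lemma pts_list:
  assumes "T \<subseteq> Ps" obtains M where "distinct M" "set M = pts T" "length M = card (T - {Inf})"
proof -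
  have "finite (T - {Inf})" using assms finite_Ps finite_subset by blast
  then have "finite (pts T)" using finite_imageD[OF _ inj_Aff] pts_image by metis
  then obtain M where "set M = pts T" "distinct M" using finite_distinct_list by blast
  then show ?thesis using that pts_card distinct_card by metis
qed

lemma psum_rational:
  assumes "\<forall>(x, y)\<in>set M. Aff x y \<in> Ps"
  shows "psum M \<in> Ps \<and> g (psum M) = ((\<Sum>(x, y)\<leftarrow>M. fst (g (Aff x y))) mod p, (\<Sum>(x, y)\<leftarrow>M. snd (g (Aff x y))) mod p)"
  using assms
proof (induction M)
  case Nil
  then show ?case using Inf_Ps g_Inf by simp
next
  case (Cons P M)
  obtain x y where P: "P = (x, y)" by force
  have "Aff x y \<in> Ps" "psum M \<in> Ps" using Cons P by auto
  then show ?case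
    using Cons P rat_points_add[of "Aff x y" "psum M"] g_add[of "Aff x y" "psum M"]
    by (simp add: Ps_def mod_add_right_eq)
qed

text \<open>The list omits \<open>Inf\<close>, which has coordinates (0, 0) and so leaves the sum
  unchanged.\<close>

lemma zs_psum:
  assumes T: "T \<subseteq> Ps" and M: "distinct M" "set M = pts T"
  shows "psum M = Inf \<longleftrightarrow> zs T"
proof -
  have fT: "finite T" using T finite_Ps finite_subset by blast
  have sum: "(\<Sum>(x, y)\<leftarrow>M. f (g (Aff x y))) = (\<Sum>P\<in>T. f (g P))" if "f (0, 0) = 0" for f :: "nat \<times> nat \<Rightarrow> nat"
  proof -
    have "(\<Sum>(x, y)\<leftarrow>M. f (g (Aff x y))) = (\<Sum>P\<in>pts T. f (g (case P of (x, y) \<Rightarrow> Aff x y)))"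
      using M by (simp add: sum_list_distinct_conv_sum_set case_prod_beta)
    also have "\<dots> = (\<Sum>P\<in>T - {Inf}. f (g P))"
      unfolding pts_image[symmetric] by (simp add: sum.reindex[OF inj_Aff])
    also have "\<dots> = (\<Sum>P\<in>T. f (g P))"
      using fT that g_Inf by (intro sum.mono_neutral_left) auto
    finally show ?thesis .
  qed
  have "\<forall>(x, y)\<in>set M. Aff x y \<in> Ps" using M T by (auto simp: pts_def)
  then have "psum M \<in> Ps \<and> g (psum M) = ((\<Sum>P\<in>T. fst (g P)) mod p, (\<Sum>P\<in>T. snd (g P)) mod p)"
    using psum_rational[of M] by (simp only: sum fst_conv snd_conv)
  then show ?thesis using g_eq_0[of "psum M"] by (auto simp: zs_def)
qed

lemma dAB_le_2k: "dAB A B \<le> 2 * k \<longleftrightarrow> degree A \<le> k \<and> degree B \<le> k - 2"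
  using k2 by (cases "B = 0") (auto simp: dAB_def)

text \<open>Pole order 2k is reached only through x^k, and 2k - 1 only through x^(k-2) y; if that
  coefficient vanishes, the order drops.\<close>

lemma dAB_less:
  "dAB A B \<le> 2 * k \<Longrightarrow> coeff A k = 0 \<Longrightarrow> dAB A B \<le> 2 * k - 1"
  "dAB A B \<le> 2 * k - 1 \<Longrightarrow> coeff B (k - 2) = 0 \<Longrightarrow> dAB A B \<le> 2 * k - 2"
proof -
  have *: "degree D \<le> n \<Longrightarrow> coeff D n = 0 \<Longrightarrow> degree D < n \<or> D = 0" for D :: "'b poly" and n
    by (metis le_neq_implies_less leading_coeff_0_iff)
  show "dAB A B \<le> 2 * k \<Longrightarrow> coeff A k = 0 \<Longrightarrow> dAB A B \<le> 2 * k - 1"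
  proof -
    assume h: "dAB A B \<le> 2 * k" "coeff A k = 0"
    have "2 * degree B + 3 \<noteq> 2 * k" by presburger
    then show ?thesis using *[of A k] h k2 by (auto simp: dAB_def split: if_splits)
  qed
  assume h: "dAB A B \<le> 2 * k - 1" "coeff B (k - 2) = 0"
  have A: "2 * degree A \<le> 2 * k - 2"
  proof -
    have "2 * degree A \<le> 2 * k - 1" using h(1) by (simp add: dAB_def split: if_splits)
    then show ?thesis by presburger
  qed
  show "dAB A B \<le> 2 * k - 2"
  proof (cases "B = 0")
    case False
    then have "degree B \<le> k - 2" using h k2 by (auto simp: dAB_def)
    then have "degree B < k - 2" using *[of B "k - 2"] h False by blast
    then show ?thesis using A False by (simp add: dAB_def)
  qed (use A in \<open>simp add: dAB_def\<close>)
qed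

text \<open>A zero at \<open>Inf\<close> lowers the pole order by one and is the one zero missing
  from the list of affine points, so the balance of zeros and poles is the same in both
  cases.\<close>

lemma zeros_bound:
  assumes AB: "(A, B) \<in> RR" "(A, B) \<noteq> (0, 0)" and T: "T \<subseteq> Ps" and v: "\<forall>P\<in>T. val (A, B) P = 0"
  shows "card T \<le> 2 * k" "card T = 2 * k \<Longrightarrow> zs T"
proof -
  obtain M where M: "distinct M" "set M = pts T" "length M = card (T - {Inf})"
    using pts_list[OF T] by blast
  have on: "\<forall>P\<in>set M. on_aff a (fst P) (snd P)" using M(2) T Aff_Ps by (auto simp: pts_def)
  have "[:A, B:] \<in> IM M"
  proof (rule vanish_IM[OF M(1)])
    fix x y assume "(x, y) \<in> set M"
    then have "Aff x y \<in> T" using M(2) by (simp add: pts_def)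
    then show "eval2 [:A, B:] x y = 0" using v T val_Aff_0[of x y A B] by blast
  qed
  moreover have "\<not> eqE [:A, B:] 0" using AB(2) by (simp add: nz_AB)
  ultimately have len: "length M \<le> dAB A B" and eq: "dAB A B = length M \<Longrightarrow> psum M = Inf"
    using dg_in_IM[OF on, of "[:A, B:]"] by (auto simp only: dg_AB)
  have d: "dAB A B \<le> 2 * k" using AB(1) dAB_le_2k by (simp add: RR_def)
  have "card T \<le> 2 * k \<and> (card T = 2 * k \<longrightarrow> psum M = Inf)"
  proof (cases "Inf \<in> T")
    case False
    then have "length M = card T" using M(3) by simp
    then show ?thesis using len eq d by auto
  next
    case True
    then have "coeff A k = 0" using v by (auto simp: val_def)
    then have d': "dAB A B \<le> 2 * k - 1" using dAB_less(1)[OF d] by blast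
    have "finite T" using T finite_Ps finite_subset by blast
    then have "card T = Suc (length M)" using True M(3) by (metis card.remove)
    then show ?thesis using len eq d' k2 by auto
  qed
  then show "card T \<le> 2 * k" "card T = 2 * k \<Longrightarrow> zs T" using zs_psum[OF T M(1,2)] by auto
qed

text \<open>The function with divisor \<open>T - 2k \<infinity>\<close>, made monic, is unique and hence Galois invariant.\<close>
lemma zeros_exist:
  assumes T: "T \<subseteq> Ps" and card: "card T = 2 * k" and z: "zs T"
  shows "\<exists>AB\<in>RR. AB \<noteq> (0, 0) \<and> (\<forall>P\<in>T. val AB P = 0)"
proof -
  obtain M where M: "distinct M" "set M = pts T" "length M = card (T - {Inf})"
    using pts_list[OF T] by blast
  have on: "\<forall>P\<in>set M. on_aff a (fst P) (snd P)" using M(2) T Aff_Ps by (auto simp: pts_def)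
  have "psum M = Inf" using zs_psum[OF T M(1,2)] z by blast
  then obtain G where G: "G \<in> IM M" "\<not> eqE G 0" "dg G = length M" using ex_in_IM[OF on] by blast
  obtain A B where AB: "eqE G [:A, B:]" using reduce by blast
  have ABm: "[:A, B:] \<in> IM M" using idl_eqE[OF idl_IM G(1) eqE_sym[OF AB]] .
  have dm: "dAB A B = length M" using dg_eqE[OF AB] G(3) by (simp only: dg_AB)
  have fT: "finite T" using T finite_Ps finite_subset by blast
  \<comment> \<open>The leading coefficient for pole order exactly \<open>length M\<close>: that of
    x^k if this is 2k, that of x^(k-2) y if \<open>Inf\<close> takes one zero and it is 2k -
    1.\<close>
  define lam where "lam A B = (if Inf \<in> T then coeff B (k - 2) else coeff A k)" for A B :: "'b poly"
  have len: "length M = (if Inf \<in> T then 2 * k - 1 else 2 * k)"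
    using M(3) card fT by simp
  have less: "dAB A B < length M" if "dAB A B \<le> length M" "lam A B = 0" for A B
    using that dAB_less[of A B] k2 len by (cases "Inf \<in> T") (auto simp: lam_def)
  have nl: "lam A B \<noteq> 0" using less[of A B] dm by auto
  define t where "t = 1 / lam A B"
  define A1 where "A1 = smult t A"
  define B1 where "B1 = smult t B"
  have "lam A1 B1 = t * lam A B" by (simp add: lam_def A1_def B1_def)
  then have l1: "lam A1 B1 = 1" using nl by (simp add: t_def)
  have d1: "dAB A1 B1 \<le> length M" using dm l1 by (cases "t = 0") (auto simp: A1_def B1_def lam_def dAB_def)
  have m1: "[:A1, B1:] \<in> IM M"
    using idl_mult[OF idl_IM ABm, of "[:[:t:]:]"] by (simp add: A1_def B1_def)
  have m2: "[:fpol A1, fpol B1:] \<in> IM M"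
  proof (rule vanish_IM[OF M(1)])
    fix x y assume xy: "(x, y) \<in> set M"
    then have "on_aff a x y" "x \<in> F" "y \<in> F" using M(2) T Aff_Ps by (auto simp: pts_def)
    then show "eval2 [:fpol A1, fpol B1:] x y = 0" using fpol_vanish IM_vanish[OF m1 xy] by blast
  qed
  \<comment> \<open>Both functions are monic and vanish on \<open>T\<close>, so their difference has
    fewer poles than prescribed zeros and must be zero.\<close>
  let ?D = "[:A1 - fpol A1, B1 - fpol B1:]"
  have mD: "?D \<in> IM M" using idl_diff[OF idl_IM m1 m2] by simp
  have "dAB (A1 - fpol A1) (B1 - fpol B1) \<le> max (dAB A1 B1) (dAB (- fpol A1) (- fpol B1))"
    using dAB_add[of A1 "- fpol A1" B1 "- fpol B1"] by simp
  also have "dAB (- fpol A1) (- fpol B1) = dAB (fpol A1) (fpol B1)" by (simp add: dAB_def)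
  finally have "dAB (A1 - fpol A1) (B1 - fpol B1) \<le> length M"
    using d1 dAB_fpol[of A1 B1] by linarith
  moreover have "lam (A1 - fpol A1) (B1 - fpol B1) = 0"
    using l1 by (auto simp: lam_def coeff_fpol split: if_splits)
  ultimately have "dAB (A1 - fpol A1) (B1 - fpol B1) < length M" by (rule less)
  then have "eqE ?D 0" using dg_in_IM(1)[OF on mD] unfolding dg_AB by linarith
  then have fx: "fpol A1 = A1" "fpol B1 = B1" by (simp_all add: nz_AB)
  have d2: "dAB A1 B1 \<le> 2 * k" using d1 len by (auto split: if_splits)
  then have "(A1, B1) \<in> RR" using fx fpol_fixed dAB_le_2k by (simp add: RR_def)
  moreover have "(A1, B1) \<noteq> (0, 0)" using l1 by (auto simp: lam_def split: if_splits)
  moreover have "val (A1, B1) P = 0" if P: "P \<in> T" for P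
  proof (cases P)
    case Inf
    then have "dAB A1 B1 \<le> 2 * k - 1" using d1 len P by simp
    then have "degree A1 < k" using k2 by (auto simp: dAB_def split: if_splits)
    then show ?thesis using Inf by (simp add: val_def coeff_eq_0)
  next
    case (Aff x y)
    then have "(x, y) \<in> set M" "Aff x y \<in> Ps" using P M(2) T by (auto simp: pts_def)
    then show ?thesis using IM_vanish[OF m1] Aff_Ps val_Aff_0 Aff by blast
  qed
  ultimately show ?thesis by blast
qed

lemma RR_card: "card RR = q ^ (2 * k)" and finite_RR: "finite RR"
proof -
  have e: "RR = {A. (\<forall>i. coeff A i \<in> F) \<and> degree A \<le> k} \<times> {B. (\<forall>i. coeff B i \<in> F) \<and> degree B \<le> k - 2}"
    by (auto simp: RR_def)
  have "Suc k + Suc (k - 2) = 2 * k" using k2 by simp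
  then have "q ^ Suc k * q ^ Suc (k - 2) = q ^ (2 * k)" by (simp only: power_add[symmetric])
  then show "card RR = q ^ (2 * k)" unfolding e card_cartesian_product using card_poly_F by metis
  show "finite RR" unfolding e using card_poly_F by blast
qed

lemma RR_add: "(A, B) \<in> RR \<Longrightarrow> (A', B') \<in> RR \<Longrightarrow> (A + A', B + B') \<in> RR"
  by (auto simp: RR_def intro!: F.add degree_add_le)

lemma RR_smult: "t \<in> F \<Longrightarrow> (A, B) \<in> RR \<Longrightarrow> (smult t A, smult t B) \<in> RR"
  by (auto simp: RR_def intro!: F.mult intro: order_trans[OF degree_smult_le])

lemma RR_diff: "(A, B) \<in> RR \<Longrightarrow> (A', B') \<in> RR \<Longrightarrow> (A - A', B - B') \<in> RR"
  by (auto simp: RR_def intro!: F.diff degree_diff_le)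

lemma val_add: "val (A + A', B + B') P = val (A, B) P + val (A', B') P"
  by (cases P) (auto simp: val_def add_divide_distrib[symmetric] algebra_simps)

lemma val_diff: "val (A - A', B - B') P = val (A, B) P - val (A', B') P"
  by (cases P) (auto simp: val_def diff_divide_distrib[symmetric] algebra_simps)

lemma val_smult: "val (smult t A, smult t B) P = t * val (A, B) P"
  by (cases P) (auto simp: val_def algebra_simps)

text \<open>A nonzero difference would vanish at all p^2 > 2k rational points.\<close>

lemma inj_cw: "inj_on cw RR"
proof (rule inj_onI, rule ccontr)
  fix u v assume uv: "u \<in> RR" "v \<in> RR" "cw u = cw v" "u \<noteq> v"
  obtain A B A' B' where e: "u = (A, B)" "v = (A', B')" by (cases u, cases v)
  have "val u P = val v P" if "P \<in> Ps" for P using fun_cong[OF uv(3), of P] that by (simp add: cw_def)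
  then have "\<forall>P\<in>Ps. val (A - A', B - B') P = 0" by (simp add: val_diff e)
  then have "card Ps \<le> 2 * k"
    using uv e by (intro zeros_bound(1)[OF RR_diff[of A B A' B']]) auto
  then show False using card_Ps k_bound by simp
qed

lemma linear_C: "F.linear_code C"
  unfolding F.linear_code_def
proof (intro conjI ballI)
  show "finite C" using finite_RR by (simp add: C_eq)
  have "(0, 0) \<in> RR" by (simp add: RR_def F.zero)
  moreover have "cw (0, 0) = (\<lambda>_. 0)" by (auto simp: cw_def val_def fun_eq_iff split: point.splits)
  ultimately show "(\<lambda>_. 0) \<in> C" unfolding C_eq by (metis imageI)
next
  fix u v assume "u \<in> C" "v \<in> C"
  then obtain A B A' B' where *: "(A, B) \<in> RR" "(A', B') \<in> RR" "u = cw (A, B)" "v = cw (A', B')"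
    unfolding C_eq by auto
  have "(\<lambda>i. u i + v i) = cw (A + A', B + B')" using * by (auto simp: cw_def val_add)
  then show "(\<lambda>i. u i + v i) \<in> C" using RR_add * unfolding C_eq by blast
next
  fix t u assume "t \<in> F" "u \<in> C"
  then obtain A B where *: "(A, B) \<in> RR" "u = cw (A, B)" "t \<in> F"
    unfolding C_eq by auto
  have "(\<lambda>i. t * u i) = cw (smult t A, smult t B)" using * by (auto simp: cw_def val_smult)
  then show "(\<lambda>i. t * u i) \<in> C" using RR_smult * unfolding C_eq by blast
qed

lemma C_values: assumes "c \<in> C" "P \<in> Ps" shows "c P \<in> F"
proof -
  obtain A B where *: "(A, B) \<in> RR" "c = cw (A, B)" using assms unfolding C_eq by auto
  have "val (A, B) P \<in> F"
  proof (cases P)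
    case (Aff x y)
    then have "x \<in> F" "y \<in> F" using assms Aff_Ps by auto
    then show ?thesis using * Aff x0
      by (auto simp: val_def RR_def intro!: F.divide F.add F.mult F.power F.diff poly_F)
  qed (use * in \<open>auto simp: val_def RR_def\<close>)
  then show ?thesis using * assms by (simp add: cw_def)
qed

lemma card_C: "card C = q ^ (2 * k)"
  unfolding C_eq by (simp add: card_image[OF inj_cw] RR_card)

lemma Z_linear: "F.linear_code (Z T)"
  using linear_C unfolding F.linear_code_def Z_def by (auto intro: finite_subset[of _ C])

lemma Z_trivial:
  assumes T: "T \<subseteq> Ps" and h: "2 * k < card T \<or> (card T = 2 * k \<and> \<not> zs T)"
  shows "card (Z T) = 1"
proof -
  have "c = (\<lambda>_. 0)" if c: "c \<in> Z T" for c
  proof -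
    obtain A B where *: "(A, B) \<in> RR" "c = cw (A, B)" using c unfolding Z_def C_eq by auto
    have "\<forall>P\<in>T. val (A, B) P = 0" using c * T unfolding Z_def by (auto simp: cw_def subset_iff)
    then have "(A, B) = (0, 0)" using zeros_bound[OF *(1) _ T] h by force
    then show ?thesis using * by (auto simp: cw_def val_def fun_eq_iff split: point.splits)
  qed
  moreover have "(\<lambda>_. 0) \<in> Z T" using linear_C by (simp add: Z_def F.linear_code_def)
  ultimately have "Z T = {\<lambda>_. 0}" by blast
  then show ?thesis by simp
qed

lemma Z_step: assumes "s \<in> Ps" shows "card (Z T) \<le> q * card (Z (insert s T))"
proof -
  have "F.functional (Z T) (\<lambda>c. c s)"
    unfolding F.functional_def using C_values assms by (auto simp: Z_def)
  from F.card_kernel_le[OF Z_linear this] have "card (Z T) \<le> q * card {v \<in> Z T. v s = 0}"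
    by (simp add: card_F)
  also have "{v \<in> Z T. v s = 0} = Z (insert s T)" by (auto simp: Z_def)
  finally show ?thesis .
qed

lemma Z_chain:
  assumes "finite S" "S \<subseteq> Ps" shows "card (Z T) \<le> q ^ card S * card (Z (S \<union> T))"
  using assms
proof (induction S)
  case (insert s S)
  have "card (Z T) \<le> q ^ card S * card (Z (S \<union> T))" using insert by simp
  also have "\<dots> \<le> q ^ card S * (q * card (Z (insert s (S \<union> T))))"
    using insert.prems by (intro mult_left_mono Z_step) auto
  finally show ?case using insert.hyps by (simp add: mult_ac)
qed simp

lemma Z_zero_sum: assumes "T \<subseteq> Ps" "card T = 2 * k" "zs T" shows "card (Z T) \<ge> q"
proof -
  obtain AB where AB: "AB \<in> RR" "AB \<noteq> (0, 0)" "\<forall>P\<in>T. val AB P = 0" using zeros_exist[OF assms] by blast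
  have 0: "(0, 0) \<in> RR" by (simp add: RR_def F.zero)
  have "cw AB \<noteq> cw (0, 0)" using inj_cw AB 0 by (auto simp: inj_on_def)
  moreover have "cw (0, 0) = (\<lambda>_. 0)" by (auto simp: cw_def val_def fun_eq_iff split: point.splits)
  ultimately obtain P where P: "cw AB P \<noteq> 0" by auto
  have m: "cw AB \<in> Z T" using AB assms by (auto simp: Z_def C_eq cw_def)
  have "inj_on (\<lambda>t P. t * cw AB P) F"
  proof (rule inj_onI)
    fix s t assume "(\<lambda>P. s * cw AB P) = (\<lambda>P. t * cw AB P)"
    then show "s = t" using P by (metis mult_right_cancel)
  qed
  moreover have "(\<lambda>t P. t * cw AB P) ` F \<subseteq> Z T" using Z_linear[of T] m unfolding F.linear_code_def by blast
  moreover have "finite (Z T)" using Z_linear unfolding F.linear_code_def by blast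
  ultimately show ?thesis using card_inj_on_le card_F by metis
qed

text \<open>Different added points give different sums, so at most one of them completes
  \<open>T\<close> to a zero-sum set, while at least two are available.\<close>

lemma non_zero_sum_extension:
  assumes T: "T \<subseteq> Ps" and card: "card T + 2 \<le> p\<^sup>2"
  shows "\<exists>s\<in>Ps - T. \<not> zs (insert s T)"
proof (rule ccontr)
  assume h: "\<not> ?thesis"
  have fT: "finite T" using T finite_Ps finite_subset by blast
  have "card (Ps - T) \<ge> 2" using card card_Ps card_Diff_subset[OF fT T] by simp
  then have "Ps - T \<noteq> {}" by (metis card.empty not_numeral_le_zero)
  then obtain s where s: "s \<in> Ps - T" by blast
  have "card (Ps - T - {s}) \<ge> 1" using \<open>card (Ps - T) \<ge> 2\<close> s by simp
  then have "Ps - T - {s} \<noteq> {}" by (metis card.empty not_one_le_zero)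
  then obtain s' where s': "s' \<in> Ps - T" "s' \<noteq> s" by blast
  have z: "zs (insert s T)" "zs (insert s' T)" using h s s' by blast+
  have c: "u = v" if "p dvd u + w" "p dvd v + w" "u < p" "v < p" for u v w :: nat
  proof -
    have "int p dvd int (u + w) - int (v + w)"
      using that by (intro dvd_diff) (simp_all only: int_dvd_int_iff)
    then have "int p dvd int u - int v" by simp
    then have "int u mod int p = int v mod int p" by (simp only: mod_eq_dvd_iff)
    then show ?thesis using that by simp
  qed
  have "fst (g s) = fst (g s')" "snd (g s) = snd (g s')"
    using z s s' fT g_range[of s] g_range[of s'] c unfolding zs_def by auto
  then have "g s = g s'" by (simp add: prod_eq_iff)
  then show False using s s' g_bij by (auto simp: bij_betw_def inj_on_def Ps_def)
qed

lemma k_pos: "k > 0" using k2 by simp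

text \<open>Each further vanishing condition divides the number of codewords by at most q. Starting
  from all of \<open>C\<close> gives the lower bound. For the upper bound, \<open>T\<close> is
  enlarged to a set of size 2k with nonzero sum, on which only the zero word vanishes.\<close>

theorem card_Z:
  assumes T: "T \<subseteq> Ps"
  shows "card (Z T) = (if card T < 2 * k then q ^ (2 * k - card T)
     else if card T = 2 * k \<and> zs T then q else 1)"
proof -
  have fT: "finite T" using T finite_Ps finite_subset by blast
  have q0: "q > 0" using q_gt_1 by simp
  have lower: "q ^ (2 * k - card T) \<le> card (Z T)" if "card T < 2 * k"
  proof -
    have "q ^ (2 * k - card T) * q ^ card T = card C"
      using that by (simp add: card_C power_add[symmetric])
    also have "C = Z {}" by (simp add: Z_def)
    also have "card (Z {}) \<le> card (Z T) * q ^ card T" using Z_chain[OF fT T, of "{}"] by (simp add: mult.commute)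
    finally show ?thesis using q0 by simp
  qed
  have upper: "card (Z T) \<le> q ^ (2 * k - card T)" if lt: "card T < 2 * k"
  proof -
    \<comment> \<open>One place is kept free for a last point that prevents the sum from being
      zero.\<close>
    have "2 * k - 1 - card T \<le> card (Ps - T)"
      using k_bound card_Ps card_Diff_subset[OF fT T] by simp
    then obtain S where S: "S \<subseteq> Ps - T" "card S = 2 * k - 1 - card T" "finite S"
      by (rule obtain_subset_with_card_n)
    have "card (S \<union> T) = card S + card T" using S fT by (intro card_Un_disjoint) auto
    then have c: "card (S \<union> T) = 2 * k - 1" using S lt by simp
    have sub: "S \<union> T \<subseteq> Ps" using S T by blast
    obtain s where s: "s \<in> Ps - (S \<union> T)" "\<not> zs (insert s (S \<union> T))"
      using non_zero_sum_extension[OF sub] c k_bound k_pos by auto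
    have "card (insert s (S \<union> T)) = 2 * k" using s S fT c k_pos by simp
    then have 1: "card (Z (insert s (S \<union> T))) = 1" using s sub by (intro Z_trivial) auto
    have fS: "finite (insert s S)" "insert s S \<subseteq> Ps" using S s by auto
    have "card (Z T) \<le> q ^ card (insert s S) * card (Z (insert s S \<union> T))" by (rule Z_chain[OF fS])
    also have "\<dots> = q ^ (2 * k - card T)" using 1 s S lt by (simp add: Suc_diff_Suc)
    finally show ?thesis .
  qed
  have "card (Z T) = q" if z: "card T = 2 * k" "zs T"
  proof -
    have "card T < card Ps" using z(1) k_bound card_Ps by simp
    then obtain s where s: "s \<in> Ps" "s \<notin> T" using T by (metis less_irrefl subset_antisym subsetI)
    have "card (Z (insert s T)) = 1" using s T fT z by (intro Z_trivial) auto
    then have "card (Z T) \<le> q" using Z_step[OF s(1), of T] by simp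
    then show ?thesis using Z_zero_sum[OF T z] by simp
  qed
  moreover have "card (Z T) = q ^ (2 * k - card T)" if "card T < 2 * k"
    using lower[OF that] upper[OF that] by (rule le_antisym[rotated])
  moreover have "card (Z T) = 1" if "\<not> card T < 2 * k" "\<not> (card T = 2 * k \<and> zs T)"
    using that by (intro Z_trivial[OF T]) linarith
  ultimately show ?thesis by simp
qed

definition Cd :: "('b point \<Rightarrow> 'b) set" where "Cd = dual_code F Ps C"

lemma finite_Cd: "finite Cd"
proof -
  have "Cd \<subseteq> {f. \<forall>x. (x \<in> Ps \<longrightarrow> f x \<in> F) \<and> (x \<notin> Ps \<longrightarrow> f x = 0)}"
    by (auto simp: Cd_def dual_code_def)
  then show ?thesis using finite_set_of_finite_funs[OF finite_Ps finite_F] finite_subset by blast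
qed

text \<open>\<open>card_dual_support\<close> is applied to the complement of \<open>S\<close>. Hence
  the exceptional sets of the dual code are the complements of the zero-sum sets of size 2k.\<close>

lemma card_Cd_zeros:
  assumes S: "S \<subseteq> Ps"
  shows "card {v \<in> Cd. \<forall>i\<in>S. v i = 0} = (if card S < p\<^sup>2 - 2 * k then q ^ (p\<^sup>2 - 2 * k - card S)
     else if card S = p\<^sup>2 - 2 * k \<and> zs (Ps - S) then q else 1)"
proof -
  let ?T = "Ps - S"
  let ?D = "{v \<in> Cd. \<forall>i\<in>S. v i = 0}"
  have fS: "finite S" using S finite_Ps finite_subset by blast
  have cS: "card S \<le> p\<^sup>2" using card_mono[OF finite_Ps S] card_Ps by simp
  have cT: "card ?T = p\<^sup>2 - card S" using card_Diff_subset[OF fS S] card_Ps by simp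
  have q0: "q > 0" using q_gt_1 by simp
  have "Ps - ?T = S" using S by blast
  then have "card ?D * q ^ (2 * k) = q ^ card ?T * card (Z ?T)"
    using F.card_dual_support[of C Ps ?T] linear_C C_values finite_Ps
    by (simp add: Cd_def Z_def card_F card_C)
  moreover have "q ^ card ?T * card (Z ?T) = (if card S < p\<^sup>2 - 2 * k then q ^ (p\<^sup>2 - 2 * k - card S)
     else if card S = p\<^sup>2 - 2 * k \<and> zs (Ps - S) then q else 1) * q ^ (2 * k)"
  proof -
    consider "card S < p\<^sup>2 - 2 * k" | "card S = p\<^sup>2 - 2 * k" | "card S > p\<^sup>2 - 2 * k" by linarith
    then show ?thesis
    proof cases
      case 1
      then have "card ?T > 2 * k" "card ?T = (p\<^sup>2 - 2 * k - card S) + 2 * k" using cT k_bound by auto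
      then have "q ^ card ?T = q ^ (p\<^sup>2 - 2 * k - card S) * q ^ (2 * k)" by (metis power_add)
      moreover have "card (Z ?T) = 1" using \<open>card ?T > 2 * k\<close> by (simp add: card_Z)
      ultimately show ?thesis using 1 by simp
    next
      case 2
      then have "card ?T = 2 * k" using cT k_bound by auto
      then show ?thesis using 2 by (simp add: card_Z)
    next
      case 3
      then have "card ?T < 2 * k" using cT cS k_bound by auto
      then show ?thesis using 3 by (simp add: card_Z power_add[symmetric])
    qed
  qed
  ultimately show ?thesis using q0 by simp
qed

definition N :: nat where "N = card {T. T \<subseteq> Ps \<and> card T = 2 * k \<and> zs T}"

lemma N_complement: "card {S. S \<subseteq> Ps \<and> card S = p\<^sup>2 - 2 * k \<and> zs (Ps - S)} = N"
proof -
  have compl: "card (Ps - S) = p\<^sup>2 - card S" if "S \<subseteq> Ps" for S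
    using that finite_Ps finite_subset card_Diff_subset[of S Ps] card_Ps by metis
  have "bij_betw (\<lambda>S. Ps - S) {S. S \<subseteq> Ps \<and> card S = p\<^sup>2 - 2 * k \<and> zs (Ps - S)}
     {T. T \<subseteq> Ps \<and> card T = 2 * k \<and> zs T}"
    by (rule bij_betw_byWitness[of _ "\<lambda>S. Ps - S"]) (use compl k_bound in \<open>auto simp: double_diff\<close>)
  then show ?thesis unfolding N_def by (rule bij_betw_same_card)
qed

lemma N_value: "N * p\<^sup>2 = (p\<^sup>2 choose (2 * k)) + (p\<^sup>2 - 1) * (p choose (2 * k div p))"
proof -
  let ?G = "{..<p} \<times> {..<p}"
  have inj: "inj_on g Ps" and im: "g ` Ps = ?G" using g_bij by (auto simp: bij_betw_def Ps_def)
  have sum: "(\<Sum>u\<in>g ` T. f u) = (\<Sum>P\<in>T. f (g P))" "card (g ` T) = card T" if "T \<subseteq> Ps" for T and f :: "nat \<times> nat \<Rightarrow> nat"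
    using inj_on_subset[OF inj that] by (simp_all add: sum.reindex card_image)
  have "bij_betw (\<lambda>T. g ` T) {T. T \<subseteq> Ps \<and> card T = 2 * k \<and> zs T}
     {T. T \<subseteq> ?G \<and> card T = 2 * k \<and> p dvd (\<Sum>u\<in>T. fst u) \<and> p dvd (\<Sum>u\<in>T. snd u)}"
    unfolding bij_betw_def
  proof (intro conjI equalityI subsetI)
    show "inj_on (\<lambda>T. g ` T) {T. T \<subseteq> Ps \<and> card T = 2 * k \<and> zs T}"
      by (rule inj_onI) (use inj in \<open>auto simp: inj_on_image_eq_iff\<close>)
  next
    fix U assume "U \<in> (\<lambda>T. g ` T) ` {T. T \<subseteq> Ps \<and> card T = 2 * k \<and> zs T}"
    then show "U \<in> {T. T \<subseteq> ?G \<and> card T = 2 * k \<and> p dvd (\<Sum>u\<in>T. fst u) \<and> p dvd (\<Sum>u\<in>T. snd u)}"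
      using im by (auto simp: sum zs_def)
  next
    fix U assume U: "U \<in> {T. T \<subseteq> ?G \<and> card T = 2 * k \<and> p dvd (\<Sum>u\<in>T. fst u) \<and> p dvd (\<Sum>u\<in>T. snd u)}"
    then obtain T where T: "T \<subseteq> Ps" "U = g ` T" using im by (metis (no_types, lifting) mem_Collect_eq subset_imageE)
    then show "U \<in> (\<lambda>T. g ` T) ` {T. T \<subseteq> Ps \<and> card T = 2 * k \<and> zs T}"
      using U by (auto simp: sum zs_def)
  qed
  then have "N = card {T. T \<subseteq> ?G \<and> card T = 2 * k \<and> p dvd (\<Sum>u\<in>T. fst u) \<and> p dvd (\<Sum>u\<in>T. snd u)}"
    unfolding N_def by (rule bij_betw_same_card)
  then show ?thesis using card_zero_sum_subsets[OF prime_p odd_p, of "2 * k"] p_dvd by simp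
qed

lemma C_moments:
  "(\<Sum>w\<le>p\<^sup>2. wdist Ps C w * ((p\<^sup>2 - w) choose m)) =
      (p\<^sup>2 choose m) * (if m < 2 * k then q ^ (2 * k - m) else 1) + (if m = 2 * k then (q - 1) * N else 0)"
  using nmds_moments[OF finite_Ps, of C q "2 * k" zs m] card_Z linear_C q_gt_1
  by (simp add: card_Ps Z_def N_def F.linear_code_def)

lemmas C_distribution = nmds_weight_distribution[OF k_bound C_moments]

lemma Cd_distribution:
  "wdist Ps Cd (2 * k) = (q - 1) * N"
  "s \<in> {1..p\<^sup>2 - 2 * k} \<Longrightarrow> int (wdist Ps Cd (2 * k + s)) =
          int (p\<^sup>2 choose (2 * k + s)) * (\<Sum>j<s. (-1)^j * int ((2 * k + s) choose j) * (int q ^ (s - j) - 1))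
          + (-1)^s * int ((p\<^sup>2 - 2 * k) choose s) * int ((q - 1) * N)"
proof -
  let ?K = "p\<^sup>2 - 2 * k"
  have K: "?K < p\<^sup>2" "p\<^sup>2 - ?K = 2 * k" using k_bound k_pos by auto
  have "(\<Sum>w\<le>p\<^sup>2. wdist Ps Cd w * ((p\<^sup>2 - w) choose m)) =
      (p\<^sup>2 choose m) * (if m < ?K then q ^ (?K - m) else 1) + (if m = ?K then (q - 1) * N else 0)" for m
    using nmds_moments[OF finite_Ps finite_Cd, of q ?K "\<lambda>S. zs (Ps - S)" m] card_Cd_zeros q_gt_1
    unfolding N_complement card_Ps by simp
  note d = nmds_weight_distribution[OF K(1) this, unfolded K(2)]
  show "wdist Ps Cd (2 * k) = (q - 1) * N" by (rule d(1))
  assume s: "s \<in> {1..?K}"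
  then have "?K - s \<le> p\<^sup>2" "p\<^sup>2 - (?K - s) = 2 * k + s" using k_bound by auto
  then have "p\<^sup>2 choose (?K - s) = p\<^sup>2 choose (2 * k + s)" using binomial_symmetric[of "?K - s" "p\<^sup>2"] by simp
  then show "int (wdist Ps Cd (2 * k + s)) =
          int (p\<^sup>2 choose (2 * k + s)) * (\<Sum>j<s. (-1)^j * int ((2 * k + s) choose j) * (int q ^ (s - j) - 1))
          + (-1)^s * int ((p\<^sup>2 - 2 * k) choose s) * int ((q - 1) * N)"
    using d(2)[OF s] by simp
qed

end

section \<open>Coordinates from the group isomorphism, and the final theorem\<close>

lemma DirProd_coordinates:
  fixes a :: "nat \<Rightarrow> 'b::field"
  assumes p: "p > 0" and grp: "ec_group a q \<cong> DirProd (integer_mod_group p) (integer_mod_group p)"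
  obtains g where "bij_betw g (rat_points a q) ({..<p} \<times> {..<p})"
    "\<And>P R. P \<in> rat_points a q \<Longrightarrow> R \<in> rat_points a q \<Longrightarrow>
      g (ec_add a P R) = ((fst (g P) + fst (g R)) mod p, (snd (g P) + snd (g R)) mod p)"
proof -
  let ?H = "DirProd (integer_mod_group p) (integer_mod_group p)"
  obtain h where h: "h \<in> iso (ec_group a q) ?H" using grp by (auto simp: is_iso_def)
  have cH: "carrier ?H = {0..<int p} \<times> {0..<int p}" using p by (simp add: DirProd_def carrier_integer_mod_group)
  have bij: "bij_betw h (rat_points a q) ({0..<int p} \<times> {0..<int p})"
    using h cH by (auto simp: iso_def ec_group_def)
  have hom: "h (ec_add a P R) = ((fst (h P) + fst (h R)) mod int p, (snd (h P) + snd (h R)) mod int p)"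
    if "P \<in> rat_points a q" "R \<in> rat_points a q" for P R
    using h that by (auto simp: iso_def hom_def ec_group_def DirProd_def case_prod_beta)
  have rng: "fst (h P) \<in> {0..<int p} \<and> snd (h P) \<in> {0..<int p}" if "P \<in> rat_points a q" for P
    using bij_betw_apply[OF bij that] by auto
  define g where "g P = (nat (fst (h P)), nat (snd (h P)))" for P
  \<comment> \<open>\<open>integer_mod_group p\<close> has the integers from 0 to p - 1 as carrier;
    the counting of subsets uses natural numbers.\<close>
  have "bij_betw (\<lambda>u. (nat (fst u), nat (snd u))) ({0..<int p} \<times> {0..<int p}) ({..<p} \<times> {..<p})"
    by (rule bij_betw_byWitness[of _ "\<lambda>u. (int (fst u), int (snd u))"]) auto
  from bij_betw_trans[OF bij this] have "bij_betw g (rat_points a q) ({..<p} \<times> {..<p})"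
    by (simp only: g_def[abs_def] o_def)
  moreover have "g (ec_add a P R) = ((fst (g P) + fst (g R)) mod p, (snd (g P) + snd (g R)) mod p)"
    if "P \<in> rat_points a q" "R \<in> rat_points a q" for P R
    using hom[OF that] rng[OF that(1)] rng[OF that(2)]
    by (simp add: g_def nat_mod_distrib nat_add_distrib)
  ultimately show ?thesis using that by blast
qed

theorem mainTheorem8:
  fixes a :: "nat \<Rightarrow> 'b::field" and q p k :: nat and Q :: "'b point"
  assumes closed: "alg_closed_field TYPE('b)"
    and qpow: "\<exists>l e. prime l \<and> e > 0 \<and> q = l ^ e \<and> of_nat l = (0::'b)"
    and q7: "q \<ge> 7"
    and pprime: "prime p" and podd: "odd p"
    and coeffs: "\<forall>i\<in>{1,2,3,4,6}. a i \<in> Fsub q"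
    and nonsing: "nonsingular a"
    and grp: "ec_group a q \<cong> DirProd (integer_mod_group p) (integer_mod_group p)"
    and Qin: "Q \<in> rat_points a (q^2) - rat_points a q"
    and Qsum: "ec_add a Q (frob q Q) = Inf"
    and kdvd: "p dvd k" and kpos: "0 < k" and kbound: "2 * k < p^2"
  defines "Ps \<equiv> rat_points a q"
  defines "C \<equiv> AG_code a q Ps Q k"
  defines "Cd \<equiv> dual_code (Fsub q) Ps C"
  defines "A \<equiv> wdist Ps C" and "Ad \<equiv> wdist Ps Cd"
  shows "A (p^2 - 2*k) = Ad (2*k)
    \<and> real (A (p^2 - 2*k)) = real ((q - 1) * ((p^2 choose (2*k)) + (p^2 - 1) * (p choose (2*k div p)))) / real (p^2)
    \<and> (\<forall>s\<in>{1..2*k}. int (A (p^2 - 2*k + s)) =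
          int (p^2 choose (2*k - s)) * (\<Sum>j<s. (-1)^j * int ((p^2 - 2*k + s) choose j) * (int q ^ (s - j) - 1))
          + (-1)^s * int ((2*k) choose s) * int (A (p^2 - 2*k)))
    \<and> (\<forall>s\<in>{1..p^2 - 2*k}. int (Ad (2*k + s)) =
          int (p^2 choose (2*k + s)) * (\<Sum>j<s. (-1)^j * int ((2*k + s) choose j) * (int q ^ (s - j) - 1))
          + (-1)^s * int ((p^2 - 2*k) choose s) * int (Ad (2*k)))"
proof -
  obtain x0 y0 where Q: "Q = Aff x0 y0" using Qin by (cases Q) (auto simp: rat_points_def)
  interpret elliptic_fq a q
    using closed nonsing qpow coeffs by unfold_locales (auto simp: alg_closed_field_def)
  have on: "on_aff a x0 y0" using Qin Q by (auto simp: rat_points_def)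
  \<comment> \<open>The sum of two affine points is \<open>Inf\<close> only in the branch for
    opposite points, which yields both equations.\<close>
  have s: "x0 = x0 ^ q \<and> y0 + y0 ^ q + a 1 * x0 ^ q + a 3 = 0"
    using Qsum unfolding Q frob_def point.case ec_add_def Let_def by (auto split: if_splits)
  then have xF: "x0 \<in> Fsub q" by (simp add: Fsub_def)
  have "y0 ^ q + (y0 + a 1 * x0 + a 3) = 0" using s by (metis add.assoc add.commute)
  then have "y0 ^ q = - (y0 + a 1 * x0 + a 3)" by (simp only: eq_neg_iff_add_eq_0)
  then have yq: "y0 ^ q = negy x0 y0" by (simp add: negy_def)
  have "y0 \<notin> Fsub q" using Qin Q on xF by (auto simp: rat_points_def)
  then have ne: "negy x0 y0 \<noteq> y0" using yq by (simp add: Fsub_def)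
  \<comment> \<open>A positive multiple of a prime is at least 2, which makes the degree bound k - 2
    in \<open>RR\<close> a genuine subtraction.\<close>
  have "p \<ge> 2" "p \<le> k" using pprime kdvd kpos by (auto simp: prime_ge_2_nat dvd_imp_le)
  then interpret conjugate_points a q x0 y0 k
    using xF on ne yq by unfold_locales auto
  obtain g where g: "bij_betw g (rat_points a q) ({..<p} \<times> {..<p})"
    "\<And>P R. P \<in> rat_points a q \<Longrightarrow> R \<in> rat_points a q \<Longrightarrow>
      g (ec_add a P R) = ((fst (g P) + fst (g R)) mod p, (snd (g P) + snd (g R)) mod p)"
    using DirProd_coordinates[OF _ grp] pprime prime_gt_0_nat by metis
  interpret Z: zp2_code a q x0 y0 k p g
    using pprime podd kdvd kbound g by unfold_locales auto
  have e: "Ps = Z.Ps" "C = Z.C" "Cd = Z.Cd"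
    by (simp_all add: Ps_def C_def Cd_def Z.Ps_def Z.C_def Z.Cd_def Q)
  have A: "A (p\<^sup>2 - 2 * k) = (q - 1) * Z.N" and Ad: "Ad (2 * k) = (q - 1) * Z.N"
    unfolding A_def Ad_def e by (rule Z.C_distribution(1), rule Z.Cd_distribution(1))
  have "real ((q - 1) * Z.N) * real (p\<^sup>2) = real ((q - 1) * (Z.N * p\<^sup>2))" by simp
  then have "real (A (p\<^sup>2 - 2 * k)) * real (p\<^sup>2) =
     real ((q - 1) * ((p\<^sup>2 choose (2 * k)) + (p\<^sup>2 - 1) * (p choose (2 * k div p))))"
    unfolding A Z.N_value .
  moreover have "real (p\<^sup>2) \<noteq> 0" using \<open>p \<ge> 2\<close> by simp
  ultimately have "real (A (p\<^sup>2 - 2 * k)) =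
     real ((q - 1) * ((p\<^sup>2 choose (2 * k)) + (p\<^sup>2 - 1) * (p choose (2 * k div p)))) / real (p\<^sup>2)"
    by (metis nonzero_eq_divide_eq)
  then show ?thesis
    using Z.C_distribution(2) Z.Cd_distribution(2) unfolding A Ad unfolding A_def Ad_def e by blast
qed

end
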